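(* Let $n$ be a positive integer and let $H_{0,c}$ be the rational Cherednik algebra attached to $G=S_n$, $V=\mathfrak{h}\oplus\mathfrak{h}^*$, $\mathfrak{h}=\mathbb{C}^n$, with $t=0$ and parameter $c\in\mathbb{C}$. If $c\neq0$, then every irreducible representation of $H_{0,c}$ has dimension $n!$ and is isomorphic, as a representation of $S_n$, to the regular representation of $S_n$.
   Context: $H_{0,c}$ is the quotient of the semidirect product $S_n\ltimes\mathbb{C}\langle x_1,\dots,x_n,y_1,\dots,y_n\rangle$ (free algebra, with $S_n$ permuting the $x_i$ and the $y_i$) by the relations $[x_i,x_j]=[y_i,y_j]=0$ for all $i,j$; $[y_i,x_j]=c\,s_{ij}$ for $i\ne j$; $[y_i,x_i]=-c\sum_{j\neq i}s_{ij}$, where $s_{ij}$ is the transposition of $i$ and $j$. *)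

theory Defs
  imports Complex_Main "HOL-Algebra.QuotRing" "HOL-Algebra.Sym_Groups"
begin

section \<open>Complex monoid algebras\<close>

text \<open>Elements of $\mathbb{C}[M]$ are the finitely supported functions on the carrier of
  \<open>M\<close> (extended by zero to the whole type), with convolution as product.\<close>

definition monoid_algebra :: "('m, 'e) monoid_scheme \<Rightarrow> ('m \<Rightarrow> complex) ring" where
  "monoid_algebra M =
    \<lparr> carrier = {f. finite {m. f m \<noteq> 0} \<and> {m. f m \<noteq> 0} \<subseteq> carrier M},
      monoid.mult = (\<lambda>f g m. \<Sum>p | f p \<noteq> 0. \<Sum>q | g q \<noteq> 0. if p \<otimes>\<^bsub>M\<^esub> q = m then f p * g q else 0),
      one = (\<lambda>m. if m = \<one>\<^bsub>M\<^esub> then 1 else 0),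
      ring.zero = (\<lambda>m. 0),
      add = (\<lambda>f g m. f m + g m) \<rparr>"

definition basis_elem :: "'m \<Rightarrow> 'm \<Rightarrow> complex" where
  "basis_elem p = (\<lambda>m. if m = p then 1 else 0)"

definition scalar_elem :: "('m, 'e) monoid_scheme \<Rightarrow> complex \<Rightarrow> 'm \<Rightarrow> complex" where
  "scalar_elem M a = (\<lambda>m. if m = \<one>\<^bsub>M\<^esub> then a else 0)"

lemma monoid_algebra_mult_superset:
  assumes "finite A" "finite B" "{m. f m \<noteq> 0} \<subseteq> A" "{m. g m \<noteq> 0} \<subseteq> B"
  shows "(f \<otimes>\<^bsub>monoid_algebra M\<^esub> g) m =
    (\<Sum>p\<in>A. \<Sum>q\<in>B. if p \<otimes>\<^bsub>M\<^esub> q = m then f p * g q else 0)"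
proof -
  have "(\<Sum>q | g q \<noteq> 0. if p \<otimes>\<^bsub>M\<^esub> q = m then f p * g q else 0) =
        (\<Sum>q\<in>B. if p \<otimes>\<^bsub>M\<^esub> q = m then f p * g q else 0)" for p
    using assms by (intro sum.mono_neutral_left) auto
  moreover have "(\<Sum>p | f p \<noteq> 0. \<Sum>q\<in>B. if p \<otimes>\<^bsub>M\<^esub> q = m then f p * g q else 0) =
        (\<Sum>p\<in>A. \<Sum>q\<in>B. if p \<otimes>\<^bsub>M\<^esub> q = m then f p * g q else 0)"
    using assms by (intro sum.mono_neutral_left ballI sum.neutral) auto
  ultimately show ?thesis
    by (simp add: monoid_algebra_def)
qed

lemma monoid_algebra_mult_support:
  "{m. (f \<otimes>\<^bsub>monoid_algebra M\<^esub> g) m \<noteq> 0}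
    \<subseteq> (\<lambda>(p, q). p \<otimes>\<^bsub>M\<^esub> q) ` ({m. f m \<noteq> 0} \<times> {m. g m \<noteq> 0})"
proof
  fix m assume "m \<in> {m. (f \<otimes>\<^bsub>monoid_algebra M\<^esub> g) m \<noteq> 0}"
  then have *: "(\<Sum>p | f p \<noteq> 0. \<Sum>q | g q \<noteq> 0. if p \<otimes>\<^bsub>M\<^esub> q = m then f p * g q else 0) \<noteq> 0"
    by (simp add: monoid_algebra_def)
  then obtain p where p: "f p \<noteq> 0"
    and **: "(\<Sum>q | g q \<noteq> 0. if p \<otimes>\<^bsub>M\<^esub> q = m then f p * g q else 0) \<noteq> 0"
    by (rule sum.not_neutral_contains_not_neutral) simp
  from ** obtain q where "g q \<noteq> 0" "p \<otimes>\<^bsub>M\<^esub> q = m"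
    by (rule sum.not_neutral_contains_not_neutral) (simp split: if_splits)
  with p show "m \<in> (\<lambda>(p, q). p \<otimes>\<^bsub>M\<^esub> q) ` ({m. f m \<noteq> 0} \<times> {m. g m \<noteq> 0})"
    by (auto intro!: image_eqI[where x = "(p, q)"])
qed

lemma monoid_algebra_mult_closed:
  assumes "monoid M" "f \<in> carrier (monoid_algebra M)" "g \<in> carrier (monoid_algebra M)"
  shows "f \<otimes>\<^bsub>monoid_algebra M\<^esub> g \<in> carrier (monoid_algebra M)"
proof -
  let ?S = "(\<lambda>(p, q). p \<otimes>\<^bsub>M\<^esub> q) ` ({m. f m \<noteq> 0} \<times> {m. g m \<noteq> 0})"
  have "finite ?S" "?S \<subseteq> carrier M"
    using assms monoid.m_closed[OF \<open>monoid M\<close>] by (auto simp: monoid_algebra_def)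
  then show ?thesis
    using monoid_algebra_mult_support[of M f g]
    by (auto simp: monoid_algebra_def intro: finite_subset)
qed

lemma monoid_algebra_mult_assoc:
  assumes M: "monoid M" and f: "f \<in> carrier (monoid_algebra M)"
    and g: "g \<in> carrier (monoid_algebra M)" and h: "h \<in> carrier (monoid_algebra M)"
  shows "(f \<otimes>\<^bsub>monoid_algebra M\<^esub> g) \<otimes>\<^bsub>monoid_algebra M\<^esub> h =
         f \<otimes>\<^bsub>monoid_algebra M\<^esub> (g \<otimes>\<^bsub>monoid_algebra M\<^esub> h)"
proof
  fix m
  define A B C where "A = {m. f m \<noteq> 0}" and "B = {m. g m \<noteq> 0}" and "C = {m. h m \<noteq> 0}"
  have fin: "finite A" "finite B" "finite C"
    and car: "A \<subseteq> carrier M" "B \<subseteq> carrier M" "C \<subseteq> carrier M"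
    using f g h by (auto simp: monoid_algebra_def A_def B_def C_def)
  define R S where "R = (\<lambda>(p, q). p \<otimes>\<^bsub>M\<^esub> q) ` (A \<times> B)" and "S = (\<lambda>(p, q). p \<otimes>\<^bsub>M\<^esub> q) ` (B \<times> C)"
  have finRS: "finite R" "finite S"
    using fin by (auto simp: R_def S_def)
  have "((f \<otimes>\<^bsub>monoid_algebra M\<^esub> g) \<otimes>\<^bsub>monoid_algebra M\<^esub> h) m =
     (\<Sum>r\<in>R. \<Sum>k\<in>C. if r \<otimes>\<^bsub>M\<^esub> k = m then (f \<otimes>\<^bsub>monoid_algebra M\<^esub> g) r * h k else 0)"
    using monoid_algebra_mult_support[of M f g] fin finRS
    by (intro monoid_algebra_mult_superset) (auto simp: A_def B_def C_def R_def)
  also have "\<dots> = (\<Sum>r\<in>R. \<Sum>k\<in>C. \<Sum>p\<in>A. \<Sum>q\<in>B.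
      if p \<otimes>\<^bsub>M\<^esub> q = r then (if r \<otimes>\<^bsub>M\<^esub> k = m then f p * g q * h k else 0) else 0)"
    using fin by (auto intro!: sum.cong sum.neutral
        simp: monoid_algebra_mult_superset[of A B] A_def B_def sum_distrib_right)
  also have "\<dots> = (\<Sum>p\<in>A. \<Sum>q\<in>B. \<Sum>k\<in>C. \<Sum>r\<in>R.
      if p \<otimes>\<^bsub>M\<^esub> q = r then (if r \<otimes>\<^bsub>M\<^esub> k = m then f p * g q * h k else 0) else 0)"
    apply (subst sum.swap[of _ C R])
    apply (subst sum.swap[of _ A R])
    apply (subst sum.swap[of _ A C])
    apply (subst sum.swap[of _ B R])
    apply (subst sum.swap[of _ B C])
    apply (rule sum.cong[OF refl])+
    apply simp
    done
  also have "\<dots> = (\<Sum>p\<in>A. \<Sum>q\<in>B. \<Sum>k\<in>C.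
      if p \<otimes>\<^bsub>M\<^esub> q \<otimes>\<^bsub>M\<^esub> k = m then f p * g q * h k else 0)"
    using finRS by (intro sum.cong refl) (auto simp: R_def)
  also have "\<dots> = (\<Sum>p\<in>A. \<Sum>q\<in>B. \<Sum>k\<in>C.
      if p \<otimes>\<^bsub>M\<^esub> (q \<otimes>\<^bsub>M\<^esub> k) = m then f p * (g q * h k) else 0)"
    using car by (intro sum.cong refl) (auto simp: monoid.m_assoc[OF M] subset_iff mult.assoc)
  also have "\<dots> = (\<Sum>p\<in>A. \<Sum>q\<in>B. \<Sum>k\<in>C. \<Sum>s\<in>S.
      if q \<otimes>\<^bsub>M\<^esub> k = s then (if p \<otimes>\<^bsub>M\<^esub> s = m then f p * (g q * h k) else 0) else 0)"
    using finRS by (intro sum.cong refl) (auto simp: S_def)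
  also have "\<dots> = (\<Sum>p\<in>A. \<Sum>s\<in>S. \<Sum>q\<in>B. \<Sum>k\<in>C.
      if q \<otimes>\<^bsub>M\<^esub> k = s then (if p \<otimes>\<^bsub>M\<^esub> s = m then f p * (g q * h k) else 0) else 0)"
    apply (subst sum.swap[of _ B S])
    apply (subst sum.swap[of _ C S])
    apply simp
    done
  also have "\<dots> = (\<Sum>p\<in>A. \<Sum>s\<in>S. if p \<otimes>\<^bsub>M\<^esub> s = m then f p * (g \<otimes>\<^bsub>monoid_algebra M\<^esub> h) s else 0)"
  proof (intro sum.cong refl)
    fix p s
    have "(g \<otimes>\<^bsub>monoid_algebra M\<^esub> h) s = (\<Sum>q\<in>B. \<Sum>k\<in>C. if q \<otimes>\<^bsub>M\<^esub> k = s then g q * h k else 0)"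
      using fin by (intro monoid_algebra_mult_superset) (auto simp: B_def C_def)
    then show "(\<Sum>q\<in>B. \<Sum>k\<in>C.
        if q \<otimes>\<^bsub>M\<^esub> k = s then (if p \<otimes>\<^bsub>M\<^esub> s = m then f p * (g q * h k) else 0) else 0) =
        (if p \<otimes>\<^bsub>M\<^esub> s = m then f p * (g \<otimes>\<^bsub>monoid_algebra M\<^esub> h) s else 0)"
      by (cases "p \<otimes>\<^bsub>M\<^esub> s = m") (simp_all add: sum_distrib_left if_distrib cong: if_cong)
  qed
  also have "\<dots> = (f \<otimes>\<^bsub>monoid_algebra M\<^esub> (g \<otimes>\<^bsub>monoid_algebra M\<^esub> h)) m"
    using monoid_algebra_mult_support[of M g h] fin finRS
    by (intro monoid_algebra_mult_superset[symmetric]) (auto simp: A_def B_def C_def S_def)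
  finally show "((f \<otimes>\<^bsub>monoid_algebra M\<^esub> g) \<otimes>\<^bsub>monoid_algebra M\<^esub> h) m =
         (f \<otimes>\<^bsub>monoid_algebra M\<^esub> (g \<otimes>\<^bsub>monoid_algebra M\<^esub> h)) m" .
qed

lemma monoid_algebra_ring:
  assumes M: "monoid M"
  shows "ring (monoid_algebra M)"
proof (rule ringI)
  let ?R = "monoid_algebra M"
  have add_supp: "{m. f m + g m \<noteq> 0} \<subseteq> {m. f m \<noteq> 0} \<union> {m. g m \<noteq> 0}" for f g :: "'a \<Rightarrow> complex"
    by auto
  have add_closed: "f \<oplus>\<^bsub>?R\<^esub> g \<in> carrier ?R" if "f \<in> carrier ?R" "g \<in> carrier ?R" for f g
    using that finite_subset[OF add_supp[of f g]] add_supp[of f g]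
    by (auto simp: monoid_algebra_def)
  show "abelian_group ?R"
  proof (rule abelian_groupI)
    fix f assume f: "f \<in> carrier ?R"
    show "\<exists>g\<in>carrier ?R. g \<oplus>\<^bsub>?R\<^esub> f = \<zero>\<^bsub>?R\<^esub>"
      using f by (intro bexI[of _ "\<lambda>m. - f m"]) (auto simp: monoid_algebra_def)
  qed (use add_closed in \<open>auto simp: monoid_algebra_def add_ac\<close>)
  show "monoid ?R"
  proof (rule monoidI)
    show "\<one>\<^bsub>?R\<^esub> \<in> carrier ?R"
      using monoid.one_closed[OF M] by (auto simp: monoid_algebra_def split: if_splits)
    fix f assume f: "f \<in> carrier ?R"
    define A where "A = {m. f m \<noteq> 0}"
    have A: "finite A" "A \<subseteq> carrier M"
      using f by (auto simp: monoid_algebra_def A_def)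
    have one_at: "\<one>\<^bsub>?R\<^esub> \<one>\<^bsub>M\<^esub> = 1"
      by (simp add: monoid_algebra_def)
    show "\<one>\<^bsub>?R\<^esub> \<otimes>\<^bsub>?R\<^esub> f = f"
    proof
      fix m
      have "(\<one>\<^bsub>?R\<^esub> \<otimes>\<^bsub>?R\<^esub> f) m =
          (\<Sum>p\<in>{\<one>\<^bsub>M\<^esub>}. \<Sum>q\<in>A. if p \<otimes>\<^bsub>M\<^esub> q = m then \<one>\<^bsub>?R\<^esub> p * f q else 0)"
        using A by (intro monoid_algebra_mult_superset) (auto simp: A_def monoid_algebra_def)
      also have "\<dots> = (\<Sum>q\<in>A. if q = m then f q else 0)"
        using A by (auto intro!: sum.cong simp: one_at monoid.l_one[OF M] subset_iff)
      also have "\<dots> = f m"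
        using A by (auto simp: A_def)
      finally show "(\<one>\<^bsub>?R\<^esub> \<otimes>\<^bsub>?R\<^esub> f) m = f m" .
    qed
    show "f \<otimes>\<^bsub>?R\<^esub> \<one>\<^bsub>?R\<^esub> = f"
    proof
      fix m
      have "(f \<otimes>\<^bsub>?R\<^esub> \<one>\<^bsub>?R\<^esub>) m =
          (\<Sum>p\<in>A. \<Sum>q\<in>{\<one>\<^bsub>M\<^esub>}. if p \<otimes>\<^bsub>M\<^esub> q = m then f p * \<one>\<^bsub>?R\<^esub> q else 0)"
        using A by (intro monoid_algebra_mult_superset) (auto simp: A_def monoid_algebra_def)
      also have "\<dots> = (\<Sum>p\<in>A. if p = m then f p else 0)"
        using A by (auto intro!: sum.cong simp: one_at monoid.r_one[OF M] subset_iff)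
      also have "\<dots> = f m"
        using A by (auto simp: A_def)
      finally show "(f \<otimes>\<^bsub>?R\<^esub> \<one>\<^bsub>?R\<^esub>) m = f m" .
    qed
  qed (use monoid_algebra_mult_closed monoid_algebra_mult_assoc M in blast)+
  fix f g h assume "f \<in> carrier ?R" "g \<in> carrier ?R" "h \<in> carrier ?R"
  define A B where "A = {m. f m \<noteq> 0} \<union> {m. g m \<noteq> 0}" and "B = {m. h m \<noteq> 0}"
  have fin: "finite A" "finite B"
    using \<open>f \<in> carrier ?R\<close> \<open>g \<in> carrier ?R\<close> \<open>h \<in> carrier ?R\<close>
    by (auto simp: monoid_algebra_def A_def B_def)
  have supp: "{m. f m \<noteq> 0} \<subseteq> A" "{m. g m \<noteq> 0} \<subseteq> A" "{m. h m \<noteq> 0} \<subseteq> B"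
    "{m. (f \<oplus>\<^bsub>?R\<^esub> g) m \<noteq> 0} \<subseteq> A"
    by (auto simp: A_def B_def monoid_algebra_def)
  have add_at: "(u \<oplus>\<^bsub>?R\<^esub> v) m = u m + v m" for u v m
    by (simp add: monoid_algebra_def)
  show "(f \<oplus>\<^bsub>?R\<^esub> g) \<otimes>\<^bsub>?R\<^esub> h = (f \<otimes>\<^bsub>?R\<^esub> h) \<oplus>\<^bsub>?R\<^esub> (g \<otimes>\<^bsub>?R\<^esub> h)"
    unfolding fun_eq_iff add_at monoid_algebra_mult_superset[OF fin supp(1,3)]
      monoid_algebra_mult_superset[OF fin supp(2,3)] monoid_algebra_mult_superset[OF fin supp(4,3)]
      sum.distrib[symmetric]
    by (intro allI sum.cong refl) (simp add: distrib_right)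
  show "h \<otimes>\<^bsub>?R\<^esub> (f \<oplus>\<^bsub>?R\<^esub> g) = (h \<otimes>\<^bsub>?R\<^esub> f) \<oplus>\<^bsub>?R\<^esub> (h \<otimes>\<^bsub>?R\<^esub> g)"
    unfolding fun_eq_iff add_at monoid_algebra_mult_superset[OF fin(2,1) supp(3,1)]
      monoid_algebra_mult_superset[OF fin(2,1) supp(3,2)]
      monoid_algebra_mult_superset[OF fin(2,1) supp(3,4)] sum.distrib[symmetric]
    by (intro allI sum.cong refl) (simp add: distrib_left)
qed

lemma basis_elem_closed: "p \<in> carrier M \<Longrightarrow> basis_elem p \<in> carrier (monoid_algebra M)"
  by (auto simp: monoid_algebra_def basis_elem_def split: if_splits)

lemma scalar_elem_closed: "monoid M \<Longrightarrow> scalar_elem M a \<in> carrier (monoid_algebra M)"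
  using monoid.one_closed[of M]
  by (auto simp: monoid_algebra_def scalar_elem_def split: if_splits)


section \<open>The semidirect product of the symmetric group with the free algebra\<close>

datatype cherednik_gen = Gen_x nat | Gen_y nat

primrec perm_gen :: "(nat \<Rightarrow> nat) \<Rightarrow> cherednik_gen \<Rightarrow> cherednik_gen" where
  "perm_gen \<sigma> (Gen_x i) = Gen_x (\<sigma> i)"
| "perm_gen \<sigma> (Gen_y i) = Gen_y (\<sigma> i)"

definition cherednik_gens :: "nat \<Rightarrow> cherednik_gen set" where
  "cherednik_gens n = Gen_x ` {1..n} \<union> Gen_y ` {1..n}"

text \<open>The pair \<open>(w, \<sigma>)\<close> stands for the product $w\sigma$ of a noncommutative monomial with a
  permutation, and $w\sigma \cdot v\tau = w\,\sigma(v)\,\sigma\tau$. These pairs form a linear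
  basis of $S_n \ltimes \mathbb{C}\langle x_1,\dots,x_n,y_1,\dots,y_n\rangle$, which is
  therefore the monoid algebra of the following monoid.\<close>

definition skew_monoid :: "nat \<Rightarrow> (cherednik_gen list \<times> (nat \<Rightarrow> nat)) monoid" where
  "skew_monoid n =
    \<lparr> carrier = lists (cherednik_gens n) \<times> carrier (sym_group n),
      monoid.mult = (\<lambda>(w, \<sigma>) (v, \<tau>). (w @ map (perm_gen \<sigma>) v, \<sigma> \<circ> \<tau>)),
      one = ([], id) \<rparr>"

type_synonym skew_elem = "cherednik_gen list \<times> (nat \<Rightarrow> nat) \<Rightarrow> complex"

definition skew_algebra :: "nat \<Rightarrow> skew_elem ring" where
  "skew_algebra n = monoid_algebra (skew_monoid n)"

definition skew_x :: "nat \<Rightarrow> skew_elem" where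
  "skew_x i = basis_elem ([Gen_x i], id)"

definition skew_y :: "nat \<Rightarrow> skew_elem" where
  "skew_y i = basis_elem ([Gen_y i], id)"

definition skew_perm :: "(nat \<Rightarrow> nat) \<Rightarrow> skew_elem" where
  "skew_perm \<sigma> = basis_elem ([], \<sigma>)"

definition skew_scalar :: "nat \<Rightarrow> complex \<Rightarrow> skew_elem" where
  "skew_scalar n a = scalar_elem (skew_monoid n) a"

lemma perm_gen_closed:
  assumes "\<sigma> permutes {1..n}" "a \<in> cherednik_gens n"
  shows "perm_gen \<sigma> a \<in> cherednik_gens n"
  using assms(2) permutes_in_image[OF assms(1)] unfolding cherednik_gens_def by (cases a) force+

lemma perm_gen_id: "perm_gen id = id"
proof
  fix a show "perm_gen id a = id a" by (cases a) auto
qed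

lemma perm_gen_comp: "perm_gen \<sigma> \<circ> perm_gen \<tau> = perm_gen (\<sigma> \<circ> \<tau>)"
proof
  fix a show "(perm_gen \<sigma> \<circ> perm_gen \<tau>) a = perm_gen (\<sigma> \<circ> \<tau>) a" by (cases a) auto
qed

lemma monoid_skew_monoid: "monoid (skew_monoid n)"
  by (rule monoidI)
    (auto simp: skew_monoid_def sym_group_def permutes_id perm_gen_id perm_gen_comp[symmetric]
      comp_assoc in_lists_conv_set simp del: One_nat_def intro: permutes_compose intro!: perm_gen_closed)

lemma ring_skew_algebra: "ring (skew_algebra n)"
  unfolding skew_algebra_def by (intro monoid_algebra_ring monoid_skew_monoid)


section \<open>The rational Cherednik algebra at \<open>t = 0\<close>\<close>

definition commutator :: "('a, 'e) ring_scheme \<Rightarrow> 'a \<Rightarrow> 'a \<Rightarrow> 'a" where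
  "commutator R a b = (a \<otimes>\<^bsub>R\<^esub> b) \<ominus>\<^bsub>R\<^esub> (b \<otimes>\<^bsub>R\<^esub> a)"

definition cherednik_relators :: "nat \<Rightarrow> complex \<Rightarrow> skew_elem set" where
  "cherednik_relators n c =
    {commutator (skew_algebra n) (skew_x i) (skew_x j) | i j. i \<in> {1..n} \<and> j \<in> {1..n}} \<union>
    {commutator (skew_algebra n) (skew_y i) (skew_y j) | i j. i \<in> {1..n} \<and> j \<in> {1..n}} \<union>
    {commutator (skew_algebra n) (skew_y i) (skew_x j) \<ominus>\<^bsub>skew_algebra n\<^esub>
       skew_scalar n c \<otimes>\<^bsub>skew_algebra n\<^esub> skew_perm (Transposition.transpose i j)
      | i j. i \<in> {1..n} \<and> j \<in> {1..n} \<and> i \<noteq> j} \<union>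
    {commutator (skew_algebra n) (skew_y i) (skew_x i) \<ominus>\<^bsub>skew_algebra n\<^esub>
       skew_scalar n (- c) \<otimes>\<^bsub>skew_algebra n\<^esub>
         (\<Oplus>\<^bsub>skew_algebra n\<^esub> j \<in> {1..n} - {i}. skew_perm (Transposition.transpose i j))
      | i. i \<in> {1..n}}"

definition cherednik_ideal :: "nat \<Rightarrow> complex \<Rightarrow> skew_elem set" where
  "cherednik_ideal n c = Idl\<^bsub>skew_algebra n\<^esub> (cherednik_relators n c)"

definition cherednik_algebra :: "nat \<Rightarrow> complex \<Rightarrow> skew_elem set ring" where
  "cherednik_algebra n c = skew_algebra n Quot cherednik_ideal n c"

definition cherednik_class :: "nat \<Rightarrow> complex \<Rightarrow> skew_elem \<Rightarrow> skew_elem set" where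
  "cherednik_class n c f = cherednik_ideal n c +>\<^bsub>skew_algebra n\<^esub> f"

definition cherednik_scalar :: "nat \<Rightarrow> complex \<Rightarrow> complex \<Rightarrow> skew_elem set" where
  "cherednik_scalar n c a = cherednik_class n c (skew_scalar n a)"

definition cherednik_perm :: "nat \<Rightarrow> complex \<Rightarrow> (nat \<Rightarrow> nat) \<Rightarrow> skew_elem set" where
  "cherednik_perm n c \<sigma> = cherednik_class n c (skew_perm \<sigma>)"

lemma commutator_closed:
  assumes "ring R" "a \<in> carrier R" "b \<in> carrier R"
  shows "commutator R a b \<in> carrier R"
proof -
  interpret ring R by fact
  from assms show ?thesis by (simp add: commutator_def)
qed

lemma cherednik_relators_closed: "cherednik_relators n c \<subseteq> carrier (skew_algebra n)"
proof -
  interpret ring "skew_algebra n"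
    by (rule ring_skew_algebra)
  have "skew_x i \<in> carrier (skew_algebra n)" "skew_y i \<in> carrier (skew_algebra n)"
    if "i \<in> {1..n}" for i
    using that by (auto simp: skew_algebra_def skew_x_def skew_y_def skew_monoid_def
        sym_group_def cherednik_gens_def permutes_id intro!: basis_elem_closed)
  moreover have "skew_perm (Transposition.transpose i j) \<in> carrier (skew_algebra n)"
    if "i \<in> {1..n}" "j \<in> {1..n}" for i j
    using that by (auto simp: skew_algebra_def skew_perm_def skew_monoid_def
        sym_group_def intro!: basis_elem_closed permutes_swap_id)
  moreover have "skew_scalar n a \<in> carrier (skew_algebra n)" for a
    by (simp add: skew_algebra_def skew_scalar_def scalar_elem_closed monoid_skew_monoid)
  ultimately show ?thesis
    unfolding cherednik_relators_def
    by (auto intro!: minus_closed m_closed commutator_closed finsum_closed ring_skew_algebra)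
qed

lemma ideal_cherednik_ideal: "ideal (cherednik_ideal n c) (skew_algebra n)"
  unfolding cherednik_ideal_def
  by (intro ring.genideal_ideal ring_skew_algebra cherednik_relators_closed)

lemma ring_cherednik_algebra: "ring (cherednik_algebra n c)"
  unfolding cherednik_algebra_def by (intro ideal.quotient_is_ring ideal_cherednik_ideal)


section \<open>Representations\<close>

definition End_ring :: "(complex \<Rightarrow> 'v::ab_group_add \<Rightarrow> 'v) \<Rightarrow> ('v \<Rightarrow> 'v) ring" where
  "End_ring scale =
    \<lparr> carrier = {f. Vector_Spaces.linear scale scale f},
      monoid.mult = (\<circ>),
      one = id,
      ring.zero = (\<lambda>v. 0),
      add = (\<lambda>f g v. f v + g v) \<rparr>"

text \<open>A complex algebra is a ring \<open>A\<close> together with its structure map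
  \<open>\<eta>\<close>, $a \mapsto a \cdot 1_A$; a representation of it on a complex vector space is a homomorphism
  of algebras into the endomorphism algebra. No finiteness of the dimension is assumed.\<close>

definition representation ::
  "('a, 'e) ring_scheme \<Rightarrow> (complex \<Rightarrow> 'a) \<Rightarrow> (complex \<Rightarrow> 'v::ab_group_add \<Rightarrow> 'v) \<Rightarrow>
    ('a \<Rightarrow> 'v \<Rightarrow> 'v) \<Rightarrow> bool" where
  "representation A \<eta> scale \<rho> \<longleftrightarrow>
    vector_space scale \<and> \<rho> \<in> ring_hom A (End_ring scale) \<and> (\<forall>a. \<rho> (\<eta> a) = scale a)"

definition irreducible_representation ::
  "('a, 'e) ring_scheme \<Rightarrow> (complex \<Rightarrow> 'a) \<Rightarrow> (complex \<Rightarrow> 'v::ab_group_add \<Rightarrow> 'v) \<Rightarrow>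
    ('a \<Rightarrow> 'v \<Rightarrow> 'v) \<Rightarrow> bool" where
  "irreducible_representation A \<eta> scale \<rho> \<longleftrightarrow>
    representation A \<eta> scale \<rho> \<and> (\<exists>v::'v. v \<noteq> 0) \<and>
    (\<forall>W. Modules.module.subspace scale W \<and> (\<forall>a\<in>carrier A. \<rho> a ` W \<subseteq> W)
       \<longrightarrow> W = {0} \<or> W = UNIV)"

text \<open>A linear isomorphism onto the group algebra $\mathbb{C}[G]$ intertwining the given action
  of \<open>G\<close> with left multiplication.\<close>

definition isomorphic_to_regular ::
  "('g, 'e) monoid_scheme \<Rightarrow> (complex \<Rightarrow> 'v::ab_group_add \<Rightarrow> 'v) \<Rightarrow> ('g \<Rightarrow> 'v \<Rightarrow> 'v) \<Rightarrow> bool" where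
  "isomorphic_to_regular G scale \<pi> \<longleftrightarrow>
    (\<exists>\<phi>. bij_betw \<phi> UNIV (carrier (monoid_algebra G)) \<and>
      (\<forall>u v. \<phi> (u + v) = \<phi> u \<oplus>\<^bsub>monoid_algebra G\<^esub> \<phi> v) \<and>
      (\<forall>a v. \<phi> (scale a v) = (\<lambda>g. a * \<phi> v g)) \<and>
      (\<forall>g\<in>carrier G. \<forall>v. \<phi> (\<pi> g v) = basis_elem g \<otimes>\<^bsub>monoid_algebra G\<^esub> \<phi> v))"

end

theory Submission
  imports Defs "HOL-Library.Function_Algebras" "HOL-Library.Product_Plus"
    "HOL-Computational_Algebra.Computational_Algebra"
    "HOL-Analysis.Continuum_Not_Denumerable"
begin

text \<open>The Dunkl operators at $t = 0$ give a family of representations of $H_{0,c}$ in which the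
  normally ordered monomials $x^\alpha y^\beta \sigma$ are linearly independent. Therefore identities
  can be checked there: the symmetric polynomials in the $x_i$ are central (likewise in the $y_i$, by
  the automorphism $x \mapsto y$, $y \mapsto -x$), and the spherical subalgebra $e H_{0,c} e$ is
  commutative. An irreducible representation $V$ has countable dimension, so central elements act by
  scalars (Dixmier); hence all $x_i$ and $y_i$ are algebraic and $V$ is finite-dimensional. For
  $\sigma \ne 1$ the element $c\,\sigma$ is a commutator, so it has trace zero. Moreover $e V$ is an
  irreducible module over a commutative algebra, so it is a line, and its dimension is also the trace
  of $e$, which is $\dim V / n!$. Finally, a representation of dimension $|G|$ of a finite group in which all
  $g \ne 1$ have trace zero is regular.\<close>

section \<open>The ring of additive endomorphisms\<close>

text \<open>A presentation by generators and relations shows at once that the normally ordered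
  monomials span, but not that they are independent. Independence is wanted only for carrying
  identities from a concrete representation to an arbitrary one, so it suffices to prove it once, in
  a model, and to compare normal forms there. At t = 0 the Dunkl operator has no derivative: a free
  momentum variable takes its place. The operators therefore act on arbitrary functions of positions
  and momenta, delta functions included, and multiplication by an invariant function commutes with
  all of them. This one fact gives both the centrality of symmetric polynomials and the
  commutativity of the spherical subalgebra. The dimension is not assumed to be finite, so trace
  arguments become available only after Schur's lemma in countable dimension has made the
  coordinates algebraic. The last step avoids characters: it produces a vector whose orbit under the
  group is linearly independent, and obtains it from the vanishing of the trace of an
  idempotent.\<close>

text \<open>The trivial group has a trivial endomorphism ring, so only the sort
  \<open>{ring, monoid_mult}\<close> is available, not \<open>ring_1\<close>.\<close>

typedef (overloaded) 'v aend = "{f :: 'v::ab_group_add \<Rightarrow> 'v. \<forall>x y. f (x + y) = f x + f y}"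
  morphisms app Aend
  by (rule exI[of _ id]) simp

setup_lifting type_definition_aend

instantiation aend :: (ab_group_add) "{ring, monoid_mult}"
begin

lift_definition zero_aend :: "'a aend" is "\<lambda>x. 0" by simp
lift_definition one_aend :: "'a aend" is "\<lambda>x. x" by simp
lift_definition plus_aend :: "'a aend \<Rightarrow> 'a aend \<Rightarrow> 'a aend" is "\<lambda>f g x. f x + g x" by (simp add: add_ac)
lift_definition minus_aend :: "'a aend \<Rightarrow> 'a aend \<Rightarrow> 'a aend" is "\<lambda>f g x. f x - g x" by simp
lift_definition uminus_aend :: "'a aend \<Rightarrow> 'a aend" is "\<lambda>f x. - f x" by simp
lift_definition times_aend :: "'a aend \<Rightarrow> 'a aend \<Rightarrow> 'a aend" is "\<lambda>f g x. f (g x)" by simp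

instance
  by standard (transfer; simp add: fun_eq_iff algebra_simps)+

end

lemma app_add: "app f (x + y) = app f x + app f y"
  using app[of f] by simp

lemma app_plus [simp]: "app (f + g) x = app f x + app g x"
  by (simp add: plus_aend.rep_eq)
lemma app_minus [simp]: "app (f - g) x = app f x - app g x"
  by (simp add: minus_aend.rep_eq)
lemma app_times [simp]: "app (f * g) x = app f (app g x)"
  by (simp add: times_aend.rep_eq)
lemma app_one [simp]: "app 1 x = x"
  by (simp add: one_aend.rep_eq)
lemma app_zero_left [simp]: "app 0 x = 0"
  by (simp add: zero_aend.rep_eq)
lemma app_zero_right [simp]: "app f 0 = 0"
  using app_add[of f 0 0] by simp
lemma app_neg: "app f (- x) = - app f x"
  using app_add[of f x "- x"] by (simp add: eq_neg_iff_add_eq_0 add.commute)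
lemma app_diff: "app f (x - y) = app f x - app f y"
  using app_add[of f x "- y"] by (simp add: app_neg)

lemma app_sum_left: "app (sum f A) x = (\<Sum>i\<in>A. app (f i) x)"
  by (induct A rule: infinite_finite_induct) auto

lemma app_sum_right: "app f (sum g A) = (\<Sum>i\<in>A. app f (g i))"
  by (induct A rule: infinite_finite_induct) (auto simp: app_add)

lemma aend_eqI: "(\<And>x. app f x = app g x) \<Longrightarrow> f = g"
  by (metis app_inject ext)

lemma app_Aend: "(\<And>x y. f (x + y) = f x + f y) \<Longrightarrow> app (Aend f) = f"
  by (subst Aend_inverse) auto

section \<open>Componentwise product of two rings\<close>

instantiation prod :: ("{ring, monoid_mult}", "{ring, monoid_mult}") "{ring, monoid_mult}"
begin

definition one_prod :: "'a \<times> 'b" where "one_prod = (1, 1)"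
definition times_prod :: "'a \<times> 'b \<Rightarrow> 'a \<times> 'b \<Rightarrow> 'a \<times> 'b"
  where "times_prod x y = (fst x * fst y, snd x * snd y)"

instance
  by standard (auto simp: one_prod_def times_prod_def prod_eq_iff algebra_simps)

end

lemma fst_times [simp]: "fst (x * y) = fst x * fst y"
  and snd_times [simp]: "snd (x * y) = snd x * snd y"
  and fst_one [simp]: "fst 1 = 1"
  and snd_one [simp]: "snd 1 = 1"
  by (simp_all add: times_prod_def one_prod_def)

section \<open>The defining relations in a ring\<close>

text \<open>The relations are imposed in an arbitrary ring, so that the same facts apply to the
  given representation, to the Dunkl model and to the product of both. Scalars are only asked to
  commute with the generators: in a ring of additive maps, \<open>sc a\<close> need not be
  central.\<close>

locale cherednik_rep =
  fixes n :: nat and c :: complex and sc :: "complex \<Rightarrow> 'a::{ring, monoid_mult}"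
    and X Y :: "nat \<Rightarrow> 'a" and S :: "(nat \<Rightarrow> nat) \<Rightarrow> 'a"
  assumes sc_add: "sc (a + b) = sc a + sc b"
    and sc_mult: "sc (a * b) = sc a * sc b"
    and sc_1: "sc 1 = 1"
    and sc_X: "i \<in> {1..n} \<Longrightarrow> sc a * X i = X i * sc a"
    and sc_Y: "i \<in> {1..n} \<Longrightarrow> sc a * Y i = Y i * sc a"
    and sc_S: "\<sigma> permutes {1..n} \<Longrightarrow> sc a * S \<sigma> = S \<sigma> * sc a"
    and S_id: "S id = 1"
    and S_comp: "\<lbrakk>\<sigma> permutes {1..n}; \<tau> permutes {1..n}\<rbrakk> \<Longrightarrow> S (\<sigma> \<circ> \<tau>) = S \<sigma> * S \<tau>"
    and S_X: "\<lbrakk>\<sigma> permutes {1..n}; i \<in> {1..n}\<rbrakk> \<Longrightarrow> S \<sigma> * X i = X (\<sigma> i) * S \<sigma>"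
    and S_Y: "\<lbrakk>\<sigma> permutes {1..n}; i \<in> {1..n}\<rbrakk> \<Longrightarrow> S \<sigma> * Y i = Y (\<sigma> i) * S \<sigma>"
    and X_comm: "\<lbrakk>i \<in> {1..n}; j \<in> {1..n}\<rbrakk> \<Longrightarrow> X i * X j = X j * X i"
    and Y_comm: "\<lbrakk>i \<in> {1..n}; j \<in> {1..n}\<rbrakk> \<Longrightarrow> Y i * Y j = Y j * Y i"
    and YX_diff: "\<lbrakk>i \<in> {1..n}; j \<in> {1..n}; i \<noteq> j\<rbrakk> \<Longrightarrow>
      Y i * X j = X j * Y i + sc c * S (Transposition.transpose i j)"
    and YX_same: "i \<in> {1..n} \<Longrightarrow>
      Y i * X i = X i * Y i - sc c * (\<Sum>j\<in>{1..n} - {i}. S (Transposition.transpose i j))"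
begin

lemma sc_0: "sc 0 = 0"
  using sc_add[of 0 0] by simp

lemma sc_uminus: "sc (- a) = - sc a"
  using sc_add[of a "- a"] by (simp add: sc_0 eq_neg_iff_add_eq_0 add.commute)

lemma swap_permutes: "i \<in> {1..n} \<Longrightarrow> j \<in> {1..n} \<Longrightarrow> Transposition.transpose i j permutes {1..n}"
  by (rule permutes_swap_id)

lemma perm_in: "\<sigma> permutes {1..n} \<Longrightarrow> i \<in> {1..n} \<Longrightarrow> \<sigma> i \<in> {1..n}"
  by (simp only: permutes_in_image)

end

text \<open>A product over a multiset in a noncommutative ring needs a choice of order, here the
  sorted one. For commuting factors \<open>mprod_add\<close> shows that the choice does not
  matter.\<close>

definition mprod :: "(nat \<Rightarrow> 'a::monoid_mult) \<Rightarrow> nat multiset \<Rightarrow> 'a" where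
  "mprod Z A = prod_list (map Z (sorted_list_of_multiset A))"

lemma mprod_empty [simp]: "mprod Z {#} = 1"
  by (simp add: mprod_def)

lemma mprod_add:
  assumes "\<And>j. j \<in># A \<Longrightarrow> Z i * Z j = Z j * Z i"
  shows "mprod Z (add_mset i A) = Z i * mprod Z A"
proof -
  have "prod_list (map Z (insort i xs)) = Z i * prod_list (map Z xs)"
    if "\<And>j. j \<in> set xs \<Longrightarrow> Z i * Z j = Z j * Z i" for xs
    using that
  proof (induct xs)
    case (Cons x xs)
    have "Z x * (Z i * prod_list (map Z xs)) = Z i * (Z x * prod_list (map Z xs))"
      using Cons(2)[of x] by (simp flip: mult.assoc)
    with Cons show ?case by simp
  qed simp
  from this[of "sorted_list_of_multiset A"] show ?thesis
    using assms by (simp add: mprod_def sorted_list_of_multiset_insert)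
qed

lemma mprod_commute:
  fixes z :: "'a::monoid_mult"
  assumes "\<And>j. j \<in># A \<Longrightarrow> z * Z j = Z j * z"
  shows "z * mprod Z A = mprod Z A * z"
proof -
  have "z * prod_list (map Z xs) = prod_list (map Z xs) * z" if "\<And>j. j \<in> set xs \<Longrightarrow> z * Z j = Z j * z" for xs
    using that
  proof (induct xs)
    case (Cons x xs)
    have "z * (Z x * prod_list (map Z xs)) = Z x * (z * prod_list (map Z xs))"
      using Cons(2)[of x] by (simp flip: mult.assoc)
    with Cons show ?case by (simp add: mult.assoc)
  qed simp
  from this[of "sorted_list_of_multiset A"] show ?thesis
    using assms by (simp add: mprod_def)
qed

type_synonym mono = "nat multiset \<times> nat multiset \<times> (nat \<Rightarrow> nat)"

definition mono_index :: "nat \<Rightarrow> mono set" where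
  "mono_index n = {(A, B, \<sigma>). set_mset A \<subseteq> {1..n} \<and> set_mset B \<subseteq> {1..n} \<and> \<sigma> permutes {1..n}}"

section \<open>Normal ordering\<close>

context cherednik_rep
begin

fun mon :: "mono \<Rightarrow> 'a" where
  "mon (A, B, \<sigma>) = mprod X A * mprod Y B * S \<sigma>"

text \<open>The linear span of the monomials, built one summand at a time so that linear statements
  follow by induction. It turns out to be closed under products (\<open>normal_span_mult\<close>),
  so it plays the part of the image of the whole algebra.\<close>

inductive_set normal_span :: "'a set" where
  normal_span_0: "0 \<in> normal_span"
| normal_span_step: "k \<in> mono_index n \<Longrightarrow> z \<in> normal_span \<Longrightarrow> sc a * mon k + z \<in> normal_span"

lemma normal_span_add: "z \<in> normal_span \<Longrightarrow> w \<in> normal_span \<Longrightarrow> z + w \<in> normal_span"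
  by (induct rule: normal_span.induct) (auto simp: add.assoc intro: normal_span.intros)

lemma normal_span_sc: "z \<in> normal_span \<Longrightarrow> sc a * z \<in> normal_span"
  by (induct rule: normal_span.induct) (auto simp: distrib_left normal_span_0 normal_span_step simp flip: mult.assoc sc_mult)

lemma normal_span_uminus: "z \<in> normal_span \<Longrightarrow> - z \<in> normal_span"
  using normal_span_sc[of z "- 1"] by (simp add: sc_uminus sc_1)

lemma normal_span_diff: "z \<in> normal_span \<Longrightarrow> w \<in> normal_span \<Longrightarrow> z - w \<in> normal_span"
  using normal_span_add[of z "- w"] normal_span_uminus[of w] by simp

lemma normal_span_sum: "(\<And>i. i \<in> I \<Longrightarrow> f i \<in> normal_span) \<Longrightarrow> sum f I \<in> normal_span"
  by (induct I rule: infinite_finite_induct) (auto intro: normal_span_add normal_span_0)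

lemma normal_span_mon: "k \<in> mono_index n \<Longrightarrow> mon k \<in> normal_span"
  using normal_span_step[OF _ normal_span_0, of k 1] by (simp add: sc_1)

lemma sc_mprod_X: "set_mset A \<subseteq> {1..n} \<Longrightarrow> sc a * mprod X A = mprod X A * sc a"
  by (rule mprod_commute) (use sc_X in blast)

lemma sc_mprod_Y: "set_mset A \<subseteq> {1..n} \<Longrightarrow> sc a * mprod Y A = mprod Y A * sc a"
  by (rule mprod_commute) (use sc_Y in blast)

lemma sc_mon: assumes "k \<in> mono_index n" shows "sc a * mon k = mon k * sc a"
proof -
  obtain A B \<sigma> where k: "k = (A, B, \<sigma>)" by (cases k)
  with assms have *: "sc a * mprod X A = mprod X A * sc a" "sc a * mprod Y B = mprod Y B * sc a"
    "sc a * S \<sigma> = S \<sigma> * sc a"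
    by (auto simp: mono_index_def sc_mprod_X sc_mprod_Y sc_S)
  show ?thesis
    using * by (simp add: k) (metis mult.assoc)
qed

lemma sc_normal_span: "z \<in> normal_span \<Longrightarrow> sc a * z = z * sc a"
proof (induct rule: normal_span.induct)
  case (normal_span_step k z b)
  have "sc a * (sc b * mon k) = sc b * (sc a * mon k)"
    by (simp only: mult.assoc[symmetric] sc_mult[symmetric] mult.commute[of a b])
  also have "\<dots> = sc b * mon k * sc a"
    by (simp add: sc_mon[OF normal_span_step(1), of a] mult.assoc)
  finally show ?case
    using normal_span_step by (simp add: distrib_left distrib_right)
qed simp

lemma mprod_X_add: "i \<in> {1..n} \<Longrightarrow> set_mset A \<subseteq> {1..n} \<Longrightarrow> mprod X (add_mset i A) = X i * mprod X A"
  by (rule mprod_add) (use X_comm in blast)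

lemma mprod_Y_add: "i \<in> {1..n} \<Longrightarrow> set_mset A \<subseteq> {1..n} \<Longrightarrow> mprod Y (add_mset i A) = Y i * mprod Y A"
  by (rule mprod_add) (use Y_comm in blast)

lemma normal_span_left_mult_if_mon:
  assumes "\<And>a. u * sc a = sc a * u" and "\<And>k. k \<in> mono_index n \<Longrightarrow> u * mon k \<in> normal_span" and "z \<in> normal_span"
  shows "u * z \<in> normal_span"
  using assms(3)
proof (induct rule: normal_span.induct)
  case (normal_span_step k z a)
  have "u * (sc a * mon k + z) = sc a * (u * mon k) + u * z"
    by (metis assms(1) distrib_left mult.assoc)
  then show ?case
    using normal_span_step assms(2) by (simp add: normal_span_add normal_span_sc)
qed (simp add: normal_span_0)

lemma S_mprod:
  assumes Z: "\<And>i. i \<in> {1..n} \<Longrightarrow> S \<sigma> * Z i = Z (\<sigma> i) * S \<sigma>"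
    and comm: "\<And>i j. i \<in> {1..n} \<Longrightarrow> j \<in> {1..n} \<Longrightarrow> Z i * Z j = Z j * Z i"
    and \<sigma>: "\<sigma> permutes {1..n}" and A: "set_mset A \<subseteq> {1..n}"
  shows "S \<sigma> * mprod Z A = mprod Z (image_mset \<sigma> A) * S \<sigma>"
  using A
proof (induct A)
  case (add i A)
  then have i: "i \<in> {1..n}" "\<sigma> i \<in> {1..n}" and A: "set_mset A \<subseteq> {1..n}"
    using perm_in[OF \<sigma>] by auto
  have A': "set_mset (image_mset \<sigma> A) \<subseteq> {1..n}"
    using A perm_in[OF \<sigma>] by auto
  have "mprod Z (add_mset i A) = Z i * mprod Z A"
    by (rule mprod_add) (use comm i A in blast)
  moreover have "mprod Z (add_mset (\<sigma> i) (image_mset \<sigma> A)) = Z (\<sigma> i) * mprod Z (image_mset \<sigma> A)"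
    by (rule mprod_add) (use comm i A' in blast)
  ultimately show ?case
    using add(1)[OF A] Z[OF i(1)] by simp (metis mult.assoc)
qed simp

lemma normal_span_S: assumes \<sigma>: "\<sigma> permutes {1..n}" and z: "z \<in> normal_span" shows "S \<sigma> * z \<in> normal_span"
proof (rule normal_span_left_mult_if_mon[OF _ _ z])
  fix k assume "k \<in> mono_index n"
  then obtain A B \<tau> where k: "k = (A, B, \<tau>)" "set_mset A \<subseteq> {1..n}" "set_mset B \<subseteq> {1..n}" "\<tau> permutes {1..n}"
    by (auto simp: mono_index_def)
  have *: "S \<sigma> * mprod X A = mprod X (image_mset \<sigma> A) * S \<sigma>"
    "S \<sigma> * mprod Y B = mprod Y (image_mset \<sigma> B) * S \<sigma>"
    using S_X S_Y X_comm Y_comm \<sigma> k by (auto intro!: S_mprod)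
  have "S \<sigma> * mon k = (S \<sigma> * mprod X A) * (mprod Y B * S \<tau>)"
    by (simp add: k mult.assoc)
  also have "\<dots> = mprod X (image_mset \<sigma> A) * ((S \<sigma> * mprod Y B) * S \<tau>)"
    unfolding *(1) by (simp only: mult.assoc)
  also have "\<dots> = mon (image_mset \<sigma> A, image_mset \<sigma> B, \<sigma> \<circ> \<tau>)"
    unfolding *(2) by (simp only: S_comp[OF \<sigma> k(4)] mult.assoc mon.simps)
  finally have "S \<sigma> * mon k = mon (image_mset \<sigma> A, image_mset \<sigma> B, \<sigma> \<circ> \<tau>)" .
  moreover have "(image_mset \<sigma> A, image_mset \<sigma> B, \<sigma> \<circ> \<tau>) \<in> mono_index n"
    using k permutes_compose[OF k(4) \<sigma>] perm_in[OF \<sigma>] by (auto simp: mono_index_def simp del: atLeastAtMost_iff)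
  ultimately show "S \<sigma> * mon k \<in> normal_span"
    using normal_span_mon by metis
qed (simp add: sc_S[OF \<sigma>])

lemma normal_span_X: assumes i: "i \<in> {1..n}" and z: "z \<in> normal_span" shows "X i * z \<in> normal_span"
proof (rule normal_span_left_mult_if_mon[OF _ _ z])
  fix k assume "k \<in> mono_index n"
  then obtain A B \<tau> where k: "k = (A, B, \<tau>)" "set_mset A \<subseteq> {1..n}" "set_mset B \<subseteq> {1..n}" "\<tau> permutes {1..n}"
    by (auto simp: mono_index_def)
  have "X i * mon k = mon (add_mset i A, B, \<tau>)"
    by (simp add: k mprod_X_add[OF i k(2)] mult.assoc)
  moreover have "(add_mset i A, B, \<tau>) \<in> mono_index n"
    using k i by (auto simp: mono_index_def)
  ultimately show "X i * mon k \<in> normal_span"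
    using normal_span_mon by metis
qed (simp add: sc_X[OF i])

text \<open>The only place where reordering has a cost. \<open>Y i\<close> is moved to the right
  past the factors of the x-part one by one; each commutator leaves permutations applied to a
  shorter ordered monomial, and these stay in the span by \<open>normal_span_S\<close>.\<close>

lemma normal_span_Y: assumes i: "i \<in> {1..n}" and z: "z \<in> normal_span" shows "Y i * z \<in> normal_span"
proof (rule normal_span_left_mult_if_mon[OF _ _ z])
  fix k assume "k \<in> mono_index n"
  then obtain A B \<tau> where k: "k = (A, B, \<tau>)" "set_mset A \<subseteq> {1..n}" "set_mset B \<subseteq> {1..n}" "\<tau> permutes {1..n}"
    by (auto simp: mono_index_def)
  have "Y i * (mprod X A * (mprod Y B * S \<tau>)) \<in> normal_span"
    using k(2)
  proof (induct A)
    case empty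
    have "Y i * (mprod Y B * S \<tau>) = mon ({#}, add_mset i B, \<tau>)"
      by (simp add: mprod_Y_add[OF i k(3)] mult.assoc)
    moreover have "({#}, add_mset i B, \<tau>) \<in> mono_index n"
      using k i by (auto simp: mono_index_def)
    ultimately show ?case
      using normal_span_mon by (metis mprod_empty mult_1)
  next
    case (add j A)
    then have j: "j \<in> {1..n}" and A: "set_mset A \<subseteq> {1..n}" by auto
    let ?r = "mprod X A * (mprod Y B * S \<tau>)"
    have "?r = mon (A, B, \<tau>)" by (simp add: mult.assoc)
    moreover have "(A, B, \<tau>) \<in> mono_index n"
      using A k by (simp add: mono_index_def)
    ultimately have r: "?r \<in> normal_span"
      using normal_span_mon by metis
    have "Y i * (X j * ?r) \<in> normal_span"
    proof (cases "i = j")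
      case True
      have "Y i * (X j * ?r) = X i * (Y i * ?r) - sc c * (\<Sum>j\<in>{1..n} - {i}. S (Transposition.transpose i j) * ?r)"
      proof -
        have "Y i * (X j * ?r) = (Y i * X i) * ?r"
          using True by (simp add: mult.assoc)
        also have "\<dots> = X i * (Y i * ?r) - sc c * ((\<Sum>j\<in>{1..n} - {i}. S (Transposition.transpose i j)) * ?r)"
          by (simp only: YX_same[OF i] left_diff_distrib mult.assoc)
        finally show ?thesis
          by (simp only: sum_distrib_right)
      qed
      moreover have "(\<Sum>j\<in>{1..n} - {i}. S (Transposition.transpose i j) * ?r) \<in> normal_span"
        using r i swap_permutes[OF i] by (intro normal_span_sum normal_span_S) auto
      ultimately show ?thesis
        using add(1)[OF A] i by (simp add: normal_span_X normal_span_diff normal_span_sc)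
    next
      case False
      have "Y i * (X j * ?r) = X j * (Y i * ?r) + sc c * (S (Transposition.transpose i j) * ?r)"
        by (simp only: YX_diff[OF i j False] distrib_right flip: mult.assoc)
      then show ?thesis
        using add(1)[OF A] i j r swap_permutes[OF i j] by (simp add: normal_span_X normal_span_add normal_span_sc normal_span_S)
    qed
    then show ?case
      by (simp add: mprod_X_add[OF j A] mult.assoc)
  qed
  then show "Y i * mon k \<in> normal_span"
    by (simp add: k mult.assoc)
qed (simp add: sc_Y[OF i])

lemma normal_span_mprod_left:
  assumes "\<And>i z. i \<in> {1..n} \<Longrightarrow> z \<in> normal_span \<Longrightarrow> Z i * z \<in> normal_span" and "set_mset A \<subseteq> {1..n}" and "z \<in> normal_span"
  shows "mprod Z A * z \<in> normal_span"
proof -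
  have "prod_list (map Z xs) * z \<in> normal_span" if "set xs \<subseteq> {1..n}" for xs
    using that by (induct xs) (auto simp: assms(1,3) mult.assoc)
  with assms(2) show ?thesis by (simp add: mprod_def)
qed

text \<open>The spanning half of the PBW theorem, valid in every ring with these relations. The
  independence half is \<open>model_independent\<close>.\<close>

lemma normal_span_mult: assumes "z \<in> normal_span" "w \<in> normal_span" shows "z * w \<in> normal_span"
  using assms(1)
proof (induct rule: normal_span.induct)
  case (normal_span_step k z a)
  then obtain A B \<tau> where k: "k = (A, B, \<tau>)" "set_mset A \<subseteq> {1..n}" "set_mset B \<subseteq> {1..n}" "\<tau> permutes {1..n}"
    by (auto simp: mono_index_def)
  have "mprod X A * (mprod Y B * (S \<tau> * w)) \<in> normal_span"
    using k assms(2) by (intro normal_span_mprod_left normal_span_S normal_span_X normal_span_Y)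
  then show ?case
    using normal_span_step by (simp add: k distrib_right mult.assoc normal_span_add normal_span_sc)
qed (simp add: normal_span_0)

lemma normal_span_1: "1 \<in> normal_span"
  using normal_span_mon[of "({#}, {#}, id)"] by (simp add: S_id mono_index_def permutes_id)

lemma normal_span_sc_in: "sc a \<in> normal_span"
  using normal_span_sc[OF normal_span_1] by simp

lemma normal_span_X_in: "i \<in> {1..n} \<Longrightarrow> X i \<in> normal_span"
  using normal_span_X[OF _ normal_span_1] by simp

lemma normal_span_Y_in: "i \<in> {1..n} \<Longrightarrow> Y i \<in> normal_span"
  using normal_span_Y[OF _ normal_span_1] by simp

lemma normal_span_S_in: "\<sigma> permutes {1..n} \<Longrightarrow> S \<sigma> \<in> normal_span"
  using normal_span_S[OF _ normal_span_1] by simp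

lemma normal_span_commute:
  assumes X: "\<And>i. i \<in> {1..n} \<Longrightarrow> u * X i = X i * u" and Y: "\<And>i. i \<in> {1..n} \<Longrightarrow> u * Y i = Y i * u"
    and S: "\<And>\<sigma>. \<sigma> permutes {1..n} \<Longrightarrow> u * S \<sigma> = S \<sigma> * u" and sc: "\<And>a. u * sc a = sc a * u"
    and z: "z \<in> normal_span"
  shows "u * z = z * u"
  using z
proof (induct rule: normal_span.induct)
  case (normal_span_step k z a)
  then obtain A B \<tau> where k: "k = (A, B, \<tau>)" "set_mset A \<subseteq> {1..n}" "set_mset B \<subseteq> {1..n}" "\<tau> permutes {1..n}"
    by (auto simp: mono_index_def)
  have "u * mprod X A = mprod X A * u" "u * mprod Y B = mprod Y B * u"
    using k X Y by (auto intro!: mprod_commute)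
  then have "u * (sc a * mon k) = sc a * mon k * u"
    using S[OF k(4)] sc[of a] by (simp add: k) (metis mult.assoc)
  then show ?case
    using normal_span_step by (simp add: distrib_left distrib_right)
qed simp

lemma normal_span_expansion:
  assumes "z \<in> normal_span"
  shows "\<exists>K C. finite K \<and> K \<subseteq> mono_index n \<and> z = (\<Sum>k\<in>K. sc (C k) * mon k)"
  using assms
proof (induct rule: normal_span.induct)
  case normal_span_0
  show ?case by (rule exI[of _ "{}"]) auto
next
  case (normal_span_step k z a)
  then obtain K C where K: "finite K" "K \<subseteq> mono_index n" "z = (\<Sum>k\<in>K. sc (C k) * mon k)"
    by auto
  \<comment> \<open>The new monomial may already occur in \<open>K\<close>, so its coefficient is
    added to the old one. \<open>C\<close> is cut off outside \<open>K\<close> because its values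
    there are arbitrary.\<close>
  define C' where "C' = (\<lambda>m. (if m = k then a else 0) + (if m \<in> K then C m else 0))"
  have "(\<Sum>m\<in>insert k K. sc (C' m) * mon m) =
      (\<Sum>m\<in>insert k K. sc (if m = k then a else 0) * mon m) +
      (\<Sum>m\<in>insert k K. sc (if m \<in> K then C m else 0) * mon m)"
    by (simp only: C'_def sc_add distrib_right sum.distrib)
  also have "(\<Sum>m\<in>insert k K. sc (if m = k then a else 0) * mon m) = (\<Sum>m\<in>{k}. sc a * mon m)"
    using K by (intro sum.mono_neutral_cong_right) (auto simp: sc_0)
  also have "(\<Sum>m\<in>insert k K. sc (if m \<in> K then C m else 0) * mon m) = (\<Sum>m\<in>K. sc (C m) * mon m)"
    using K by (intro sum.mono_neutral_cong_right) (auto simp: sc_0)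
  finally show ?case
    using K normal_span_step(1) by (intro exI[of _ "insert k K"] exI[of _ C']) auto
qed

end

declare One_nat_def [simp del]

section \<open>The Dunkl model\<close>

text \<open>Pairwise distinct positions \<open>a\<close>, so that the denominators of the Dunkl
  operators do not vanish, and arbitrary momenta \<open>p\<close>. Requiring injectivity on all of
  \<open>nat\<close> instead of \<open>{1..n}\<close> keeps the type independent of
  \<open>n\<close>.\<close>

typedef point = "{(a :: nat \<Rightarrow> complex, p :: nat \<Rightarrow> complex). inj a}"
  by (rule exI[of _ "(of_nat, of_nat)"]) (simp add: inj_on_def)

setup_lifting type_definition_point

lift_definition acoord :: "point \<Rightarrow> nat \<Rightarrow> complex" is fst .
lift_definition pcoord :: "point \<Rightarrow> nat \<Rightarrow> complex" is snd .

text \<open>The second branch is junk: only permutations act.\<close>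

lift_definition pact :: "(nat \<Rightarrow> nat) \<Rightarrow> point \<Rightarrow> point" is
  "\<lambda>\<sigma> (a, p). if inj \<sigma> then (a \<circ> \<sigma>, p \<circ> \<sigma>) else (a, p)"
  by (auto split: if_splits intro: inj_compose)

lemma acoord_inj: "acoord q i = acoord q j \<longleftrightarrow> i = j"
  by transfer (auto simp: inj_def)

lemma acoord_pact: "inj \<sigma> \<Longrightarrow> acoord (pact \<sigma> q) i = acoord q (\<sigma> i)"
  by transfer auto

lemma pcoord_pact: "inj \<sigma> \<Longrightarrow> pcoord (pact \<sigma> q) i = pcoord q (\<sigma> i)"
  by transfer auto

lemma pact_id: "pact id q = q"
  by transfer auto

text \<open>A right action on points, so that \<open>mS\<close> becomes a left action on
  functions.\<close>

lemma pact_pact: "inj \<sigma> \<Longrightarrow> inj \<tau> \<Longrightarrow> pact \<tau> (pact \<sigma> q) = pact (\<sigma> \<circ> \<tau>) q"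
  by transfer (clarsimp split del: if_split, simp add: inj_compose comp_assoc)

text \<open>The positions are distinct, so the action on points is free. This is what later
  separates monomials with different permutations.\<close>

lemma pact_eqD: "inj \<sigma> \<Longrightarrow> inj \<tau> \<Longrightarrow> pact \<sigma> q = pact \<tau> q \<Longrightarrow> \<sigma> = \<tau>"
  by transfer (clarsimp split del: if_split, simp add: fun_eq_iff inj_eq)

lemma smult_sum_right: "smult a (sum f A) = (\<Sum>x\<in>A. smult a (f x))"
  by (induct A rule: infinite_finite_induct) (auto simp: smult_add_right)

lemma sum_func_apply: "(sum f A) q = (\<Sum>x\<in>A. f x q)"
  by (induct A rule: infinite_finite_induct) auto

type_synonym func = "point \<Rightarrow> complex poly"

definition mult_op :: "func \<Rightarrow> func aend" where
  "mult_op G = Aend (\<lambda>F q. G q * F q)"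
definition msc :: "complex \<Rightarrow> func aend" where
  "msc a = mult_op (\<lambda>q. [:a:])"
definition mX :: "nat \<Rightarrow> func aend" where
  "mX i = mult_op (\<lambda>q. [:acoord q i:])"
definition mS :: "(nat \<Rightarrow> nat) \<Rightarrow> func aend" where
  "mS \<sigma> = Aend (\<lambda>F q. F (pact \<sigma> q))"
text \<open>The classical Dunkl operator, whose momentum \<open>p\<close> is multiplied by a formal variable: this
  variable records the filtration by degree in the \<open>y\<close>s.\<close>

definition mY :: "nat \<Rightarrow> complex \<Rightarrow> nat \<Rightarrow> func aend" where
  "mY n c i = Aend (\<lambda>F q. [:0, pcoord q i:] * F q + (\<Sum>k\<in>{1..n} - {i}.
     smult (c / (acoord q i - acoord q k)) (F (pact (Transposition.transpose i k) q))))"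

lemma app_mult_op: "app (mult_op G) F q = G q * F q"
  unfolding mult_op_def by (subst app_Aend) (simp_all add: fun_eq_iff distrib_left)

lemma app_msc: "app (msc a) F q = smult a (F q)"
  by (simp add: msc_def app_mult_op)

lemma app_mX: "app (mX i) F q = smult (acoord q i) (F q)"
  by (simp add: mX_def app_mult_op)

lemma app_mS: "app (mS \<sigma>) F q = F (pact \<sigma> q)"
  unfolding mS_def by (subst app_Aend) (auto simp: fun_eq_iff)

lemma app_mY: "app (mY n c i) F q = [:0, pcoord q i:] * F q + (\<Sum>k\<in>{1..n} - {i}.
     smult (c / (acoord q i - acoord q k)) (F (pact (Transposition.transpose i k) q)))"
  unfolding mY_def
  by (subst app_Aend) (simp_all add: fun_eq_iff distrib_left smult_add_right sum.distrib add_ac)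

lemma func_eqI: "(\<And>F q. app f F q = app g F q) \<Longrightarrow> f = (g :: func aend)"
  by (rule aend_eqI) auto

lemma mX_mult_op: "mX i * mult_op G = mult_op G * mX i"
  by (rule func_eqI) (simp add: app_mult_op app_mX)

lemma msc_mult_op: "msc a * mult_op G = mult_op G * msc a"
  by (rule func_eqI) (simp add: app_mult_op app_msc)

definition invariant :: "nat \<Rightarrow> func \<Rightarrow> bool" where
  "invariant n G \<longleftrightarrow> (\<forall>\<sigma> q. \<sigma> permutes {1..n} \<longrightarrow> G (pact \<sigma> q) = G q)"

lemma mS_mult_op: "invariant n G \<Longrightarrow> \<sigma> permutes {1..n} \<Longrightarrow> mS \<sigma> * mult_op G = mult_op G * mS \<sigma>"
  by (rule func_eqI) (simp add: app_mult_op app_mS invariant_def)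

text \<open>The operator consists of a multiplication and of reflections, and an invariant function
  passes through both. With a derivative, that is for t different from 0, this would fail.\<close>

lemma mY_mult_op:
  assumes "invariant n G" "i \<in> {1..n}"
  shows "mY n c i * mult_op G = mult_op G * mY n c i"
proof (rule func_eqI)
  fix F q
  have "G (pact (Transposition.transpose i k) q) = G q" if "k \<in> {1..n} - {i}" for k
    using assms that permutes_swap_id[of i "{1..n}" k] by (simp add: invariant_def)
  then have "(\<Sum>k\<in>{1..n} - {i}. smult (c / (acoord q i - acoord q k))
        (G (pact (Transposition.transpose i k) q) * F (pact (Transposition.transpose i k) q))) =
      (\<Sum>k\<in>{1..n} - {i}. G q * smult (c / (acoord q i - acoord q k)) (F (pact (Transposition.transpose i k) q)))"
    by (intro sum.cong) auto
  then show "app (mY n c i * mult_op G) F q = app (mult_op G * mY n c i) F q"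
    by (simp add: app_mult_op app_mY distrib_left sum_distrib_left)
qed

section \<open>Commutativity of the Dunkl operators\<close>

lemma double_sum_diff_diagonal:
  fixes G G' :: "'b \<Rightarrow> 'b \<Rightarrow> 'a::ab_group_add"
  assumes "finite M" and "\<And>k l. k \<in> M \<Longrightarrow> l \<in> M \<Longrightarrow> k \<noteq> l \<Longrightarrow> G k l = G' l k"
  shows "(\<Sum>k\<in>M. \<Sum>l\<in>M. G k l) - (\<Sum>l\<in>M. \<Sum>k\<in>M. G' l k) = (\<Sum>m\<in>M. G m m - G' m m)"
proof -
  have "(\<Sum>k\<in>M. \<Sum>l\<in>M. G k l) - (\<Sum>l\<in>M. \<Sum>k\<in>M. G' l k) = (\<Sum>k\<in>M. \<Sum>l\<in>M. G k l - G' l k)"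
    by (subst (2) sum.swap) (simp add: sum_subtractf)
  also have "\<dots> = (\<Sum>k\<in>M. \<Sum>l\<in>M. if l = k then G k k - G' k k else 0)"
    using assms(2) by (intro sum.cong) auto
  also have "\<dots> = (\<Sum>m\<in>M. G m m - G' m m)"
    using assms(1) by simp
  finally show ?thesis .
qed

text \<open>The products of two reflections are sorted by their indices: s_ij twice, s_ij with one
  reflection involving a further index m, and s_ik with s_jl for k, l outside {i, j}. In the last
  group the second denominator is evaluated at the point moved by s_ik, whence
  \<open>T i k l\<close>.\<close>

lemma mY_mY_expand:
  fixes F :: func
  assumes ij: "i \<in> {1..n}" "j \<in> {1..n}" "i \<noteq> j"
  defines "M \<equiv> {1..n} - {i, j}" and "T \<equiv> Transposition.transpose :: nat \<Rightarrow> nat \<Rightarrow> nat \<Rightarrow> nat"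
  shows "app (mY n c i) (app (mY n c j) F) q =
    [:0, pcoord q i:] * ([:0, pcoord q j:] * F q)
    + ((\<Sum>m\<in>M. [:0, pcoord q i:] * smult (c / (acoord q j - acoord q m)) (F (pact (T j m) q)))
      + (\<Sum>m\<in>M. [:0, pcoord q j:] * smult (c / (acoord q i - acoord q m)) (F (pact (T i m) q))))
    + smult (c / (acoord q i - acoord q j) * (c / (acoord q i - acoord q j))) (F q)
    + ((\<Sum>m\<in>M. smult (c / (acoord q i - acoord q j) * (c / (acoord q i - acoord q m))) (F (pact (T i j \<circ> T j m) q))
      + smult (c / (acoord q i - acoord q m) * (c / (acoord q j - acoord q m))) (F (pact (T i m \<circ> T i j) q)))
    + (\<Sum>k\<in>M. \<Sum>l\<in>M. smult (c / (acoord q i - acoord q k) * (c / (acoord q j - acoord q (T i k l)))) (F (pact (T i k \<circ> T j l) q))))"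
    (is "?L = ?R")
proof -
  let ?a = "acoord q" and ?p = "pcoord q"
  have split: "sum h ({1..n} - {i}) = h j + sum h M" "sum h ({1..n} - {j}) = h i + sum h M" for h :: "nat \<Rightarrow> complex poly"
  proof -
    have "{1..n} - {i} = insert j M" "{1..n} - {j} = insert i M" using ij by (auto simp: M_def)
    moreover have "finite M" "i \<notin> M" "j \<notin> M" by (auto simp: M_def)
    ultimately show "sum h ({1..n} - {i}) = h j + sum h M" "sum h ({1..n} - {j}) = h i + sum h M"
      by (simp_all only: sum.insert not_False_eq_True)
  qed
  have T_inj: "inj (T k l)" for k l by (simp add: T_def)
  have pp: "pact (T k l) (pact (T r s) q) = pact (T r s \<circ> T k l) q" for k l r s
    by (simp add: pact_pact T_inj)
  have Tsym: "T k l = T l k" for k l by (simp add: T_def transpose_commute)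
  have TT: "T k l \<circ> T k l = id" for k l by (simp add: T_def)
  define Z where "Z = app (mY n c j) F"
  have Z: "Z r = [:0, pcoord r j:] * F r + (smult (c / (acoord r j - acoord r i)) (F (pact (T j i) r))
      + (\<Sum>l\<in>M. smult (c / (acoord r j - acoord r l)) (F (pact (T j l) r))))" for r
    by (simp add: Z_def app_mY split T_def)
  have Zij: "Z (pact (T i j) q) = [:0, ?p i:] * F (pact (T i j) q) + (smult (c / (?a i - ?a j)) (F q)
      + (\<Sum>m\<in>M. smult (c / (?a i - ?a m)) (F (pact (T i j \<circ> T j m) q))))"
  proof -
    have "T i j i = j" "T i j j = i" "\<And>m. m \<in> M \<Longrightarrow> T i j m = m"
      by (auto simp: T_def M_def transpose_def)
    then show ?thesis
      by (simp add: Z acoord_pact pcoord_pact T_inj pp Tsym[of j i] TT pact_id)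
  qed
  have Zik: "Z (pact (T i k) q) = [:0, ?p j:] * F (pact (T i k) q) + (smult (c / (?a j - ?a k)) (F (pact (T i k \<circ> T i j) q))
      + (\<Sum>l\<in>M. smult (c / (?a j - ?a (T i k l))) (F (pact (T i k \<circ> T j l) q))))" if "k \<in> M" for k
  proof -
    have "T i k i = k" "T i k j = j"
      using that ij by (auto simp: T_def M_def transpose_def)
    then show ?thesis
      by (simp add: Z acoord_pact pcoord_pact T_inj pp Tsym[of j i])
  qed
  have regroup: "(x + u + y) + ((v + z + w) + (y' + (f + g))) = x + (y + y') + z + ((w + f) + g)"
    if "u + v = 0" for u v w x y y' z f g :: "complex poly"
    using that by (simp add: eq_neg_iff_add_eq_0[symmetric])
  \<comment> \<open>At the point moved by s_ij the momentum p_j has become p_i, so the two terms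
    that combine a momentum with s_ij differ only in the sign of the denominator.\<close>
  have cancel: "[:0, ?p i:] * smult (c / (?a j - ?a i)) u + smult (c / (?a i - ?a j)) ([:0, ?p i:] * u) = 0" for u
  proof -
    have "c / (?a j - ?a i) = - (c / (?a i - ?a j))" by (metis minus_diff_eq divide_minus_right)
    then show ?thesis by simp
  qed
  have "?L = [:0, ?p i:] * Z q + (smult (c / (?a i - ?a j)) (Z (pact (T i j) q))
      + (\<Sum>k\<in>M. smult (c / (?a i - ?a k)) (Z (pact (T i k) q))))"
    by (simp add: Z_def[symmetric] app_mY split T_def)
  also have "(\<Sum>k\<in>M. smult (c / (?a i - ?a k)) (Z (pact (T i k) q))) =
     (\<Sum>m\<in>M. [:0, pcoord q j:] * smult (c / (?a i - ?a m)) (F (pact (T i m) q)))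
     + ((\<Sum>m\<in>M. smult (c / (?a i - ?a m) * (c / (?a j - ?a m))) (F (pact (T i m \<circ> T i j) q)))
     + (\<Sum>k\<in>M. \<Sum>l\<in>M. smult (c / (?a i - ?a k) * (c / (?a j - ?a (T i k l)))) (F (pact (T i k \<circ> T j l) q))))"
    by (simp only: sum.distrib[symmetric], rule sum.cong)
      (simp_all only: Zik smult_add_right smult_smult smult_sum_right mult_smult_right)
  also have "smult (c / (?a i - ?a j)) (Z (pact (T i j) q)) =
     smult (c / (?a i - ?a j)) ([:0, ?p i:] * F (pact (T i j) q))
      + smult (c / (?a i - ?a j) * (c / (?a i - ?a j))) (F q)
      + (\<Sum>m\<in>M. smult (c / (?a i - ?a j) * (c / (?a i - ?a m))) (F (pact (T i j \<circ> T j m) q)))"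
    by (simp only: Zij smult_add_right smult_smult smult_sum_right add.assoc)
  also have "[:0, ?p i:] * Z q = [:0, ?p i:] * ([:0, ?p j:] * F q) +
     [:0, ?p i:] * smult (c / (?a j - ?a i)) (F (pact (T i j) q)) +
     (\<Sum>m\<in>M. [:0, ?p i:] * smult (c / (?a j - ?a m)) (F (pact (T j m) q)))"
    by (simp only: Z distrib_left sum_distrib_left add.assoc Tsym[of j i])
  finally show ?thesis
    unfolding sum.distrib
    by (rule trans[OF _ regroup]) (rule cancel[of "F (pact (T i j) q)"])
qed

text \<open>The terms with momenta and the term with s_ij squared are symmetric in i and j. For k
  different from l the reflections s_ik and s_jl commute, so these terms cancel in pairs. For each
  further index m there remain the two 3-cycles on i, j, m, and their coefficients vanish.\<close>

lemma mY_comm: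
  assumes ij: "i \<in> {1..n}" "j \<in> {1..n}"
  shows "mY n c i * mY n c j = mY n c j * mY n c i"
proof (cases "i = j")
  case False
  show ?thesis
  proof (rule func_eqI)
    fix F :: func and q
    define M where "M = {1..n} - {i, j}"
    define T where "T = (Transposition.transpose :: nat \<Rightarrow> nat \<Rightarrow> nat \<Rightarrow> nat)"
    define r where "r = (\<lambda>k l. c / (acoord q k - acoord q l))"
    have Tsym: "T k l = T l k" for k l by (simp add: T_def transpose_commute)
    have M': "{1..n} - {j, i} = M" by (auto simp: M_def)
    define G where "G = (\<lambda>k l. smult (r i k * r j (T i k l)) (F (pact (T i k \<circ> T j l) q)))"
    define G' where "G' = (\<lambda>k l. smult (r j k * r i (T j k l)) (F (pact (T j k \<circ> T i l) q)))"
    have GG: "G k l = G' l k" if "k \<in> M" "l \<in> M" "k \<noteq> l" for k l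
    proof -
      have "T i k \<circ> T j l = T j l \<circ> T i k" "T i k l = l" "T j l k = k"
        using that False by (auto simp: T_def M_def transpose_def fun_eq_iff)
      then show ?thesis by (simp add: G_def G'_def mult.commute)
    qed
    define A where "A = (\<lambda>m. smult (r i j * r i m) (F (pact (T i j \<circ> T j m) q)) + smult (r i m * r j m) (F (pact (T i m \<circ> T i j) q)))"
    define B where "B = (\<lambda>m. smult (r j i * r j m) (F (pact (T j i \<circ> T i m) q)) + smult (r j m * r i m) (F (pact (T j m \<circ> T j i) q)))"
    have diag: "(G m m - G' m m) + (A m - B m) = 0" if "m \<in> M" for m
    proof -
      have cyc: "T i m \<circ> T i j = T i j \<circ> T j m" "T j m \<circ> T i m = T i j \<circ> T j m"
        "T j i \<circ> T i m = T i m \<circ> T j m" "T j m \<circ> T j i = T i m \<circ> T j m"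
        "T i m m = i" "T j m m = j"
        using that False by (auto simp: T_def M_def transpose_def fun_eq_iff)
      have ne: "acoord q i \<noteq> acoord q j" "acoord q i \<noteq> acoord q m" "acoord q j \<noteq> acoord q m"
        using that False by (auto simp: acoord_inj M_def)
      \<comment> \<open>With x = a_i - a_j and y = a_j - a_m, this identity and the next are, up to
        sign and the factor c^2, both the partial fraction formula 1/(x(x+y)) + 1/((x+y)y) =
        1/(xy).\<close>
      have r1: "r i j * r i m + r i m * r j m - r j m * r i j = 0"
        using ne by (simp add: r_def divide_simps) (simp add: algebra_simps)
      have r2: "r i m * r j i - r j i * r j m - r j m * r i m = 0"
        using ne by (simp add: r_def divide_simps) (simp add: algebra_simps)
      have "(G m m - G' m m) + (A m - B m) =
          smult (r i j * r i m + r i m * r j m - r j m * r i j) (F (pact (T i j \<circ> T j m) q))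
          + smult (r i m * r j i - r j i * r j m - r j m * r i m) (F (pact (T i m \<circ> T j m) q))"
        by (simp only: G_def G'_def A_def B_def cyc smult_add_left smult_diff_left) (simp add: algebra_simps)
      then show ?thesis by (simp only: r1 r2) simp
    qed
    have "(sum A M + (\<Sum>k\<in>M. \<Sum>l\<in>M. G k l)) - (sum B M + (\<Sum>k\<in>M. \<Sum>l\<in>M. G' k l)) =
       ((\<Sum>k\<in>M. \<Sum>l\<in>M. G k l) - (\<Sum>k\<in>M. \<Sum>l\<in>M. G' k l)) + (sum A M - sum B M)"
      by simp
    also have "\<dots> = (\<Sum>m\<in>M. (G m m - G' m m) + (A m - B m))"
      by (subst double_sum_diff_diagonal) (auto simp: GG M_def sum.distrib sum_subtractf)
    also have "\<dots> = 0"
      by (rule sum.neutral) (use diag in blast)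
    finally have key: "sum A M + (\<Sum>k\<in>M. \<Sum>l\<in>M. G k l) = sum B M + (\<Sum>k\<in>M. \<Sum>l\<in>M. G' k l)"
      by simp
    have sq: "r i j * r i j = r j i * r j i"
      by (simp add: r_def power2_eq_square[symmetric] power_divide power2_commute)
    have L: "app (mY n c i) (app (mY n c j) F) q =
      [:0, pcoord q i:] * ([:0, pcoord q j:] * F q)
      + ((\<Sum>m\<in>M. [:0, pcoord q i:] * smult (r j m) (F (pact (T j m) q)))
        + (\<Sum>m\<in>M. [:0, pcoord q j:] * smult (r i m) (F (pact (T i m) q))))
      + smult (r i j * r i j) (F q) + (sum A M + (\<Sum>k\<in>M. \<Sum>l\<in>M. G k l))"
      unfolding mY_mY_expand[OF ij False] M_def T_def r_def A_def G_def by simp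
    have R: "app (mY n c j) (app (mY n c i) F) q =
      [:0, pcoord q j:] * ([:0, pcoord q i:] * F q)
      + ((\<Sum>m\<in>M. [:0, pcoord q j:] * smult (r i m) (F (pact (T i m) q)))
        + (\<Sum>m\<in>M. [:0, pcoord q i:] * smult (r j m) (F (pact (T j m) q))))
      + smult (r j i * r j i) (F q) + (sum B M + (\<Sum>k\<in>M. \<Sum>l\<in>M. G' k l))"
      unfolding mY_mY_expand[OF ij(2,1) False[symmetric]] M' T_def r_def B_def G'_def by simp
    show "app (mY n c i * mY n c j) F q = app (mY n c j * mY n c i) F q"
      unfolding app_times L R key sq by (simp only: mult.left_commute add.commute)
  qed
qed simp

text \<open>Multiplication by the momentum cancels from the commutator. Each reflection contributes
  c times a divided difference of the coordinate a_j, which is 1 for k = j, -1 for j = i and 0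
  otherwise; these are the right-hand sides of the defining relations.\<close>

lemma mY_mX_aux:
  assumes "i \<in> {1..n}"
  shows "app (mY n c i) (app (mX j) F) q - app (mX j) (app (mY n c i) F) q =
    (\<Sum>k\<in>{1..n} - {i}. smult (c / (acoord q i - acoord q k) * (acoord q (Transposition.transpose i k j) - acoord q j))
       (F (pact (Transposition.transpose i k) q)))"
  by (simp add: app_mY app_mX acoord_pact smult_add_right smult_sum_right right_diff_distrib smult_diff_left
      sum_subtractf mult.commute)

lemma cherednik_rep_model: "cherednik_rep n c msc mX (mY n c) mS"
proof
  fix i j assume i: "i \<in> {1..n}" and j: "j \<in> {1..n}"
  assume ne: "i \<noteq> j"
  show "mY n c i * mX j = mX j * mY n c i + msc c * mS (Transposition.transpose i j)"
  proof (rule func_eqI)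
    fix F q
    have "app (mY n c i) (app (mX j) F) q - app (mX j) (app (mY n c i) F) q =
       (\<Sum>k\<in>{1..n} - {i}. if k = j then smult c (F (pact (Transposition.transpose i j) q)) else 0)"
      unfolding mY_mX_aux[OF i] using ne
      by (intro sum.cong refl) (auto simp: acoord_inj transpose_def)
    also have "\<dots> = smult c (F (pact (Transposition.transpose i j) q))"
      using ne j by simp
    finally show "app (mY n c i * mX j) F q = app (mX j * mY n c i + msc c * mS (Transposition.transpose i j)) F q"
      by (simp add: app_msc app_mS algebra_simps)
  qed
next
  fix i assume i: "i \<in> {1..n}"
  show "mY n c i * mX i = mX i * mY n c i - msc c * (\<Sum>j\<in>{1..n} - {i}. mS (Transposition.transpose i j))"
  proof (rule func_eqI)
    fix F q
    have "app (mY n c i) (app (mX i) F) q - app (mX i) (app (mY n c i) F) q =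
       (\<Sum>k\<in>{1..n} - {i}. - smult c (F (pact (Transposition.transpose i k) q)))"
      unfolding mY_mX_aux[OF i]
    proof (intro sum.cong refl)
      fix k assume "k \<in> {1..n} - {i}"
      then have "c / (acoord q i - acoord q k) * (acoord q (Transposition.transpose i k i) - acoord q i) = - c"
        by (auto simp: acoord_inj divide_simps algebra_simps)
      then show "smult (c / (acoord q i - acoord q k) * (acoord q (Transposition.transpose i k i) - acoord q i))
          (F (pact (Transposition.transpose i k) q)) = - smult c (F (pact (Transposition.transpose i k) q))"
        by simp
    qed
    then show "app (mY n c i * mX i) F q =
        app (mX i * mY n c i - msc c * (\<Sum>j\<in>{1..n} - {i}. mS (Transposition.transpose i j))) F q"
      by (simp add: app_msc app_mS app_sum_left sum_func_apply sum_negf smult_sum_right algebra_simps)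
  qed
next
  fix \<sigma> i assume \<sigma>: "\<sigma> permutes {1..n}" and i: "i \<in> {1..n}"
  note inj = permutes_inj[OF \<sigma>]
  show "mS \<sigma> * mX i = mX (\<sigma> i) * mS \<sigma>"
    by (rule func_eqI) (simp add: app_mS app_mX acoord_pact inj)
  show "mS \<sigma> * mY n c i = mY n c (\<sigma> i) * mS \<sigma>"
  proof (rule func_eqI)
    fix F q
    have "\<sigma> \<circ> Transposition.transpose i k = Transposition.transpose (\<sigma> i) (\<sigma> k) \<circ> \<sigma>" for k
      using inj by (auto simp: fun_eq_iff transpose_def inj_eq)
    moreover have "{1..n} - {\<sigma> i} = \<sigma> ` ({1..n} - {i})"
      using permutes_image[OF \<sigma>] inj by (simp add: image_set_diff)
    ultimately show "app (mS \<sigma> * mY n c i) F q = app (mY n c (\<sigma> i) * mS \<sigma>) F q"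
      using inj by (simp add: app_mS app_mY acoord_pact pcoord_pact pact_pact sum.reindex inj_on_subset)
  qed
next
  fix i a assume "i \<in> {1..n}"
  show "msc a * mY n c i = mY n c i * msc a"
    by (rule func_eqI) (simp add: app_msc app_mY smult_add_right smult_sum_right mult.commute)
next
  fix a b
  show "msc (a + b) = msc a + msc b"
    by (rule func_eqI) (simp add: app_msc smult_add_left)
  show "msc (a * b) = msc a * msc b"
    by (rule func_eqI) (simp add: app_msc)
  show "msc 1 = 1"
    by (rule func_eqI) (simp add: app_msc)
  show "mS id = 1"
    by (rule func_eqI) (simp add: app_mS pact_id)
next
  fix \<sigma> \<tau> assume "\<sigma> permutes {1..n}" "\<tau> permutes {1..n}"
  then show "mS (\<sigma> \<circ> \<tau>) = mS \<sigma> * mS \<tau>"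
    by (intro func_eqI) (simp add: app_mS pact_pact permutes_inj)
next
  fix i a
  show "msc a * mX i = mX i * msc a"
    by (rule func_eqI) (simp add: app_msc app_mX mult.commute)
next
  fix \<sigma> a
  show "msc a * mS \<sigma> = mS \<sigma> * msc a"
    by (rule func_eqI) (simp add: app_msc app_mS)
next
  fix i j
  show "mX i * mX j = mX j * mX i"
    by (rule func_eqI) (simp add: app_mX mult.commute)
qed (rule mY_comm)

section \<open>Independence of the normally ordered monomials\<close>

lemma exists_point: "inj a \<Longrightarrow> \<exists>q. acoord q = a \<and> pcoord q = p"
  by (rule exI[of _ "Abs_point (a, p)"])
    (simp add: acoord.rep_eq pcoord.rep_eq Abs_point_inverse)

text \<open>Coefficients are compared through their leading terms in the polynomial variable: every \<open>Y\<close>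
  raises the degree by one, and its leading part is multiplication by \<open>p\<close>.\<close>

definition lead :: "nat \<Rightarrow> func \<Rightarrow> (point \<Rightarrow> complex) \<Rightarrow> bool" where
  "lead d F L \<longleftrightarrow> (\<forall>q. degree (F q) \<le> d \<and> coeff (F q) d = L q)"

lemma lead_mX: "lead d F L \<Longrightarrow> lead d (app (mX i) F) (\<lambda>q. acoord q i * L q)"
  by (auto simp: lead_def app_mX intro: order_trans[OF degree_smult_le])

lemma lead_mS: "lead d F L \<Longrightarrow> lead d (app (mS \<sigma>) F) (\<lambda>q. L (pact \<sigma> q))"
  by (simp add: lead_def app_mS)

lemma lead_mY:
  assumes "lead d F L"
  shows "lead (Suc d) (app (mY n c i) F) (\<lambda>q. pcoord q i * L q)"
proof -
  have F: "degree (F q) \<le> d" "coeff (F q) d = L q" for q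
    using assms by (auto simp: lead_def)
  let ?r = "\<lambda>q. \<Sum>k\<in>{1..n} - {i}.
     smult (c / (acoord q i - acoord q k)) (F (pact (Transposition.transpose i k) q))"
  have r: "degree (?r q) \<le> d" for q
    by (rule degree_sum_le) (auto intro: order_trans[OF degree_smult_le] F)
  have "degree (app (mY n c i) F q) \<le> Suc d" for q
    unfolding app_mY
  proof (rule degree_add_le)
    show "degree ([:0, pcoord q i:] * F q) \<le> Suc d"
      using F(1)[of q] by (simp add: degree_pCons_eq_if le_trans[OF degree_smult_le])
    show "degree (?r q) \<le> Suc d"
      using r[of q] by simp
  qed
  moreover have "coeff (?r q) (Suc d) = 0" for q
    using r[of q] by (intro coeff_eq_0) simp
  ultimately show ?thesis
    by (simp add: lead_def app_mY F)
qed

lemma lead_mprod_mX: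
  assumes "lead d F L"
  shows "lead d (app (mprod mX A) F) (\<lambda>q. mprod (acoord q) A * L q)"
proof -
  have "lead d (app (prod_list (map mX xs)) F) (\<lambda>q. prod_list (map (acoord q) xs) * L q)" for xs
    by (induct xs) (use assms lead_mX in \<open>fastforce simp: mult.assoc\<close>)+
  then show ?thesis by (simp add: mprod_def)
qed

lemma lead_mprod_mY:
  assumes "lead d F L"
  shows "lead (d + size B) (app (mprod (mY n c) B) F) (\<lambda>q. mprod (pcoord q) B * L q)"
proof -
  have "lead (d + length xs) (app (prod_list (map (mY n c) xs)) F) (\<lambda>q. prod_list (map (pcoord q) xs) * L q)" for xs
  proof (induct xs)
    case (Cons x xs)
    from lead_mY[OF Cons, of n c x] show ?case by (simp add: mult.assoc)
  qed (use assms in simp)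
  from this[of "sorted_list_of_multiset B"] show ?thesis
    by (simp add: mprod_def flip: size_mset)
qed

text \<open>The moments are combined with the coefficients of a polynomial that vanishes at every
  \<open>m j\<close> except \<open>m k\<close>, which isolates the term of \<open>k\<close>.
  Exponent 0 is left out of the hypothesis, hence the condition that \<open>m k\<close> be
  nonzero.\<close>

lemma vandermonde:
  fixes m C :: "'b \<Rightarrow> complex"
  assumes "finite K" "inj_on m K" and k: "k \<in> K" "m k \<noteq> 0"
    and zero: "\<And>s. (\<Sum>k\<in>K. C k * m k ^ Suc s) = 0"
  shows "C k = 0"
proof -
  define f where "f = (\<Prod>j\<in>K - {k}. [:- m j, 1:])"
  have f: "poly f (m j) = (if j = k then poly f (m k) else 0)" if "j \<in> K" for j
    using that assms(1) by (auto simp: f_def poly_prod prod_zero_iff)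
  have "0 = (\<Sum>i\<le>degree f. coeff f i * (\<Sum>j\<in>K. C j * m j ^ Suc i))"
    by (simp only: zero) simp
  also have "\<dots> = (\<Sum>i\<le>degree f. \<Sum>j\<in>K. C j * m j * (coeff f i * m j ^ i))"
    by (simp add: sum_distrib_left algebra_simps)
  also have "\<dots> = (\<Sum>j\<in>K. C j * m j * poly f (m j))"
    by (subst sum.swap) (simp add: poly_altdef sum_distrib_left)
  also have "\<dots> = (\<Sum>j\<in>K. if j = k then C k * m k * poly f (m k) else 0)"
    by (intro sum.cong refl) (use f in auto)
  also have "\<dots> = C k * m k * poly f (m k)"
    using assms(1) k by simp
  finally show ?thesis
    using assms(1,2) k by (auto simp: f_def poly_prod inj_on_def)
qed

lemma count_image_mset_inj: "inj f \<Longrightarrow> count (image_mset f A) (f x) = count A x"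
  by (induct A) (auto simp: inj_eq)

lemma mprod_conv_prod_mset: "mprod (f :: nat \<Rightarrow> 'a::comm_monoid_mult) A = (\<Prod>i\<in>#A. f i)"
  unfolding mprod_def by (metis mset_map mset_sorted_list_of_multiset prod_mset_prod_list)

text \<open>Unique factorization: the weights are distinct primes, those of even index for the
  positions and those of odd index for the momenta, so the value of a monomial determines all its
  exponents.\<close>

lemma exists_distinguishing_weights:
  obtains w v :: "nat \<Rightarrow> nat"
  where "inj w" "\<And>i. w i > 1" "\<And>i. v i > 0"
    "inj (\<lambda>(A, B). (\<Prod>i\<in>#A. w i) * (\<Prod>i\<in>#B. v i))"
proof -
  define pr where "pr = enumerate {p::nat. prime p}"
  have pr: "prime (pr i)" for i
    using enumerate_in_set[OF primes_infinite, of i] by (simp add: pr_def)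
  have inj: "inj pr"
    unfolding pr_def by (rule strict_mono_imp_inj_on[OF strict_mono_enumerate[OF primes_infinite]])
  define w v where "w = (\<lambda>i. pr (2 * i))" and "v = (\<lambda>i. pr (2 * i + 1))"
  have inj_w: "inj w" and inj_v: "inj v"
    by (auto simp: w_def v_def intro!: injI dest!: injD[OF inj])
  have ne: "w i \<noteq> v j" for i j
    using inj by (auto simp: w_def v_def inj_eq) presburger
  have count: "count A i = multiplicity (w i) ((\<Prod>i\<in>#A. w i) * (\<Prod>i\<in>#B. v i))"
      "count B i = multiplicity (v i) ((\<Prod>i\<in>#A. w i) * (\<Prod>i\<in>#B. v i))" for A B i
  proof -
    let ?N = "image_mset w A + image_mset v B"
    have "prime_factorization (prod_mset ?N) = ?N"
      by (rule prime_factorization_prod_mset_primes) (auto simp: w_def v_def pr)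
    moreover have "count ?N (w i) = count A i" "count ?N (v i) = count B i"
      using ne ne[symmetric] by (auto simp: count_image_mset_inj inj_w inj_v count_eq_zero_iff)
    ultimately show "count A i = multiplicity (w i) ((\<Prod>i\<in>#A. w i) * (\<Prod>i\<in>#B. v i))"
      "count B i = multiplicity (v i) ((\<Prod>i\<in>#A. w i) * (\<Prod>i\<in>#B. v i))"
      using pr by (metis count_prime_factorization_prime prod_mset_Un w_def, metis count_prime_factorization_prime prod_mset_Un v_def)
  qed
  show ?thesis
  proof (rule that[of w v])
    show "inj (\<lambda>(A, B). (\<Prod>i\<in>#A. w i) * (\<Prod>i\<in>#B. v i))"
      by (rule injI) (auto intro!: multiset_eqI, metis count(1), metis count(2))
  qed (use inj_w pr in \<open>auto simp: w_def v_def prime_gt_0_nat prime_gt_1_nat\<close>)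
qed

text \<open>From a relation one keeps the terms of highest degree in the \<open>Y\<close>s with one
  fixed permutation. Their leading coefficients at a point are values of commutative monomials in
  positions and momenta; at powers of weights that distinguish the monomials these values form a
  Vandermonde system.\<close>

lemma model_independent:
  fixes C :: "mono \<Rightarrow> complex"
  assumes K: "finite K" "K \<subseteq> mono_index n"
    and zero: "(\<Sum>k\<in>K. msc (C k) * cherednik_rep.mon mX (mY n c) mS k) = 0"
  shows "\<forall>k\<in>K. C k = 0"
proof (rule ccontr)
  interpret model: cherednik_rep n c msc mX "mY n c" mS
    by (rule cherednik_rep_model)
  assume "\<not> (\<forall>k\<in>K. C k = 0)"
  define deg :: "mono \<Rightarrow> nat" where "deg = (\<lambda>(A, B, \<sigma>). size B)"
  define K' where "K' = {k \<in> K. C k \<noteq> 0}"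
  have K': "finite K'" "K' \<noteq> {}" "K' \<subseteq> mono_index n"
    using K \<open>\<not> (\<forall>k\<in>K. C k = 0)\<close> by (auto simp: K'_def)
  have zero': "(\<Sum>k\<in>K'. msc (C k) * model.mon k) = 0"
    using zero K by (subst (asm) sum.mono_neutral_right[of K K']) (auto simp: K'_def model.sc_0)
  define d where "d = Max (deg ` K')"
  have d_max: "deg k \<le> d" if "k \<in> K'" for k
    using that K' by (simp add: d_def)
  obtain k0 where k0: "k0 \<in> K'" "deg k0 = d"
  proof -
    have "d \<in> deg ` K'" unfolding d_def using K' by (intro Max_in) auto
    then show thesis using that by blast
  qed
  define \<sigma>0 where "\<sigma>0 = snd (snd k0)"
  have perm: "snd (snd k) permutes {1..n}" if "k \<in> K'" for k
    using that K' by (auto simp: mono_index_def)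
  define K'' where "K'' = {k \<in> K'. deg k = d \<and> snd (snd k) = \<sigma>0}"
  have k0'': "k0 \<in> K''"
    using k0 by (simp add: K''_def \<sigma>0_def)
  have vanish: "(\<Sum>k\<in>K''. C k * (mprod (acoord q) (fst k) * mprod (pcoord q) (fst (snd k)))) = 0" for q
  proof -
    define L where "L = (\<lambda>r. if r = pact \<sigma>0 q then 1 else 0 :: complex)"
    define F :: func where "F = (\<lambda>r. [:L r:])"
    have "lead 0 F L" by (simp add: lead_def F_def)
    then have lead: "lead (deg k) (app (model.mon k) F)
        (\<lambda>q. mprod (acoord q) (fst k) * (mprod (pcoord q) (fst (snd k)) * L (pact (snd (snd k)) q)))" for k
      using lead_mprod_mX[where A = "fst k", OF lead_mprod_mY[where n = n and c = c and B = "fst (snd k)",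
          OF lead_mS[where \<sigma> = "snd (snd k)", OF \<open>lead 0 F L\<close>]]]
      by (cases k) (simp add: deg_def)
    have coeff_mon: "coeff (app (model.mon k) F q) d =
        (if k \<in> K'' then mprod (acoord q) (fst k) * mprod (pcoord q) (fst (snd k)) else 0)" if "k \<in> K'" for k
    proof (cases "deg k = d")
      case True
      have "L (pact (snd (snd k)) q) = (if snd (snd k) = \<sigma>0 then 1 else 0)"
        using pact_eqD[of "snd (snd k)" \<sigma>0 q] perm[OF that] perm[OF k0(1)]
        by (auto simp: L_def \<sigma>0_def permutes_inj)
      then show ?thesis
        using lead[of k] True that by (simp add: lead_def K''_def)
    next
      case False
      then have "deg k < d" using d_max[OF that] by simp
      then have "coeff (app (model.mon k) F q) d = 0"
        using lead[of k] by (intro coeff_eq_0) (auto simp: lead_def intro: le_less_trans)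
      then show ?thesis using False by (simp add: K''_def)
    qed
    have "0 = coeff (app (\<Sum>k\<in>K'. msc (C k) * model.mon k) F q) d"
      by (simp add: zero')
    also have "\<dots> = (\<Sum>k\<in>K'. C k * coeff (app (model.mon k) F q) d)"
      by (simp add: app_sum_left sum_func_apply coeff_sum app_msc)
    also have "\<dots> = (\<Sum>k\<in>K'. if k \<in> K'' then C k * (mprod (acoord q) (fst k) * mprod (pcoord q) (fst (snd k))) else 0)"
      using coeff_mon by (intro sum.cong) auto
    also have "\<dots> = (\<Sum>k\<in>K''. C k * (mprod (acoord q) (fst k) * mprod (pcoord q) (fst (snd k))))"
      using K' by (intro sum.mono_neutral_cong_right) (auto simp: K''_def)
    finally show ?thesis by simp
  qed
  obtain w v :: "nat \<Rightarrow> nat" where w: "inj w" "\<And>i. w i > 1" "\<And>i. v i > 0"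
    and inj: "inj (\<lambda>(A, B). (\<Prod>i\<in>#A. w i) * (\<Prod>i\<in>#B. v i))"
    by (rule exists_distinguishing_weights) blast
  define m where "m = (\<lambda>k::mono. (\<Prod>i\<in>#fst k. w i) * (\<Prod>i\<in>#fst (snd k). v i))"
  have "C k0 = 0"
  proof (rule vandermonde[where m = "\<lambda>k. of_nat (m k)"])
    show "finite K''" using K' by (simp add: K''_def)
    show "inj_on (\<lambda>k. complex_of_nat (m k)) K''"
    proof (rule inj_onI)
      fix k l assume *: "k \<in> K''" "l \<in> K''" "complex_of_nat (m k) = of_nat (m l)"
      then have "m k = m l" by simp
      then have "(fst k, fst (snd k)) = (fst l, fst (snd l))"
        using injD[OF inj, of "(fst k, fst (snd k))" "(fst l, fst (snd l))"] by (simp add: m_def)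
      moreover have "snd (snd k) = snd (snd l)"
        using * by (simp add: K''_def)
      ultimately show "k = l" by (simp add: prod_eq_iff)
    qed
    show "complex_of_nat (m k0) \<noteq> 0"
      using w by (auto simp: m_def prod_mset_zero_iff) (metis less_irrefl not_less_zero)+
    fix s
    \<comment> \<open>Positions of a point must be distinct, while all powers with exponent 0 are
      equal to 1. Hence the moments start at exponent 1.\<close>
    have "inj (\<lambda>i. complex_of_nat (w i) ^ Suc s)"
    proof (rule injI)
      fix i j assume "complex_of_nat (w i) ^ Suc s = of_nat (w j) ^ Suc s"
      then have "w i ^ Suc s = w j ^ Suc s"
        by (metis of_nat_eq_iff of_nat_power)
      then show "i = j"
        using w(1) by (metis injD power_inject_base zero_le)
    qed
    then obtain q where q: "acoord q = (\<lambda>i. of_nat (w i) ^ Suc s)" "pcoord q = (\<lambda>i. of_nat (v i) ^ Suc s)"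
      using exists_point by blast
    have pow: "(\<Prod>i\<in>#A. (of_nat (f i) :: complex) ^ Suc s) = of_nat (\<Prod>i\<in>#A. f i) ^ Suc s" for f :: "nat \<Rightarrow> nat" and A
      by (induct A) (auto simp: power_mult_distrib simp del: power_Suc)
    have "mprod (acoord q) (fst k) * mprod (pcoord q) (fst (snd k)) = of_nat (m k) ^ Suc s" for k
      unfolding q mprod_conv_prod_mset pow m_def of_nat_mult power_mult_distrib ..
    then show "(\<Sum>k\<in>K''. C k * of_nat (m k) ^ Suc s) = 0"
      using vanish[of q] by simp
  qed (rule k0'')
  with k0 show False by (simp add: K'_def)
qed

section \<open>Transfer of identities from the model\<close>

text \<open>For commuting \<open>Z j\<close>, this is the coefficient of $T^k$ in $\prod_j (T - Z_j)$.\<close>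

fun char_coeff :: "(nat \<Rightarrow> 'a::{ring,monoid_mult}) \<Rightarrow> nat list \<Rightarrow> nat \<Rightarrow> 'a" where
  "char_coeff Z [] k = (if k = 0 then 1 else 0)"
| "char_coeff Z (j # js) k = (case k of 0 \<Rightarrow> 0 | Suc l \<Rightarrow> char_coeff Z js l) - Z j * char_coeff Z js k"

lemma fst_sum_prod: "fst (sum f A) = (\<Sum>x\<in>A. fst (f x))"
  and snd_sum_prod: "snd (sum f A) = (\<Sum>x\<in>A. snd (f x))"
  by (induct A rule: infinite_finite_induct) auto

lemma fst_mprod: "fst (mprod Z A) = mprod (\<lambda>i. fst (Z i)) A"
  and snd_mprod: "snd (mprod Z A) = mprod (\<lambda>i. snd (Z i)) A"
proof -
  have "fst (prod_list (map Z xs)) = prod_list (map (\<lambda>i. fst (Z i)) xs)"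
    "snd (prod_list (map Z xs)) = prod_list (map (\<lambda>i. snd (Z i)) xs)" for xs
    by (induct xs) auto
  then show "fst (mprod Z A) = mprod (\<lambda>i. fst (Z i)) A" "snd (mprod Z A) = mprod (\<lambda>i. snd (Z i)) A"
    by (simp_all add: mprod_def)
qed

lemma fst_char_coeff: "fst (char_coeff Z js k) = char_coeff (\<lambda>i. fst (Z i)) js k"
  and snd_char_coeff: "snd (char_coeff Z js k) = char_coeff (\<lambda>i. snd (Z i)) js k"
  by (induct js arbitrary: k) (auto split: nat.splits)

lemma mult_op_1: "mult_op (\<lambda>q. 1) = 1"
  and mult_op_0: "mult_op (\<lambda>q. 0) = 0"
  and mult_op_diff: "mult_op (\<lambda>q. G q - H q) = mult_op G - mult_op H"
  and mult_op_mult: "mult_op (\<lambda>q. G q * H q) = mult_op G * mult_op H"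
  by (rule func_eqI, simp add: app_mult_op algebra_simps)+

lemma char_coeff_mX: "char_coeff mX js k = mult_op (\<lambda>q. [:coeff (\<Prod>j\<leftarrow>js. [:- acoord q j, 1:]) k:])"
proof (induct js arbitrary: k)
  case (Cons j js)
  let ?P = "\<lambda>q. \<Prod>j\<leftarrow>js. [:- acoord q j, 1:]"
  have "mult_op (\<lambda>q. [:coeff (\<Prod>j\<leftarrow>j # js. [:- acoord q j, 1:]) k:]) =
     mult_op (\<lambda>q. [:case k of 0 \<Rightarrow> 0 | Suc l \<Rightarrow> coeff (?P q) l:] - [:acoord q j:] * [:coeff (?P q) k:])"
    by (rule arg_cong[of _ _ mult_op]) (auto simp: coeff_pCons split: nat.splits)
  also have "\<dots> = mult_op (\<lambda>q. [:case k of 0 \<Rightarrow> 0 | Suc l \<Rightarrow> coeff (?P q) l:]) - mX j * char_coeff mX js k"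
    by (simp only: mult_op_diff mult_op_mult mX_def[symmetric] Cons)
  also have "mult_op (\<lambda>q. [:case k of 0 \<Rightarrow> 0 | Suc l \<Rightarrow> coeff (?P q) l:]) = (case k of 0 \<Rightarrow> 0 | Suc l \<Rightarrow> char_coeff mX js l)"
    by (cases k) (simp_all add: mult_op_0 Cons)
  finally show ?case by simp
qed (auto simp: mult_op_1 mult_op_0 one_pCons[symmetric])

lemma invariant_char_coeff: "invariant n (\<lambda>q. [:coeff (\<Prod>j\<leftarrow>[1..<Suc n]. [:- acoord q j, 1:]) k:])"
proof -
  have *: "(\<Prod>j\<leftarrow>[1..<Suc n]. [:- acoord q j, 1:]) = (\<Prod>j\<in>{1..n}. [:- acoord q j, 1:])" for q
    by (simp add: prod.distinct_set_conv_list[symmetric] atLeastLessThanSuc_atLeastAtMost del: upt_Suc)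
  show ?thesis
    unfolding invariant_def *
  proof (intro allI impI)
    fix \<sigma> q assume \<sigma>: "\<sigma> permutes {1..n}"
    have "(\<Prod>j\<in>{1..n}. [:- acoord (pact \<sigma> q) j, 1:]) = (\<Prod>j\<in>{1..n}. [:- acoord q j, 1:])"
      using prod.permute[OF \<sigma>, of "\<lambda>j. [:- acoord q j, 1:]"]
      by (simp add: acoord_pact[OF permutes_inj[OF \<sigma>]] o_def)
    then show "[:coeff (\<Prod>j\<in>{1..n}. [:- acoord (pact \<sigma> q) j, 1:]) k:] = [:coeff (\<Prod>j\<in>{1..n}. [:- acoord q j, 1:]) k:]"
      by simp
  qed
qed

lemma model_normal_span_mult_op:
  assumes "z \<in> cherednik_rep.normal_span n msc mX (mY n c) mS" and G: "invariant n G"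
  shows "mult_op G * z = z * mult_op G"
proof -
  interpret model: cherednik_rep n c msc mX "mY n c" mS
    by (rule cherednik_rep_model)
  show ?thesis
    by (rule model.normal_span_commute[OF _ _ _ _ assms(1)])
      (simp_all add: mX_mult_op msc_mult_op mS_mult_op[OF G] mY_mult_op[OF G])
qed

section \<open>Pairing a representation with the model\<close>

context cherednik_rep
begin

definition symmetrizer :: 'a where
  "symmetrizer = sc (1 / fact n) * (\<Sum>\<sigma> | \<sigma> permutes {1..n}. S \<sigma>)"

lemma finite_perms: "finite {\<sigma>. \<sigma> permutes {1..n}}"
  by (rule finite_permutations) simp

lemma normal_span_symmetrizer: "symmetrizer \<in> normal_span"
  unfolding symmetrizer_def by (intro normal_span_sc normal_span_sum) (simp add: normal_span_S_in)

lemma normal_span_char_coeff: "set js \<subseteq> {1..n} \<Longrightarrow> char_coeff X js k \<in> normal_span"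
  by (induct js arbitrary: k) (auto split: nat.splits intro!: normal_span_diff normal_span_uminus normal_span_mult normal_span_1 normal_span_0 normal_span_X_in)

text \<open>In the product of the given representation with the model, an element is determined by the
  coefficients of a normal form, and these can be read off in the model. So an identity that holds
  in the model holds everywhere.\<close>

lemma pair: "cherednik_rep n c (\<lambda>a. (sc a, msc a)) (\<lambda>i. (X i, mX i)) (\<lambda>i. (Y i, mY n c i)) (\<lambda>\<sigma>. (S \<sigma>, mS \<sigma>))"
proof -
  interpret model: cherednik_rep n c msc mX "mY n c" mS
    by (rule cherednik_rep_model)
  show ?thesis
    by standard
      (simp_all add: prod_eq_iff fst_sum_prod snd_sum_prod sc_add sc_mult sc_1 sc_X sc_Y sc_S S_id S_comp S_X S_Y
        X_comm Y_comm YX_diff YX_same model.sc_add model.sc_mult model.sc_1 model.sc_X model.sc_Y model.sc_S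
        model.S_id model.S_comp model.S_X model.S_Y model.X_comm model.Y_comm model.YX_diff model.YX_same)
qed

interpretation pair: cherednik_rep n c "\<lambda>a. (sc a, msc a)" "\<lambda>i. (X i, mX i)" "\<lambda>i. (Y i, mY n c i)" "\<lambda>\<sigma>. (S \<sigma>, mS \<sigma>)"
  by (rule pair)

interpretation model: cherednik_rep n c msc mX "mY n c" mS
  by (rule cherednik_rep_model)

lemma fst_pair_mon: "fst (pair.mon k) = mon k" and snd_pair_mon: "snd (pair.mon k) = model.mon k"
  by (cases k; simp add: fst_mprod snd_mprod)+

lemma transfer:
  assumes "z \<in> pair.normal_span" "snd z = 0"
  shows "fst z = 0"
proof -
  obtain K C where K: "finite K" "K \<subseteq> mono_index n" "z = (\<Sum>k\<in>K. (sc (C k), msc (C k)) * pair.mon k)"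
    using pair.normal_span_expansion[OF assms(1)] by blast
  have "(\<Sum>k\<in>K. msc (C k) * model.mon k) = 0"
    using assms(2) by (simp add: K(3) snd_sum_prod snd_pair_mon)
  then have "\<forall>k\<in>K. C k = 0"
    by (rule model_independent[OF K(1,2)])
  then show ?thesis
    by (simp add: K(3) fst_sum_prod sc_0)
qed

text \<open>Any normal form of \<open>z\<close> can be read in the model with the same coefficients.
  No uniqueness of \<open>z'\<close> is claimed, so no homomorphism between the two sides has to be
  constructed.\<close>

lemma lift: "z \<in> normal_span \<Longrightarrow> \<exists>z'. (z, z') \<in> pair.normal_span"
proof (induct rule: normal_span.induct)
  case normal_span_0
  show ?case using pair.normal_span_0 by (auto simp: zero_prod_def)
next
  case (normal_span_step k z a)
  then obtain z' where "(z, z') \<in> pair.normal_span" by blast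
  from pair.normal_span_step[OF normal_span_step(1) this, of a] show ?case
    by (auto simp: fst_pair_mon plus_prod_def times_prod_def)
qed

lemma snd_pair_normal_span: "z \<in> pair.normal_span \<Longrightarrow> snd z \<in> model.normal_span"
  by (induct rule: pair.normal_span.induct) (auto simp: snd_pair_mon intro: model.normal_span.intros)

lemma char_coeff_X_commute:
  assumes "z \<in> normal_span"
  shows "char_coeff X [1..<Suc n] k * z = z * char_coeff X [1..<Suc n] k"
proof -
  let ?E = "char_coeff (\<lambda>i. (X i, mX i)) [1..<Suc n] k"
  obtain z' where z': "(z, z') \<in> pair.normal_span"
    using lift[OF assms] by blast
  have "?E \<in> pair.normal_span"
    by (rule pair.normal_span_char_coeff) auto
  then have mem: "?E * (z, z') - (z, z') * ?E \<in> pair.normal_span"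
    using z' by (intro pair.normal_span_diff pair.normal_span_mult)
  have "z' \<in> model.normal_span"
    using snd_pair_normal_span[OF z'] by simp
  then have "char_coeff mX [1..<Suc n] k * z' = z' * char_coeff mX [1..<Suc n] k"
    unfolding char_coeff_mX using model_normal_span_mult_op invariant_char_coeff by blast
  then show ?thesis
    using transfer[OF mem] by (simp add: fst_char_coeff snd_char_coeff del: upt_Suc)
qed

text \<open>The symmetrizer e produces invariant functions, and every element of the span commutes
  with multiplication by them. Hence e a, applied to an invariant function G, is G times its value
  at the constant function 1. So e a e b e is e followed by multiplication by two functions, one for
  a and one for b, and functions commute.\<close>

lemma model_sph_commute:
  assumes "a \<in> model.normal_span" "b \<in> model.normal_span"
  shows "model.symmetrizer * a * model.symmetrizer * b * model.symmetrizer = model.symmetrizer * b * model.symmetrizer * a * model.symmetrizer"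
proof (rule func_eqI)
  fix F q
  define one :: func where "one = (\<lambda>q. 1)"
  have inv: "invariant n (app model.symmetrizer F)" for F
  proof -
    have "(\<Sum>\<sigma> | \<sigma> permutes {1..n}. F (pact \<sigma> (pact \<tau> q))) = (\<Sum>\<sigma> | \<sigma> permutes {1..n}. F (pact \<sigma> q))"
      if \<tau>: "\<tau> permutes {1..n}" for \<tau> q
    proof -
      have "(\<Sum>\<sigma> | \<sigma> permutes {1..n}. F (pact \<sigma> (pact \<tau> q))) = (\<Sum>\<sigma> | \<sigma> permutes {1..n}. F (pact (\<tau> \<circ> \<sigma>) q))"
        using \<tau> by (intro sum.cong) (auto simp: pact_pact permutes_inj)
      also have "\<dots> = (\<Sum>\<sigma> | \<sigma> permutes {1..n}. F (pact \<sigma> q))"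
        by (rule sum.reindex_bij_witness[of _ "\<lambda>\<sigma>. inv_into UNIV \<tau> \<circ> \<sigma>" "\<lambda>\<sigma>. \<tau> \<circ> \<sigma>"])
          (use \<tau> in \<open>auto intro: permutes_compose permutes_inv simp: comp_assoc[symmetric] permutes_inv_o\<close>)
      finally show ?thesis .
    qed
    then show ?thesis
      by (simp add: invariant_def model.symmetrizer_def app_msc app_sum_left sum_func_apply app_mS)
  qed
  have mult: "app (mult_op G) one = G" for G
    by (rule ext) (simp add: app_mult_op one_def)
  have move: "app z (app (mult_op G) f) = app (mult_op G) (app z f)" if "z \<in> model.normal_span" "invariant n G" for z G f
    using model_normal_span_mult_op[OF that] by (simp flip: app_times)
  have calc: "app (model.symmetrizer * a * model.symmetrizer * b * model.symmetrizer) F q =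
      app model.symmetrizer F q * (app (model.symmetrizer * b) one q * app (model.symmetrizer * a) one q)"
    if a: "a \<in> model.normal_span" and b: "b \<in> model.normal_span" for a b
  proof -
    let ?G = "app model.symmetrizer F" and ?B = "app (model.symmetrizer * b) one"
    have sa: "model.symmetrizer * a \<in> model.normal_span" and sb: "model.symmetrizer * b \<in> model.normal_span"
      using a b model.normal_span_mult model.normal_span_symmetrizer by blast+
    have invB: "invariant n ?B" using inv[of "app b one"] by simp
    have "app (model.symmetrizer * a * model.symmetrizer * b * model.symmetrizer) F = app (model.symmetrizer * a) (app (model.symmetrizer * b) (app (mult_op ?G) one))"
      by (simp add: mult)
    also have "\<dots> = app (mult_op ?G) (app (model.symmetrizer * a) ?B)"
      by (simp only: move[OF sb inv] move[OF sa inv])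
    also have "app (model.symmetrizer * a) ?B = app (model.symmetrizer * a) (app (mult_op ?B) one)"
      by (simp only: mult)
    also have "\<dots> = app (mult_op ?B) (app (model.symmetrizer * a) one)"
      by (rule move[OF sa invB])
    finally show ?thesis by (simp only: app_mult_op)
  qed
  show "app (model.symmetrizer * a * model.symmetrizer * b * model.symmetrizer) F q = app (model.symmetrizer * b * model.symmetrizer * a * model.symmetrizer) F q"
    unfolding calc[OF assms] calc[OF assms(2,1)] by (simp only: mult.commute)
qed

lemma symmetrizer_commute:
  assumes "a \<in> normal_span" "b \<in> normal_span"
  shows "symmetrizer * a * symmetrizer * b * symmetrizer = symmetrizer * b * symmetrizer * a * symmetrizer"
proof -
  obtain a' b' where ab: "(a, a') \<in> pair.normal_span" "(b, b') \<in> pair.normal_span"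
    using assms lift by blast
  have s: "fst pair.symmetrizer = symmetrizer" "snd pair.symmetrizer = model.symmetrizer"
    by (simp_all add: pair.symmetrizer_def symmetrizer_def model.symmetrizer_def fst_sum_prod snd_sum_prod)
  let ?z = "pair.symmetrizer * (a, a') * pair.symmetrizer * (b, b') * pair.symmetrizer - pair.symmetrizer * (b, b') * pair.symmetrizer * (a, a') * pair.symmetrizer"
  have "?z \<in> pair.normal_span"
    using ab by (intro pair.normal_span_diff pair.normal_span_mult pair.normal_span_symmetrizer)
  moreover have "snd ?z = 0"
    using model_sph_commute[of a' b'] snd_pair_normal_span[OF ab(1)] snd_pair_normal_span[OF ab(2)] by (simp add: s)
  ultimately have "fst ?z = 0" by (rule transfer)
  then show ?thesis by (simp add: s)
qed

text \<open>The sign is forced by [-x_i, y_j] = [y_j, x_i]. Through this presentation everything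
  shown for the \<open>X i\<close> also applies to the \<open>Y i\<close>.\<close>

lemma swapped: "cherednik_rep n c sc Y (\<lambda>i. - X i) S"
proof
  fix i j assume ij: "i \<in> {1..n}" "j \<in> {1..n}" "i \<noteq> j"
  show "- X i * Y j = Y j * - X i + sc c * S (Transposition.transpose i j)"
    using YX_diff[OF ij(2,1)] ij(3) by (simp add: transpose_commute)
next
  fix i assume "i \<in> {1..n}"
  then show "- X i * Y i = Y i * - X i - sc c * (\<Sum>j\<in>{1..n} - {i}. S (Transposition.transpose i j))"
    using YX_same[of i] by simp
qed (simp_all add: sc_add sc_mult sc_1 sc_X sc_Y sc_S S_id S_comp S_X S_Y X_comm Y_comm)

end

section \<open>Schur's lemma in countable dimension\<close>

locale complex_space = vector_space scale for scale :: "complex \<Rightarrow> 'v::ab_group_add \<Rightarrow> 'v"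
begin

definition sc :: "complex \<Rightarrow> 'v aend" where
  "sc a = Aend (scale a)"

lemma app_sc: "app (sc a) v = scale a v"
  unfolding sc_def by (subst app_Aend) (simp_all add: scale_right_distrib)

definition lin :: "'v aend \<Rightarrow> bool" where
  "lin z \<longleftrightarrow> (\<forall>a v. app z (scale a v) = scale a (app z v))"

lemma lin_iff: "lin z \<longleftrightarrow> (\<forall>a. sc a * z = z * sc a)"
proof
  assume "lin z"
  then show "\<forall>a. sc a * z = z * sc a"
    by (auto intro!: aend_eqI simp: lin_def app_sc)
next
  assume *: "\<forall>a. sc a * z = z * sc a"
  have "app z (scale a v) = app (z * sc a) v" for a v by (simp add: app_sc)
  then show "lin z" by (simp add: lin_def *[rule_format, symmetric] app_sc)
qed

lemma lin_scale: "lin z \<Longrightarrow> app z (scale a v) = scale a (app z v)"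
  by (simp add: lin_def)

definition peval :: "'v aend \<Rightarrow> complex poly \<Rightarrow> 'v aend" where
  "peval z f = fold_coeffs (\<lambda>a g. sc a + z * g) f 0"

lemma sc_0: "sc 0 = 0"
  by (rule aend_eqI) (simp add: app_sc)

lemma peval_0: "peval z 0 = 0"
  by (simp add: peval_def)

lemma peval_pCons: "peval z (pCons a f) = sc a + z * peval z f"
  by (cases "pCons a f = 0") (auto simp: peval_def sc_0)

lemma sc_add: "sc (a + b) = sc a + sc b"
  by (rule aend_eqI) (simp add: app_sc scale_left_distrib)

lemma sc_mult: "sc (a * b) = sc a * sc b"
  by (rule aend_eqI) (simp add: app_sc)

lemma sc_1: "sc 1 = 1"
  by (rule aend_eqI) (simp add: app_sc)

lemma sc_diff: "sc (a - b) = sc a - sc b"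
  by (rule aend_eqI) (simp add: app_sc scale_left_diff_distrib)

lemma peval_add: "peval z (f + g) = peval z f + peval z g"
  by (induct f g rule: poly_induct2) (auto simp: peval_0 peval_pCons sc_add algebra_simps)

lemma peval_smult: assumes "lin z" shows "peval z (smult a f) = sc a * peval z f"
proof (induct f)
  case (pCons b f)
  have "z * (sc a * peval z f) = sc a * (z * peval z f)"
    using assms by (simp add: lin_iff flip: mult.assoc)
  with pCons show ?case by (simp add: peval_pCons sc_mult distrib_left)
qed (simp add: peval_0)

lemma peval_sum: "peval z (sum f A) = (\<Sum>i\<in>A. peval z (f i))"
  by (induct A rule: infinite_finite_induct) (auto simp: peval_0 peval_add)

lemma peval_linear_mult:
  assumes "lin z"
  shows "peval z ([:- r, 1:] * f) = (z - sc r) * peval z f"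
proof -
  have "[:- r, 1:] * f = pCons 0 f + smult (- r) f" by simp
  then have "peval z ([:- r, 1:] * f) = z * peval z f + sc (- r) * peval z f"
    by (simp only: peval_add peval_smult[OF assms] peval_pCons sc_0 add_0_left)
  moreover have "sc (- r) = - sc r" using sc_diff[of 0 r] by (simp add: sc_0)
  ultimately show ?thesis by (simp add: left_diff_distrib)
qed

lemma peval_commute: "lin z \<Longrightarrow> z * peval z f = peval z f * z"
proof (induct f)
  case (pCons b f)
  then have "z * (z * peval z f) = z * peval z f * z" by (metis mult.assoc)
  with pCons show ?case by (simp add: peval_pCons distrib_left distrib_right lin_iff)
qed (simp add: peval_0)

lemma peval_lin: "lin z \<Longrightarrow> lin (peval z f)"
proof (induct f)
  case (pCons b f)
  have "sc a * sc b = sc b * sc a" for a by (simp add: mult.commute flip: sc_mult)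
  moreover have "sc a * (z * peval z f) = z * peval z f * sc a" for a
    using pCons by (metis lin_iff mult.assoc)
  ultimately show ?case
    by (simp add: lin_iff peval_pCons distrib_left distrib_right)
qed (simp add: peval_0 lin_def)

text \<open>A countable set has only countably many finite subsets, and the span of each of them
  contains only finitely many elements of an independent set.\<close>

lemma countable_independent:
  assumes "countable E" "B \<subseteq> span E" "independent B"
  shows "countable B"
proof -
  have "B \<subseteq> (\<Union>F\<in>{F. finite F \<and> F \<subseteq> E}. B \<inter> span F)"
  proof
    fix b assume b: "b \<in> B"
    with assms obtain t r where "finite t" "t \<subseteq> E" "b = (\<Sum>a\<in>t. scale (r a) a)"
      by (auto simp: span_explicit)
    moreover have "(\<Sum>a\<in>t. scale (r a) a) \<in> span t"
      by (intro span_sum span_scale span_base)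
    ultimately have "b \<in> span t" "finite t" "t \<subseteq> E" by simp_all
    with b show "b \<in> (\<Union>F\<in>{F. finite F \<and> F \<subseteq> E}. B \<inter> span F)" by auto
  qed
  moreover have "finite (B \<inter> span F)" if "finite F" for F
    using independent_span_bound[OF that, of "B \<inter> span F"] independent_mono[OF assms(3)] by auto
  then have "countable (\<Union>F\<in>{F. finite F \<and> F \<subseteq> E}. B \<inter> span F)"
    by (intro countable_UN countable_Collect_finite_subset assms(1)) (auto intro: countable_finite)
  ultimately show ?thesis by (rule countable_subset)
qed

text \<open>If \<open>z\<close> is not a scalar on \<open>W\<close>, then all \<open>z - \<lambda>\<close> are invertible there, and the uncountably many
  vectors $(z - \lambda)^{-1} v$ are linearly independent (Dixmier).\<close>

theorem dixmier:
  assumes E: "countable E" "span E = UNIV" and W: "subspace W" "W \<noteq> {0}"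
    and z: "lin z" "\<And>w. w \<in> W \<Longrightarrow> app z w \<in> W"
    and C: "\<And>c w. c \<in> C \<Longrightarrow> w \<in> W \<Longrightarrow> app c (app z w) = app z (app c w)"
      "\<And>c. c \<in> C \<Longrightarrow> lin c" "\<And>c w. c \<in> C \<Longrightarrow> w \<in> W \<Longrightarrow> app c w \<in> W"
    and simple: "\<And>w u. w \<in> W \<Longrightarrow> w \<noteq> 0 \<Longrightarrow> u \<in> W \<Longrightarrow> \<exists>c\<in>C. u = app c w"
  shows "\<exists>l. \<forall>w\<in>W. app z w = scale l w"
proof (rule ccontr)
  assume contra: "\<not> ?thesis"
  \<comment> \<open>An eigenvector \<open>w\<close> generates \<open>W\<close> under operators that
    commute with \<open>z\<close>, so \<open>z\<close> would be the scalar \<open>l\<close> on all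
    of \<open>W\<close>.\<close>
  have inj: "w = 0" if w: "w \<in> W" "app z w = scale l w" for w l
  proof (rule ccontr)
    assume "w \<noteq> 0"
    have "app z u = scale l u" if u: "u \<in> W" for u
    proof -
      obtain c where c: "c \<in> C" "u = app c w"
        using simple[OF w(1) \<open>w \<noteq> 0\<close> u] by blast
      then show ?thesis using C(1)[OF c(1) w(1)] w(2) C(2)[OF c(1)] by (simp add: lin_scale)
    qed
    with contra show False by blast
  qed
  obtain v where v: "v \<in> W" "v \<noteq> 0"
    using W subspace_0 by blast
  \<comment> \<open>Choose \<open>c\<close> that sends (z - l) v, which is nonzero, to
    \<open>v\<close>. Since \<open>c\<close> commutes with \<open>z\<close>, the vector
    \<open>c v\<close> is a preimage of \<open>v\<close>.\<close>
  have "\<exists>u\<in>W. app (z - sc l) u = v" for l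
  proof -
    let ?w = "app z v - scale l v"
    have w: "?w \<in> W" using v z W by (intro subspace_diff subspace_scale) auto
    have "?w \<noteq> 0" using inj[of v l] v by auto
    then obtain c where c: "c \<in> C" "v = app c ?w"
      using simple[OF w] v by blast
    have "app (z - sc l) (app c v) = app c ?w"
      using C(1)[OF c(1) v(1)] C(2)[OF c(1)] by (simp add: app_sc app_diff lin_scale)
    then show ?thesis using C(3)[OF c(1) v(1)] c(2) by metis
  qed
  then obtain u where u: "\<And>l. u l \<in> W" "\<And>l. app (z - sc l) (u l) = v"
    by metis
  have peval_W: "app (peval z f) w \<in> W" if "w \<in> W" for f w
    by (induct f) (use that z W in \<open>auto simp: peval_0 peval_pCons app_sc intro!: subspace_add subspace_scale subspace_0\<close>)
  \<comment> \<open>Over the complex numbers a nonzero polynomial in \<open>z\<close> is a nonzero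
    constant times factors z - r, all injective on \<open>W\<close>.\<close>
  have peval_inj: "w = 0" if "f \<noteq> 0" "w \<in> W" "app (peval z f) w = 0" for f w
    using that
  proof (induct "degree f" arbitrary: f)
    case 0
    then obtain a where "f = [:a:]" "a \<noteq> 0" by (metis degree_eq_zeroE pCons_0_0)
    with 0 show ?case by (simp add: peval_pCons peval_0 app_sc)
  next
    case (Suc d)
    then obtain r where "poly f r = 0"
      using fundamental_theorem_of_algebra[of f] by (auto simp: constant_degree)
    then obtain g where g: "f = [:- r, 1:] * g"
      by (auto simp: poly_eq_0_iff_dvd)
    then have "g \<noteq> 0" "degree g = d"
      using Suc by (auto simp: degree_mult_eq simp del: mult_pCons_left)
    have "app (z - sc r) (app (peval z g) w) = 0"
      using Suc(5) by (simp only: g peval_linear_mult[OF z(1)] app_times)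
    then have "app z (app (peval z g) w) = scale r (app (peval z g) w)"
      by (simp add: app_sc)
    then have "app (peval z g) w = 0"
      using inj peval_W Suc(4) by blast
    then show ?case
      using Suc(1)[of g] \<open>g \<noteq> 0\<close> \<open>degree g = d\<close> Suc(4) by simp
  qed
  have u_inj: "inj u"
  proof (rule injI)
    fix l m assume "u l = u m"
    then have "app z (u l) - scale l (u l) = app z (u l) - scale m (u l)"
      using u(2)[of l] u(2)[of m] by (metis app_minus app_sc)
    then have "scale l (u l) = scale m (u l)" by simp
    moreover have "u l \<noteq> 0"
      using u(2)[of l] v(2) by (metis app_zero_right)
    ultimately show "l = m" by simp
  qed
  have zero: "g l = 0" if T: "finite T" "(\<Sum>m\<in>T. scale (g m) (u m)) = 0" "l \<in> T" for T g l
  proof -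
    \<comment> \<open>Denominators are cleared: applying the product of all z - k turns the relation
      among the (z - m)^(-1) v into a polynomial in \<open>z\<close> that kills \<open>v\<close>.
      That polynomial is therefore 0, and its value at \<open>l\<close> isolates
      \<open>g l\<close>.\<close>
    define P where "P = (\<lambda>m. \<Prod>k\<in>T - {m}. [:- k, 1:])"
    let ?Q = "\<Prod>k\<in>T. [:- k, 1:]"
    have Q: "app (peval z ?Q) (u m) = app (peval z (P m)) v" if m: "m \<in> T" for m
    proof -
      have "?Q = [:- m, 1:] * P m"
        unfolding P_def using T(1) m by (rule prod.remove)
      then have "peval z ?Q = peval z (P m) * (z - sc m)"
        using peval_linear_mult[OF z(1), of m "P m"] peval_commute[OF z(1)] peval_lin[OF z(1), of "P m"]
        by (simp add: left_diff_distrib right_diff_distrib lin_iff)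
      then show ?thesis by (simp only: app_times u(2))
    qed
    have "0 = app (peval z ?Q) (\<Sum>m\<in>T. scale (g m) (u m))"
      using T by simp
    also have "\<dots> = (\<Sum>m\<in>T. scale (g m) (app (peval z (P m)) v))"
      unfolding app_sum_right by (intro sum.cong refl) (simp add: lin_scale[OF peval_lin[OF z(1)]] Q)
    also have "\<dots> = app (peval z (\<Sum>m\<in>T. smult (g m) (P m))) v"
      by (simp add: peval_sum peval_smult[OF z(1)] app_sum_left app_sc)
    finally have "(\<Sum>m\<in>T. smult (g m) (P m)) = 0"
      using peval_inj[OF _ v(1)] v(2) by metis
    then have "0 = poly (\<Sum>m\<in>T. smult (g m) (P m)) l" by simp
    also have "\<dots> = (\<Sum>m\<in>T. g m * poly (P m) l)" by (simp add: poly_sum)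
    also have "\<dots> = (\<Sum>m\<in>T. if m = l then g l * poly (P l) l else 0)"
      using T by (intro sum.cong refl) (auto simp: P_def poly_prod prod_zero_iff)
    also have "\<dots> = g l * poly (P l) l"
      using T by simp
    finally show "g l = 0"
      using T by (auto simp: P_def poly_prod)
  qed
  have "independent (range u)"
    unfolding independent_explicit_finite_subsets
  proof (intro allI impI ballI)
    fix S g x assume S: "S \<subseteq> range u" "finite S" "(\<Sum>v\<in>S. scale (g v) v) = 0" and x: "x \<in> S"
    define T where "T = u -` S"
    have T: "S = u ` T" "finite T"
      using S finite_vimageI[OF S(2) u_inj] by (auto simp: T_def)
    have "(\<Sum>m\<in>T. scale (g (u m)) (u m)) = 0"
      using S(3) unfolding T(1) by (simp add: sum.reindex inj_on_subset[OF u_inj])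
    then show "g x = 0"
      using zero[OF T(2), of "\<lambda>m. g (u m)"] x T(1) by auto
  qed
  then have "countable (range u)"
    using countable_independent[OF E(1)] E(2) by simp
  then have "countable (UNIV :: complex set)"
    using countable_image_inj_eq[OF u_inj] by simp
  then show False
    using uncountable_UNIV_complex by simp
qed

end

section \<open>Irreducible representations are finite-dimensional\<close>

lemma char_coeff_eq_0: "length js < k \<Longrightarrow> char_coeff Z js k = 0"
  by (induct js arbitrary: k) (auto split: nat.splits)

lemma char_coeff_length: "char_coeff Z js (length js) = 1"
  by (induct js) (auto simp: char_coeff_eq_0)

lemma char_coeff_eval:
  assumes "\<And>j. j \<in> set js \<Longrightarrow> z * Z j = Z j * z"
  shows "(\<Sum>k\<le>length js. char_coeff Z js k * z ^ k) = (\<Prod>j\<leftarrow>js. z - Z j)"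
  using assms
proof (induct js)
  case (Cons j js)
  let ?P = "\<Prod>j\<leftarrow>js. z - Z j"
  have IH: "(\<Sum>k\<le>length js. char_coeff Z js k * z ^ k) = ?P"
    using Cons by simp
  have comm: "z * ?P = ?P * z"
  proof -
    have "z * (\<Prod>j\<leftarrow>xs. z - Z j) = (\<Prod>j\<leftarrow>xs. z - Z j) * z" if "set xs \<subseteq> set js" for xs
      using that
    proof (induct xs)
      case (Cons x xs)
      have "z * (z - Z x) = (z - Z x) * z"
        using Cons Cons.prems(1) \<open>\<And>i. i \<in> set (j # js) \<Longrightarrow> z * Z i = Z i * z\<close>
        by (auto simp: right_diff_distrib left_diff_distrib)
      then have "z * ((z - Z x) * (\<Prod>j\<leftarrow>xs. z - Z j)) = (z - Z x) * (z * (\<Prod>j\<leftarrow>xs. z - Z j))"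
        by (simp flip: mult.assoc)
      with Cons show ?case by (simp add: mult.assoc)
    qed simp
    then show ?thesis by simp
  qed
  have "(\<Sum>k\<le>length (j # js). char_coeff Z (j # js) k * z ^ k) =
     (\<Sum>k\<le>Suc (length js). (case k of 0 \<Rightarrow> 0 | Suc l \<Rightarrow> char_coeff Z js l) * z ^ k) - (\<Sum>k\<le>Suc (length js). Z j * (char_coeff Z js k * z ^ k))"
    by (simp only: char_coeff.simps length_Cons left_diff_distrib sum_subtractf mult.assoc)
  also have "(\<Sum>k\<le>Suc (length js). (case k of 0 \<Rightarrow> 0 | Suc l \<Rightarrow> char_coeff Z js l) * z ^ k) = ?P * z"
    unfolding sum.atMost_Suc_shift by (simp add: IH[symmetric] sum_distrib_right mult.assoc power_commutes)
  also have "(\<Sum>k\<le>Suc (length js). Z j * (char_coeff Z js k * z ^ k)) = Z j * ?P"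
    by (simp add: char_coeff_eq_0 IH[symmetric] sum_distrib_left)
  finally show ?case
    using comm by (simp add: left_diff_distrib)
qed simp

text \<open>One factor of the product of the \<open>Z i - Z j\<close> is zero. Once the coefficients
  are known to be scalars, this is a monic equation for \<open>Z i\<close> of degree
  \<open>length js\<close>.\<close>

lemma char_coeff_root:
  assumes "\<And>j. j \<in> set js \<Longrightarrow> Z i * Z j = Z j * Z i" and i: "i \<in> set js"
  shows "Z i ^ length js = - (\<Sum>k<length js. char_coeff Z js k * Z i ^ k)"
proof -
  obtain xs ys where "js = xs @ i # ys"
    using i by (auto simp: in_set_conv_decomp)
  then have "(\<Prod>j\<leftarrow>js. Z i - Z j) = 0"
    by simp
  then have "(\<Sum>k\<le>length js. char_coeff Z js k * Z i ^ k) = 0"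
    using char_coeff_eval[of js "Z i" Z] assms by simp
  then show ?thesis
    by (simp add: lessThan_Suc_atMost[symmetric] char_coeff_length eq_neg_iff_add_eq_0 add.commute)
qed

section \<open>Monomials with bounded exponents\<close>

definition reduced :: "nat \<Rightarrow> nat multiset set" where
  "reduced n = {A. set_mset A \<subseteq> {1..n} \<and> (\<forall>i. count A i < n)}"

lemma finite_reduced: "finite (reduced n)"
proof -
  have "(\<lambda>A. restrict (count A) {1..n}) ` reduced n \<subseteq> PiE {1..n} (\<lambda>_. {..<n})"
    by (auto simp: reduced_def)
  moreover have "inj_on (\<lambda>A. restrict (count A) {1..n}) (reduced n)"
  proof (rule inj_onI)
    fix A B assume *: "A \<in> reduced n" "B \<in> reduced n" "restrict (count A) {1..n} = restrict (count B) {1..n}"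
    have "count A i = count B i" for i
    proof (cases "i \<in> {1..n}")
      case True
      then show ?thesis using fun_cong[OF *(3), of i] by simp
    next
      case False
      then have "i \<notin># A" "i \<notin># B" using *(1,2) by (auto simp: reduced_def)
      then show ?thesis by (simp add: count_eq_zero_iff[symmetric])
    qed
    then show "A = B" by (rule multiset_eqI)
  qed
  moreover have "finite (PiE {1..n} (\<lambda>_. {..<n}))"
    by (rule finite_PiE) auto
  ultimately show ?thesis
    using inj_on_finite by blast
qed

text \<open>Replacing an n-th power by lower powers decreases the total degree, so induction on
  \<open>size A\<close> applies. The target is an arbitrary subspace \<open>U\<close> because the
  lemma is used for the \<open>X i\<close> and, under a fixed prefix of \<open>X\<close>s, again for
  the \<open>Y i\<close>.\<close>

lemma (in complex_space) mprod_reduce: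
  assumes n: "n \<ge> 1" and lin: "\<And>i. i \<in> {1..n} \<Longrightarrow> lin (Z i)"
    and comm: "\<And>i j. i \<in> {1..n} \<Longrightarrow> j \<in> {1..n} \<Longrightarrow> Z i * Z j = Z j * Z i"
    and root: "\<And>i. i \<in> {1..n} \<Longrightarrow> Z i ^ n = (\<Sum>k<n. sc (\<alpha> i k) * Z i ^ k)"
    and U: "subspace U" and red: "\<And>A. A \<in> reduced n \<Longrightarrow> app (mprod Z A) v \<in> U"
    and A: "set_mset A \<subseteq> {1..n}"
  shows "app (mprod Z A) v \<in> U"
  using A
proof (induct "size A" arbitrary: A rule: less_induct)
  case less
  have pow: "mprod Z (replicate_mset k i + B) = Z i ^ k * mprod Z B" if "set_mset B \<subseteq> {1..n}" "i \<in> {1..n}" for i k B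
  proof (induct k)
    case (Suc k)
    have "set_mset (replicate_mset k i + B) \<subseteq> {1..n}"
      using that by (auto simp: in_replicate_mset)
    then have "mprod Z (add_mset i (replicate_mset k i + B)) = Z i * mprod Z (replicate_mset k i + B)"
      using comm that by (intro mprod_add) blast
    with Suc show ?case by (simp add: mult.assoc)
  qed simp
  show ?case
  proof (cases "A \<in> reduced n")
    case False
    then obtain i where i: "count A i \<ge> n"
      using less.prems by (auto simp: reduced_def not_less)
    have iA: "i \<in> {1..n}"
      using i n less.prems by (metis count_eq_zero_iff le_zero_eq not_one_le_zero subsetD)
    define B where "B = A - replicate_mset n i"
    have AB: "A = replicate_mset n i + B"
      using i by (simp add: B_def count_le_replicate_mset_subset_eq)
    have B: "set_mset B \<subseteq> {1..n}"
      using less.prems by (auto simp: B_def dest: in_diffD)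
    have "app (mprod Z (replicate_mset k i + B)) v \<in> U" if "k < n" for k
      using that B iA by (intro less.hyps) (auto simp: AB in_replicate_mset)
    moreover have "app (mprod Z A) v = (\<Sum>k<n. scale (\<alpha> i k) (app (mprod Z (replicate_mset k i + B)) v))"
      unfolding AB pow[OF B iA] root[OF iA] by (simp add: app_sum_left app_sc)
    ultimately show ?thesis
      using U by (auto intro!: subspace_sum subspace_scale)
  qed (rule red)
qed

section \<open>Irreducible modules: cyclic vectors, Schur's lemma, finite dimension\<close>

locale cherednik_irrep = complex_space scale + H?: cherednik_rep n c "complex_space.sc scale" X Y S
  for scale :: "complex \<Rightarrow> 'v::ab_group_add \<Rightarrow> 'v" and n c X Y S +
  assumes n: "n \<ge> 1" and c: "c \<noteq> 0" and nonzero: "\<exists>v::'v. v \<noteq> 0"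
    and irreducible: "\<And>W. \<lbrakk>subspace W; \<And>i w. i \<in> {1..n} \<Longrightarrow> w \<in> W \<Longrightarrow> app (X i) w \<in> W;
      \<And>i w. i \<in> {1..n} \<Longrightarrow> w \<in> W \<Longrightarrow> app (Y i) w \<in> W;
      \<And>\<sigma> w. \<sigma> permutes {1..n} \<Longrightarrow> w \<in> W \<Longrightarrow> app (S \<sigma>) w \<in> W\<rbrakk> \<Longrightarrow> W = {0} \<or> W = UNIV"
begin

lemma lin_normal_span: "z \<in> normal_span \<Longrightarrow> lin z"
  using sc_normal_span by (simp add: lin_iff)

lemma cyclic:
  assumes "v \<noteq> 0"
  shows "\<exists>z\<in>normal_span. u = app z v"
proof -
  let ?W = "(\<lambda>z. app z v) ` normal_span"
  have "subspace ?W"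
  proof (rule subspaceI)
    show "0 \<in> ?W" using normal_span_0 by (intro image_eqI[of _ _ 0]) auto
  next
    fix x y assume "x \<in> ?W" "y \<in> ?W"
    then obtain z w where "x = app z v" "y = app w v" "z \<in> normal_span" "w \<in> normal_span" by auto
    then show "x + y \<in> ?W" using normal_span_add by (intro image_eqI[of _ _ "z + w"]) auto
  next
    fix a x assume "x \<in> ?W"
    then obtain z where "x = app z v" "z \<in> normal_span" by auto
    then show "scale a x \<in> ?W" using normal_span_sc by (intro image_eqI[of _ _ "sc a * z"]) (auto simp: app_sc)
  qed
  moreover have "app w x \<in> ?W" if "w \<in> normal_span" "x \<in> ?W" for w x
    using that normal_span_mult by (force simp flip: app_times)
  moreover have "v \<in> ?W"
    using normal_span_1 by (intro image_eqI[of _ _ 1]) auto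
  ultimately have "?W = UNIV"
    using irreducible[of ?W] normal_span_X_in normal_span_Y_in normal_span_S_in assms by blast
  then show ?thesis by auto
qed

lemma mon_span:
  assumes "v \<noteq> 0"
  shows "span ((\<lambda>k. app (mon k) v) ` mono_index n) = UNIV"
proof -
  have "u \<in> span ((\<lambda>k. app (mon k) v) ` mono_index n)" for u
  proof -
    obtain z where z: "z \<in> normal_span" "u = app z v"
      using cyclic[OF assms] by blast
    then obtain K C where "finite K" "K \<subseteq> mono_index n" "z = (\<Sum>k\<in>K. sc (C k) * mon k)"
      using normal_span_expansion by blast
    then have "u = (\<Sum>k\<in>K. scale (C k) (app (mon k) v))"
      by (simp add: z app_sum_left app_sc)
    moreover have "(\<Sum>k\<in>K. scale (C k) (app (mon k) v)) \<in> span ((\<lambda>k. app (mon k) v) ` mono_index n)"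
      using \<open>K \<subseteq> mono_index n\<close> by (intro span_sum span_scale span_base) blast
    ultimately show ?thesis by simp
  qed
  then show ?thesis by auto
qed

lemma countable_multiset: "countable (UNIV :: nat multiset set)"
  using countable_image[OF countableI_type, of mset "UNIV :: nat list set"] by (simp add: surj_mset)

lemma countable_mono_index: "countable (mono_index n)"
proof -
  have "mono_index n \<subseteq> UNIV \<times> UNIV \<times> {\<sigma>. \<sigma> permutes {1..n}}"
    by (auto simp: mono_index_def)
  moreover have "countable (UNIV \<times> UNIV \<times> {\<sigma>. \<sigma> permutes {1..n}} :: mono set)"
    by (intro countable_SIGMA countable_finite[OF finite_perms] countable_multiset)
  ultimately show ?thesis by (rule countable_subset)
qed

text \<open>Every nonzero vector is cyclic, and there are only countably many ordered
  monomials.\<close>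

lemma countable_span: obtains E where "countable E" "span E = UNIV"
proof -
  obtain v :: 'v where "v \<noteq> 0" using nonzero by blast
  then show thesis
    using that[OF countable_image[OF countable_mono_index]] mon_span by blast
qed

lemma schur:
  assumes "lin z" "\<And>w. w \<in> normal_span \<Longrightarrow> w * z = z * w"
  shows "\<exists>l. z = sc l"
proof -
  obtain E where E: "countable E" "span E = UNIV"
    by (rule countable_span)
  have "\<exists>l. \<forall>w\<in>UNIV. app z w = scale l w"
  proof (rule dixmier[OF E, where C = normal_span])
    show "UNIV \<noteq> {0::'v}" using nonzero by auto
    fix w assume "w \<in> normal_span"
    then show "app w (app z v) = app z (app w v)" for v
      using assms(2) by (simp flip: app_times)
  qed (use assms cyclic lin_normal_span in auto)
  then show ?thesis by (auto intro!: aend_eqI simp: app_sc)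
qed

interpretation swap: cherednik_rep n c sc Y "\<lambda>i. - X i" S
  by (rule swapped)

lemma char_coeff_scalar: "\<exists>l. char_coeff X [1..<Suc n] k = sc l" "\<exists>l. char_coeff Y [1..<Suc n] k = sc l"
proof -
  have "char_coeff X [1..<Suc n] k \<in> normal_span" by (rule normal_span_char_coeff) auto
  then show "\<exists>l. char_coeff X [1..<Suc n] k = sc l"
    using char_coeff_X_commute lin_normal_span by (metis schur)
  let ?E = "char_coeff Y [1..<Suc n] k"
  \<comment> \<open>The swapped presentation yields commutation only with the span of monomials in
    the opposite order. Checking the generators brings this back to
    \<open>normal_span\<close>.\<close>
  have comm: "?E * w = w * ?E" if "w \<in> normal_span" for w
  proof (rule normal_span_commute[OF _ _ _ _ that])
    fix i assume "i \<in> {1..n}"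
    then show "?E * X i = X i * ?E" "?E * Y i = Y i * ?E"
      using swap.char_coeff_X_commute[OF swap.normal_span_Y_in] swap.char_coeff_X_commute[OF swap.normal_span_X_in] by simp_all
  qed (use swap.char_coeff_X_commute[OF swap.normal_span_S_in] swap.char_coeff_X_commute[OF swap.normal_span_sc_in] in auto)
  then show "\<exists>l. ?E = sc l"
    using normal_span_sc_in by (metis schur lin_iff)
qed

lemma roots:
  "\<exists>\<alpha>. \<forall>i\<in>{1..n}. X i ^ n = (\<Sum>k<n. sc (\<alpha> i k) * X i ^ k)"
  "\<exists>\<alpha>. \<forall>i\<in>{1..n}. Y i ^ n = (\<Sum>k<n. sc (\<alpha> i k) * Y i ^ k)"
proof -
  obtain l m where lm: "\<And>k. char_coeff X [1..<Suc n] k = sc (l k)" "\<And>k. char_coeff Y [1..<Suc n] k = sc (m k)"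
    using char_coeff_scalar by metis
  have neg: "- sc a = sc (- a)" for a by (simp add: sc_uminus)
  have "X i ^ n = (\<Sum>k<n. sc (- l k) * X i ^ k)" if "i \<in> {1..n}" for i
    using char_coeff_root[of "[1..<Suc n]" X i] X_comm that
    by (simp add: lm sum_negf[symmetric] neg[symmetric] del: upt_Suc)
  then show "\<exists>\<alpha>. \<forall>i\<in>{1..n}. X i ^ n = (\<Sum>k<n. sc (\<alpha> i k) * X i ^ k)"
    by (intro exI[of _ "\<lambda>i k. - l k"]) blast
  have "Y i ^ n = (\<Sum>k<n. sc (- m k) * Y i ^ k)" if "i \<in> {1..n}" for i
    using char_coeff_root[of "[1..<Suc n]" Y i] Y_comm that
    by (simp add: lm sum_negf[symmetric] neg[symmetric] del: upt_Suc)
  then show "\<exists>\<alpha>. \<forall>i\<in>{1..n}. Y i ^ n = (\<Sum>k<n. sc (\<alpha> i k) * Y i ^ k)"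
    by (intro exI[of _ "\<lambda>i k. - m k"]) blast
qed

theorem finite_dimensional: "\<exists>F. finite F \<and> span F = UNIV"
proof -
  obtain v :: 'v where v: "v \<noteq> 0" using nonzero by blast
  obtain \<alpha> \<beta> where \<alpha>: "\<And>i. i \<in> {1..n} \<Longrightarrow> X i ^ n = (\<Sum>k<n. sc (\<alpha> i k) * X i ^ k)"
    and \<beta>: "\<And>i. i \<in> {1..n} \<Longrightarrow> Y i ^ n = (\<Sum>k<n. sc (\<beta> i k) * Y i ^ k)"
    using roots by blast
  let ?I = "reduced n \<times> reduced n \<times> {\<sigma>. \<sigma> permutes {1..n}}"
  let ?F = "(\<lambda>k. app (mon k) v) ` ?I"
  have "finite ?F"
    using finite_reduced finite_perms by simp
  moreover have "app (mon (A, B, \<sigma>)) v \<in> span ?F"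
    if A: "set_mset A \<subseteq> {1..n}" and B: "set_mset B \<subseteq> {1..n}" and \<sigma>: "\<sigma> permutes {1..n}" for A B \<sigma>
  proof -
    have linX: "lin (X i)" and linY: "lin (Y i)" if "i \<in> {1..n}" for i
      using that lin_normal_span normal_span_X_in normal_span_Y_in by blast+
    have red: "app (mprod X A) (app (mprod Y B) (app (S \<sigma>) v)) \<in> span ?F" if "B \<in> reduced n" for B
    proof (rule mprod_reduce[OF n linX X_comm \<alpha> _ _ A])
      fix A assume "A \<in> reduced n"
      then have "app (mon (A, B, \<sigma>)) v \<in> ?F"
        using that \<sigma> by blast
      then show "app (mprod X A) (app (mprod Y B) (app (S \<sigma>) v)) \<in> span ?F"
        by (intro span_base) simp
    qed auto
    \<comment> \<open>The exponents of the \<open>Y\<close>s are reduced underneath the prefix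
      \<open>mprod X A\<close>, which has arbitrary exponents here; \<open>red\<close> then settles
      the case of a reduced \<open>B\<close>.\<close>
    let ?U = "{w. app (mprod X A) w \<in> span ?F}"
    have "lin (mprod X A)"
      using sc_mprod_X[OF A] by (simp add: lin_iff)
    then have "subspace ?U"
      by (auto simp: subspace_def app_add lin_scale span_zero span_add span_scale)
    then have "app (mprod Y B) (app (S \<sigma>) v) \<in> ?U"
      by (intro mprod_reduce[OF n linY Y_comm \<beta> _ _ B]) (use red in auto)
    then show ?thesis by simp
  qed
  then have "(\<lambda>k. app (mon k) v) ` mono_index n \<subseteq> span ?F"
    by (auto simp: mono_index_def simp del: mon.simps)
  then have "span ?F = UNIV"
    using mon_span[OF v] span_minimal[OF _ subspace_span] by blast
  ultimately show ?thesis by blast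
qed

end

section \<open>Traces\<close>

context complex_space
begin

text \<open>Linearity is only asked on a subset \<open>V\<close>: traces are taken also on the group
  algebra, which in general is a proper subspace of its function type.\<close>

definition endo :: "'v set \<Rightarrow> ('v \<Rightarrow> 'v) \<Rightarrow> bool" where
  "endo V f \<longleftrightarrow> (\<forall>x\<in>V. \<forall>y\<in>V. f (x + y) = f x + f y) \<and> (\<forall>a. \<forall>x\<in>V. f (scale a x) = scale a (f x)) \<and> f ` V \<subseteq> V"

definition tr :: "'v set \<Rightarrow> ('v \<Rightarrow> 'v) \<Rightarrow> complex" where
  "tr B f = (\<Sum>b\<in>B. representation B (f b) b)"

lemma endo_0: "endo (span B) f \<Longrightarrow> f 0 = 0"
proof -
  assume f: "endo (span B) f"
  have "f (scale 0 0) = scale 0 (f 0)"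
    using f span_zero[of B] unfolding endo_def by blast
  then show ?thesis by simp
qed

lemma endo_sum:
  assumes f: "endo (span B) f" and "\<And>i. i \<in> I \<Longrightarrow> x i \<in> span B"
  shows "f (\<Sum>i\<in>I. scale (a i) (x i)) = (\<Sum>i\<in>I. scale (a i) (f (x i)))"
  using assms(2)
proof (induct I rule: infinite_finite_induct)
  case (insert i I)
  have "scale (a i) (x i) \<in> span B" "(\<Sum>i\<in>I. scale (a i) (x i)) \<in> span B"
    using insert by (auto intro!: span_scale span_sum)
  then have "f (\<Sum>i\<in>insert i I. scale (a i) (x i)) = f (scale (a i) (x i)) + f (\<Sum>i\<in>I. scale (a i) (x i))"
    using insert(1,2) f by (simp add: endo_def)
  then show ?case
    using insert f by (simp add: endo_def)
qed (simp_all add: endo_0[OF f])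

lemma endo_expand:
  assumes B: "finite B" "independent B" and f: "endo (span B) f" and x: "x \<in> span B"
  shows "f x = (\<Sum>b\<in>B. scale (representation B x b) (f b))"
proof -
  have "f x = f (\<Sum>b\<in>B. scale (representation B x b) b)"
    using sum_representation_eq[OF B(2) x B(1)] by simp
  also have "\<dots> = (\<Sum>b\<in>B. scale (representation B x b) (f b))"
    by (rule endo_sum[OF f span_base])
  finally show ?thesis .
qed

text \<open>The product of matrices with respect to two bases. The case \<open>C = B\<close> gives
  \<open>tr_comm\<close>, and \<open>f\<close> or the identity with two different bases gives
  \<open>tr_basis_change\<close>.\<close>

lemma representation_expand:
  assumes B: "finite B" "independent B" and C: "independent C" "span C = span B"
    and f: "endo (span B) f" and x: "x \<in> span B"
  shows "representation C (f x) c = (\<Sum>b\<in>B. representation B x b * representation C (f b) c)"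
proof -
  have fB: "f b \<in> span C" if "b \<in> B" for b
    using f that C(2) span_base[OF that] by (auto simp: endo_def)
  have "representation C (f x) = representation C (\<Sum>b\<in>B. scale (representation B x b) (f b))"
    using endo_expand[OF B f x] by simp
  also have "\<dots> = (\<lambda>c. \<Sum>b\<in>B. representation C (scale (representation B x b) (f b)) c)"
    by (rule representation_sum[OF C(1)]) (simp add: fB span_scale)
  finally show ?thesis
    by (simp add: representation_scale[OF C(1) fB])
qed

lemma endo_id: "endo V (\<lambda>x. x)"
  by (simp add: endo_def)

lemma tr_comm:
  assumes B: "finite B" "independent B" and f: "endo (span B) f" and g: "endo (span B) g"
  shows "tr B (\<lambda>x. f (g x)) = tr B (\<lambda>x. g (f x))"
proof -
  have *: "tr B (\<lambda>x. f (g x)) = (\<Sum>b\<in>B. \<Sum>d\<in>B. representation B (g b) d * representation B (f d) b)"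
    if f: "endo (span B) f" and g: "endo (span B) g" for f g
    unfolding tr_def using g
    by (intro sum.cong refl representation_expand[OF B B(2) refl f]) (auto simp: endo_def span_base)
  show ?thesis
    unfolding *[OF f g] *[OF g f] by (subst sum.swap) (simp add: mult.commute)
qed

lemma tr_basis_change:
  assumes B: "finite B" "independent B" and C: "finite C" "independent C" and BC: "span B = span C"
    and f: "endo (span B) f"
  shows "tr B f = tr C f"
proof -
  have fB: "f b \<in> span C" if "b \<in> span B" for b
    using f that BC by (auto simp: endo_def)
  have "tr B f = (\<Sum>b\<in>B. \<Sum>c\<in>C. representation C (f b) c * representation B c b)"
    unfolding tr_def
  proof (intro sum.cong refl)
    fix b assume "b \<in> B"
    then have "f b \<in> span C" using fB span_base by blast
    then show "representation B (f b) b = (\<Sum>c\<in>C. representation C (f b) c * representation B c b)"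
      using representation_expand[OF C B(2) BC endo_id] by simp
  qed
  also have "\<dots> = (\<Sum>c\<in>C. \<Sum>b\<in>B. representation B c b * representation C (f b) c)"
    by (subst sum.swap) (simp add: mult.commute)
  also have "\<dots> = tr C f"
    unfolding tr_def using BC
    by (intro sum.cong refl representation_expand[OF B C(2) BC[symmetric] f, symmetric]) (auto simp: span_base)
  finally show ?thesis .
qed

text \<open>In a basis that extends a basis \<open>C\<close> of the image, \<open>f\<close> fixes
  the vectors of \<open>C\<close> and sends the others into \<open>span C\<close>. The diagonal thus
  has 1 at \<open>C\<close> and 0 elsewhere.\<close>

lemma tr_idempotent:
  assumes B: "finite B" "independent B" and f: "endo (span B) f" and idem: "\<And>x. x \<in> span B \<Longrightarrow> f (f x) = f x"
  shows "tr B f = of_nat (dim (f ` span B))"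
proof -
  obtain C where C: "C \<subseteq> f ` span B" "independent C" "f ` span B \<subseteq> span C"
    by (rule maximal_independent_subset)
  have fB: "f ` span B \<subseteq> span B" using f by (simp add: endo_def)
  obtain D where D: "C \<subseteq> D" "D \<subseteq> span B" "independent D" "span B \<subseteq> span D"
    using maximal_independent_subset_extend[of C "span B"] C fB by blast
  have DB: "span D = span B"
    using D span_minimal[OF D(2) subspace_span] by blast
  have fin: "finite D"
    using independent_span_bound[OF B(1) D(3,2)] by simp
  have "tr B f = tr D f"
    using tr_basis_change[OF B fin D(3) DB[symmetric] f] .
  also have "\<dots> = (\<Sum>b\<in>D. if b \<in> C then 1 else 0)"
    unfolding tr_def
  proof (intro sum.cong refl)
    fix b assume b: "b \<in> D"
    show "representation D (f b) b = (if b \<in> C then 1 else 0)"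
    proof (cases "b \<in> C")
      case True
      then obtain x where "x \<in> span B" "b = f x" using C by auto
      then have "f b = b" using idem by simp
      then show ?thesis
        using True b by (simp add: representation_basis[OF D(3)])
    next
      case False
      have "f b \<in> span C" using C(3) b D(2) by blast
      then have "representation D (f b) = representation C (f b)"
        by (rule representation_extend[OF D(3) _ D(1)])
      then show ?thesis
        using False representation_ne_zero[of C "f b" b] by auto
    qed
  qed
  also have "\<dots> = of_nat (card C)"
    using fin D(1) by (simp add: sum.If_cases Int_absorb1)
  also have "card C = dim (f ` span B)"
    by (rule basis_card_eq_dim[OF C(1,3,2)])
  finally show ?thesis .
qed

text \<open>Characteristic 0 matters here: a rank that vanishes as a complex number is zero.\<close>

lemma tr_idempotent_0:
  assumes B: "finite B" "independent B" and f: "endo (span B) f" and idem: "\<And>x. x \<in> span B \<Longrightarrow> f (f x) = f x"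
    and tr: "tr B f = 0" and x: "x \<in> span B"
  shows "f x = 0"
proof -
  obtain C where C: "C \<subseteq> f ` span B" "independent C" "f ` span B \<subseteq> span C" "card C = dim (f ` span B)"
    by (rule basis_exists)
  have "C \<subseteq> span B" using C(1) f by (auto simp: endo_def)
  then have "finite C" using independent_span_bound[OF B(1) C(2)] by simp
  then have "C = {}"
    using C(4) tr tr_idempotent[OF B f idem] by simp
  then show ?thesis using C(3) x by auto
qed

lemma tr_id: "independent B \<Longrightarrow> tr B (\<lambda>x. x) = of_nat (card B)"
  by (simp add: tr_def representation_basis)

lemma tr_add:
  assumes "independent B" "endo (span B) f" "endo (span B) g"
  shows "tr B (\<lambda>x. f x + g x) = tr B f + tr B g"
proof -
  have "f b \<in> span B" "g b \<in> span B" if "b \<in> B" for b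
    using assms that span_base[OF that] by (auto simp: endo_def)
  then show ?thesis
    by (simp add: tr_def representation_add[OF assms(1)] sum.distrib)
qed

lemma tr_sum:
  assumes "independent B" "\<And>i b. i \<in> I \<Longrightarrow> b \<in> B \<Longrightarrow> f i b \<in> span B"
  shows "tr B (\<lambda>x. \<Sum>i\<in>I. f i x) = (\<Sum>i\<in>I. tr B (f i))"
  unfolding tr_def
  by (subst sum.swap) (simp add: representation_sum[OF assms(1)] assms(2))

lemma tr_scale:
  assumes "independent B" "\<And>b. b \<in> B \<Longrightarrow> f b \<in> span B"
  shows "tr B (\<lambda>x. scale a (f x)) = a * tr B f"
  by (simp add: tr_def representation_scale assms sum_distrib_left)

lemma tr_rank_one:
  assumes B: "finite B" "independent B" and w: "w \<in> span B"
    and \<phi>: "\<And>x y. \<phi> (x + y) = \<phi> x + \<phi> y" "\<And>a x. \<phi> (scale a x) = a * \<phi> x"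
  shows "tr B (\<lambda>x. scale (\<phi> x) w) = \<phi> w"
proof -
  have sum: "\<phi> (\<Sum>b\<in>I. scale (a b) b) = (\<Sum>b\<in>I. a b * \<phi> b)" for a I
  proof (induct I rule: infinite_finite_induct)
    case (infinite I)
    then show ?case using \<phi>(2)[of 0 0] by simp
  next
    case empty
    then show ?case using \<phi>(2)[of 0 0] by simp
  qed (simp add: \<phi>)
  have "tr B (\<lambda>x. scale (\<phi> x) w) = (\<Sum>b\<in>B. representation B w b * \<phi> b)"
    by (simp add: tr_def representation_scale[OF B(2) w] mult.commute)
  also have "\<dots> = \<phi> w"
    using sum[of "representation B w" B] sum_representation_eq[OF B(2) w B(1)] by simp
  finally show ?thesis .
qed

end

section \<open>Traces on an irreducible representation and its dimension\<close>

context cherednik_irrep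
begin

definition basis :: "'v set" where
  "basis = (SOME B. finite B \<and> independent B \<and> span B = UNIV)"

lemma basis: "finite basis" "independent basis" "span basis = UNIV"
proof -
  obtain F where F: "finite F" "span F = UNIV"
    using finite_dimensional by blast
  obtain B where "B \<subseteq> UNIV" "independent B" "UNIV \<subseteq> span B"
    by (rule maximal_independent_subset)
  moreover then have "finite B"
    using independent_span_bound[OF F(1), of B] F(2) by simp
  ultimately have "\<exists>B. finite B \<and> independent B \<and> span B = UNIV" by blast
  from someI_ex[OF this] show "finite basis" "independent basis" "span basis = UNIV"
    by (simp_all add: basis_def)
qed

lemma endo_lin: "lin z \<Longrightarrow> endo UNIV (app z)"
  by (simp add: endo_def app_add lin_scale)

definition trace :: "'v aend \<Rightarrow> complex" where
  "trace z = tr basis (app z)"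

lemma trace_comm: assumes "lin z" "lin w" shows "trace (z * w) = trace (w * z)"
  using tr_comm[OF basis(1,2), of "app z" "app w"] assms
  by (simp add: trace_def times_aend.rep_eq basis endo_lin)

lemma trace_add: "lin z \<Longrightarrow> lin w \<Longrightarrow> trace (z + w) = trace z + trace w"
  using tr_add[OF basis(2), of "app z" "app w"] by (simp add: trace_def plus_aend.rep_eq basis endo_lin)

lemma trace_sum: "trace (sum f I) = (\<Sum>i\<in>I. trace (f i))"
  unfolding trace_def using tr_sum[OF basis(2), of I "\<lambda>i. app (f i)"]
  by (simp add: basis flip: app_sum_left)

lemma trace_sc: "trace (sc a * z) = a * trace z"
  unfolding trace_def using tr_scale[OF basis(2), of "app z" a] by (simp add: basis times_aend.rep_eq app_sc)

lemma trace_1: "trace 1 = of_nat (card basis)"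
  using tr_id[OF basis(2)] by (simp add: trace_def one_aend.rep_eq)

text \<open>For $\sigma(j) = i \ne j$ write $\sigma = s_{ij} \tau$ with $\tau(j) = j$. Then $\tau$ commutes with
  $x_j$, so $c\,\sigma = [y_i, x_j]\,\tau = [y_i \tau, x_j]$ is a commutator.\<close>

lemma trace_S:
  assumes \<sigma>: "\<sigma> permutes {1..n}" "\<sigma> \<noteq> id"
  shows "trace (S \<sigma>) = 0"
proof -
  obtain j where "\<sigma> j \<noteq> j" using \<sigma>(2) by (auto simp: fun_eq_iff)
  then have j: "j \<in> {1..n}" using permutes_not_in[OF \<sigma>(1)] by blast
  define i where "i = \<sigma> j"
  have i: "i \<in> {1..n}" "i \<noteq> j"
    using perm_in[OF \<sigma>(1) j] \<open>\<sigma> j \<noteq> j\<close> by (auto simp: i_def)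
  define t where "t = Transposition.transpose i j"
  have t: "t permutes {1..n}" unfolding t_def by (rule swap_permutes[OF i(1) j])
  define \<tau> where "\<tau> = t \<circ> \<sigma>"
  have \<tau>: "\<tau> permutes {1..n}" "\<tau> j = j" "t \<circ> \<tau> = \<sigma>"
    using permutes_compose[OF \<sigma>(1) t] by (auto simp: \<tau>_def t_def i_def fun_eq_iff)
  have linX: "lin (X j)" and linY: "lin (Y i)" and linS: "lin (S \<tau>)"
    using normal_span_X_in[OF j] normal_span_Y_in[OF i(1)] normal_span_S_in[OF \<tau>(1)] lin_normal_span by blast+
  have mem: "Y i * S \<tau> \<in> normal_span" "X j * (Y i * S \<tau>) \<in> normal_span" "sc c * S \<sigma> \<in> normal_span"
    using j i \<tau> \<sigma> by (intro normal_span_mult normal_span_sc normal_span_X_in normal_span_Y_in normal_span_S_in; simp)+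
  have "Y i * S \<tau> * X j = Y i * X j * S \<tau>"
    using S_X[OF \<tau>(1) j] by (simp add: \<tau>(2) mult.assoc)
  also have "\<dots> = X j * (Y i * S \<tau>) + sc c * (S t * S \<tau>)"
    unfolding YX_diff[OF i(1) j i(2)] by (simp add: t_def distrib_right mult.assoc)
  also have "S t * S \<tau> = S \<sigma>"
    using S_comp[OF t \<tau>(1)] \<tau>(3) by simp
  finally have "trace (Y i * S \<tau> * X j) = trace (X j * (Y i * S \<tau>)) + c * trace (S \<sigma>)"
    using mem lin_normal_span by (simp add: trace_add trace_sc)
  moreover have "trace (Y i * S \<tau> * X j) = trace (X j * (Y i * S \<tau>))"
    using trace_comm lin_normal_span[OF mem(1)] linX by blast
  ultimately show ?thesis using c by simp
qed

lemma trace_symmetrizer: "trace symmetrizer = of_nat (card basis) / fact n"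
proof -
  have "(\<Sum>\<sigma> | \<sigma> permutes {1..n}. trace (S \<sigma>)) = (\<Sum>\<sigma> | \<sigma> permutes {1..n}. if \<sigma> = id then of_nat (card basis) else 0)"
    using trace_S by (intro sum.cong) (auto simp: S_id trace_1)
  also have "\<dots> = of_nat (card basis)"
    using finite_perms by (simp add: permutes_id)
  finally show ?thesis
    by (simp add: symmetrizer_def trace_sc trace_sum)
qed

lemma S_symmetrizer: assumes \<tau>: "\<tau> permutes {1..n}" shows "S \<tau> * symmetrizer = symmetrizer"
proof -
  have "S \<tau> * (\<Sum>\<sigma> | \<sigma> permutes {1..n}. S \<sigma>) = (\<Sum>\<sigma> | \<sigma> permutes {1..n}. S (\<tau> \<circ> \<sigma>))"
    unfolding sum_distrib_left by (intro sum.cong) (auto simp: S_comp[OF \<tau>])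
  also have "\<dots> = (\<Sum>\<sigma> | \<sigma> permutes {1..n}. S \<sigma>)"
    by (rule sum.reindex_bij_witness[of _ "\<lambda>\<sigma>. inv_into UNIV \<tau> \<circ> \<sigma>" "\<lambda>\<sigma>. \<tau> \<circ> \<sigma>"])
      (use \<tau> in \<open>auto intro: permutes_compose permutes_inv simp: comp_assoc[symmetric] permutes_inv_o\<close>)
  finally have "S \<tau> * (\<Sum>\<sigma> | \<sigma> permutes {1..n}. S \<sigma>) = (\<Sum>\<sigma> | \<sigma> permutes {1..n}. S \<sigma>)" .
  moreover have "S \<tau> * symmetrizer = sc (1 / fact n) * (S \<tau> * (\<Sum>\<sigma> | \<sigma> permutes {1..n}. S \<sigma>))"
    by (simp add: symmetrizer_def sc_S[OF \<tau>] flip: mult.assoc)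
  ultimately show ?thesis
    by (simp add: symmetrizer_def)
qed

lemma symmetrizer_idem: "symmetrizer * symmetrizer = symmetrizer"
proof -
  have "(\<Sum>\<sigma> | \<sigma> permutes {1..n}. S \<sigma>) * symmetrizer = (\<Sum>\<sigma> | \<sigma> permutes {1..n}. symmetrizer)"
    unfolding sum_distrib_right by (intro sum.cong) (auto simp: S_symmetrizer)
  also have "\<dots> = sc (fact n) * symmetrizer"
    by (rule aend_eqI) (simp add: app_sum_left app_sc card_permutations[of "{1..n}"] sum_constant_scale)
  finally have "symmetrizer * symmetrizer = sc (1 / fact n) * (sc (fact n) * symmetrizer)"
    by (simp add: symmetrizer_def mult.assoc)
  then show ?thesis by (simp add: sc_1 flip: mult.assoc sc_mult)
qed

text \<open>The image of e is nonzero because its trace is. If x = e x is nonzero and u = e u, an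
  element a with a x = u also satisfies (e a e) x = u, so the image is simple over the operators e a
  e. These commute, so Dixmier's argument applies to them on the image and makes each a scalar; a
  simple module over scalars is a line.\<close>

lemma dim_symmetrizer: "dim (range (app symmetrizer)) = 1"
proof -
  let ?W = "range (app symmetrizer)"
  have lin: "lin symmetrizer" by (rule lin_normal_span[OF normal_span_symmetrizer])
  have idem: "app symmetrizer (app symmetrizer x) = app symmetrizer x" for x
    using symmetrizer_idem by (metis app_times)
  have tr: "trace symmetrizer = of_nat (dim ?W)"
    using tr_idempotent[OF basis(1,2), of "app symmetrizer"] lin idem by (simp add: basis trace_def endo_lin)
  obtain v :: 'v where v: "v \<noteq> 0" using nonzero by blast
  have "basis \<noteq> {}" using v basis(3) by auto
  then have "trace symmetrizer \<noteq> 0" using basis(1) by (simp add: trace_symmetrizer)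
  moreover have "dim {0} = 0"
    using dim_span[of "{}"] dim_eq_card_independent[OF independent_empty] by simp
  ultimately have "?W \<noteq> {0}" using tr by auto
  have W: "subspace ?W"
    by (rule subspaceI) (auto simp: image_iff intro: exI[of _ 0] simp flip: app_add lin_scale[OF lin])
  obtain w where w: "w \<in> ?W" "w \<noteq> 0"
    using \<open>?W \<noteq> {0}\<close> subspace_0[OF W] by blast
  obtain E where E: "countable E" "span E = UNIV" by (rule countable_span)
  have simple: "\<exists>a\<in>normal_span. u = app (symmetrizer * a * symmetrizer) x" if x: "x \<in> ?W" "x \<noteq> 0" and u: "u \<in> ?W" for x u
  proof -
    obtain a where a: "a \<in> normal_span" "u = app a x"
      using cyclic[OF x(2)] by blast
    have "app (symmetrizer * a * symmetrizer) x = u"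
      using x(1) u a(2) idem by auto
    with a(1) show ?thesis by metis
  qed
  have scalar: "\<exists>l. \<forall>x\<in>?W. app (symmetrizer * a * symmetrizer) x = scale l x" if a: "a \<in> normal_span" for a
  proof (rule dixmier[OF E W \<open>?W \<noteq> {0}\<close>, where C = "(\<lambda>b. symmetrizer * b * symmetrizer) ` normal_span"])
    have mem: "symmetrizer * b * symmetrizer \<in> normal_span" if "b \<in> normal_span" for b
      using that by (intro normal_span_mult normal_span_symmetrizer)
    then show "lin (symmetrizer * a * symmetrizer)" "\<And>z. z \<in> (\<lambda>b. symmetrizer * b * symmetrizer) ` normal_span \<Longrightarrow> lin z"
      using a lin_normal_span by auto
    show "app (symmetrizer * a * symmetrizer) x \<in> ?W" "\<And>z. z \<in> (\<lambda>b. symmetrizer * b * symmetrizer) ` normal_span \<Longrightarrow> app z x \<in> ?W" for x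
      by auto
    fix z x assume "z \<in> (\<lambda>b. symmetrizer * b * symmetrizer) ` normal_span"
    then obtain b where b: "b \<in> normal_span" "z = symmetrizer * b * symmetrizer" by blast
    have "z * (symmetrizer * a * symmetrizer) = (symmetrizer * a * symmetrizer) * z"
      using symmetrizer_commute[OF b(1) a] symmetrizer_idem by (simp add: b(2) mult.assoc) (metis mult.assoc)
    then show "app z (app (symmetrizer * a * symmetrizer) x) = app (symmetrizer * a * symmetrizer) (app z x)"
      by (metis app_times)
  qed (use simple in blast)
  have "?W \<subseteq> span {w}"
  proof
    fix u assume "u \<in> ?W"
    then obtain a where "a \<in> normal_span" "u = app (symmetrizer * a * symmetrizer) w"
      using simple w by blast
    then obtain l where "u = scale l w"
      using scalar w by blast
    then show "u \<in> span {w}" by (simp add: span_scale span_base)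
  qed
  moreover have "{w} \<subseteq> ?W" "independent {w}" using w by auto
  ultimately show ?thesis
    using basis_card_eq_dim[of "{w}" ?W] by simp
qed

lemma card_basis: "card basis = fact n"
proof -
  have "trace symmetrizer = of_nat (dim (range (app symmetrizer)))"
    using tr_idempotent[OF basis(1,2), of "app symmetrizer"] lin_normal_span[OF normal_span_symmetrizer] symmetrizer_idem
    by (simp add: basis trace_def endo_lin) (metis app_times)
  then have "complex_of_nat (card basis) = of_nat (fact n)"
    by (simp add: trace_symmetrizer dim_symmetrizer)
  then show ?thesis by (simp only: of_nat_eq_iff)
qed

theorem dim_UNIV: "dim UNIV = fact n"
  using dim_eq_card[of basis UNIV] basis card_basis by simp

end

section \<open>A trace criterion for the regular representation\<close>

lemma complex_space_functions: "complex_space (\<lambda>a (f :: 'g \<Rightarrow> complex) m. a * f m)"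
  by standard (auto simp: fun_eq_iff algebra_simps)

context group
begin

lemma sum_right_translate:
  assumes "g \<in> carrier G" shows "(\<Sum>k\<in>carrier G. F k) = (\<Sum>h\<in>carrier G. F (h \<otimes> g))"
  by (rule sum.reindex_bij_witness[of _ "\<lambda>h. h \<otimes> g" "\<lambda>k. k \<otimes> inv g"]) (use assms in \<open>auto simp: m_assoc\<close>)

lemma sum_left_translate:
  assumes "g \<in> carrier G" shows "(\<Sum>k\<in>carrier G. F k) = (\<Sum>h\<in>carrier G. F (g \<otimes> h))"
  by (rule sum.reindex_bij_witness[of _ "\<lambda>h. g \<otimes> h" "\<lambda>k. inv g \<otimes> k"]) (use assms in \<open>auto simp: m_assoc[symmetric]\<close>)

lemma monoid_algebra_carrier_iff:
  "finite (carrier G) \<Longrightarrow> f \<in> carrier (monoid_algebra G) \<longleftrightarrow> (\<forall>g. g \<notin> carrier G \<longrightarrow> f g = 0)"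
  by (auto simp: monoid_algebra_def intro: finite_subset[of _ "carrier G"])

lemma monoid_algebra_mult_eval:
  assumes fin: "finite (carrier G)" and a: "a \<in> carrier (monoid_algebra G)" and b: "b \<in> carrier (monoid_algebra G)"
    and h: "h \<in> carrier G"
  shows "(a \<otimes>\<^bsub>monoid_algebra G\<^esub> b) h = (\<Sum>p\<in>carrier G. a p * b (inv p \<otimes> h))"
proof -
  have "(a \<otimes>\<^bsub>monoid_algebra G\<^esub> b) h = (\<Sum>p\<in>carrier G. \<Sum>q\<in>carrier G. if p \<otimes> q = h then a p * b q else 0)"
    using a b by (intro monoid_algebra_mult_superset fin) (auto simp: monoid_algebra_def)
  also have "\<dots> = (\<Sum>p\<in>carrier G. \<Sum>q\<in>carrier G. if q = inv p \<otimes> h then a p * b q else 0)"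
  proof (intro sum.cong refl if_cong)
    fix p q assume "p \<in> carrier G" "q \<in> carrier G"
    then show "p \<otimes> q = h \<longleftrightarrow> q = inv p \<otimes> h"
      using h by (metis inv_closed inv_solve_left)
  qed
  also have "\<dots> = (\<Sum>p\<in>carrier G. a p * b (inv p \<otimes> h))"
    using fin h by (intro sum.cong refl) (simp add: sum.delta)
  finally show ?thesis .
qed

lemma monoid_algebra_mult_scale:
  assumes fin: "finite (carrier G)" and a: "a \<in> carrier (monoid_algebra G)" and b: "b \<in> carrier (monoid_algebra G)"
  shows "a \<otimes>\<^bsub>monoid_algebra G\<^esub> (\<lambda>m. l * b m) = (\<lambda>m. l * (a \<otimes>\<^bsub>monoid_algebra G\<^esub> b) m)"
    and "(\<lambda>m. l * a m) \<otimes>\<^bsub>monoid_algebra G\<^esub> b = (\<lambda>m. l * (a \<otimes>\<^bsub>monoid_algebra G\<^esub> b) m)"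
proof -
  have *: "a \<in> carrier (monoid_algebra G)" "b \<in> carrier (monoid_algebra G)"
    "(\<lambda>m. l * a m) \<in> carrier (monoid_algebra G)" "(\<lambda>m. l * b m) \<in> carrier (monoid_algebra G)"
    using a b by (simp_all add: monoid_algebra_carrier_iff[OF fin])
  have closed: "x \<otimes>\<^bsub>monoid_algebra G\<^esub> y \<in> carrier (monoid_algebra G)"
    if "x \<in> carrier (monoid_algebra G)" "y \<in> carrier (monoid_algebra G)" for x y
    using monoid_algebra_mult_closed[OF monoid_axioms that] .
  have outside: "(x \<otimes>\<^bsub>monoid_algebra G\<^esub> y) h = 0"
    if "x \<in> carrier (monoid_algebra G)" "y \<in> carrier (monoid_algebra G)" "h \<notin> carrier G" for x y h
    using closed[OF that(1,2)] that(3) by (simp add: monoid_algebra_carrier_iff[OF fin])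
  show "a \<otimes>\<^bsub>monoid_algebra G\<^esub> (\<lambda>m. l * b m) = (\<lambda>m. l * (a \<otimes>\<^bsub>monoid_algebra G\<^esub> b) m)"
  proof
    fix h show "(a \<otimes>\<^bsub>monoid_algebra G\<^esub> (\<lambda>m. l * b m)) h = l * (a \<otimes>\<^bsub>monoid_algebra G\<^esub> b) h"
      by (cases "h \<in> carrier G")
        (simp_all add: * outside monoid_algebra_mult_eval[OF fin] sum_distrib_left mult.left_commute)
  qed
  show "(\<lambda>m. l * a m) \<otimes>\<^bsub>monoid_algebra G\<^esub> b = (\<lambda>m. l * (a \<otimes>\<^bsub>monoid_algebra G\<^esub> b) m)"
  proof
    fix h show "((\<lambda>m. l * a m) \<otimes>\<^bsub>monoid_algebra G\<^esub> b) h = l * (a \<otimes>\<^bsub>monoid_algebra G\<^esub> b) h"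
      by (cases "h \<in> carrier G")
        (simp_all add: * outside monoid_algebra_mult_eval[OF fin] sum_distrib_left mult.assoc)
  qed
qed

end

section \<open>Vectors with a linearly independent orbit\<close>

locale traceless_group_action = complex_space scale + group G
  for scale :: "complex \<Rightarrow> 'v::ab_group_add \<Rightarrow> 'v" and G :: "('g, 'e) monoid_scheme" (structure) +
  fixes S :: "'g \<Rightarrow> 'v aend" and B :: "'v set"
  assumes fin: "finite (carrier G)"
    and S_one: "S \<one> = 1"
    and S_mult: "\<lbrakk>g \<in> carrier G; h \<in> carrier G\<rbrakk> \<Longrightarrow> S (g \<otimes> h) = S g * S h"
    and S_lin: "g \<in> carrier G \<Longrightarrow> lin (S g)"
    and B: "finite B" "independent B" "span B = UNIV" "card B = card (carrier G)"
    and tr_S: "\<lbrakk>g \<in> carrier G; g \<noteq> \<one>\<rbrakk> \<Longrightarrow> tr B (app (S g)) = 0"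
begin

definition comb :: "('g \<Rightarrow> complex) \<Rightarrow> 'g set \<Rightarrow> 'v \<Rightarrow> 'v" where
  "comb a D u = (\<Sum>g\<in>D. scale (a g) (app (S g) u))"

text \<open>Independence of a family indexed by the group, so that equal vectors
  \<open>g u = h u\<close> count as a dependence, which the image set would not detect.\<close>

definition free_on :: "'v \<Rightarrow> 'g set \<Rightarrow> bool" where
  "free_on u D \<longleftrightarrow> (\<forall>a. comb a D u = 0 \<longrightarrow> (\<forall>g\<in>D. a g = 0))"

lemma S_S: "g \<in> carrier G \<Longrightarrow> h \<in> carrier G \<Longrightarrow> app (S g) (app (S h) u) = app (S (g \<otimes> h)) u"
  by (simp add: S_mult)

lemma comb_add: "comb a D (u + w) = comb a D u + comb a D w"
  by (simp add: comb_def app_add scale_right_distrib sum.distrib)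

lemma comb_diff: "comb a D (u - w) = comb a D u - comb a D w"
  by (simp add: comb_def app_diff scale_right_diff_distrib sum_subtractf)

lemma S_comb: "D \<subseteq> carrier G \<Longrightarrow> g \<in> carrier G \<Longrightarrow> app (S g) (comb a D u) = (\<Sum>h\<in>D. scale (a h) (app (S (g \<otimes> h)) u))"
  unfolding comb_def app_sum_right
  by (intro sum.cong refl) (auto simp: lin_scale S_lin S_S)

lemma free_on_extend:
  assumes D: "D \<subseteq> carrier G" and free: "free_on u D" and h: "h \<in> carrier G"
    and not_free: "h \<notin> D \<Longrightarrow> \<not> free_on u (insert h D)"
  shows "\<exists>a. app (S h) u = comb a D u"
proof (cases "h \<in> D")
  case True
  have "comb (\<lambda>g. if g = h then 1 else 0) D u = app (S h) u"
    using True finite_subset[OF D fin] by (simp add: comb_def if_distrib[of "\<lambda>a. scale a _"] cong: if_cong)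
  then show ?thesis by metis
next
  case False
  obtain a where a: "comb a (insert h D) u = 0" "\<exists>g\<in>insert h D. a g \<noteq> 0"
    using not_free[OF False] by (auto simp: free_on_def)
  have sum: "scale (a h) (app (S h) u) + comb a D u = 0"
    using a(1) False finite_subset[OF D fin] by (simp add: comb_def)
  have "a h \<noteq> 0"
  proof
    assume "a h = 0"
    then have "comb a D u = 0" using sum by simp
    then show False using free a(2) \<open>a h = 0\<close> by (auto simp: free_on_def)
  qed
  have "comb (\<lambda>g. - (1 / a h) * a g) D u = scale (- (1 / a h)) (comb a D u)"
    by (simp add: comb_def scale_sum_right)
  also have "comb a D u = - scale (a h) (app (S h) u)"
    using sum by (simp add: eq_neg_iff_add_eq_0 add.commute)
  also have "scale (- (1 / a h)) (- scale (a h) (app (S h) u)) = app (S h) u"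
    using \<open>a h \<noteq> 0\<close> by simp
  finally show ?thesis by metis
qed

lemma comb_carrier_in_D:
  assumes "D \<subseteq> carrier G" and "\<And>h. h \<in> carrier G \<Longrightarrow> \<exists>a. app (S h) u = comb a D u"
  shows "\<exists>a. comb b (carrier G) u = comb a D u"
proof -
  obtain A where A: "\<And>h. h \<in> carrier G \<Longrightarrow> app (S h) u = comb (A h) D u"
    using assms(2) by metis
  have "comb b (carrier G) u = (\<Sum>h\<in>carrier G. \<Sum>g\<in>D. scale (b h * A h g) (app (S g) u))"
    unfolding comb_def[of b] by (intro sum.cong refl) (subst A, auto simp: comb_def scale_sum_right)
  also have "\<dots> = comb (\<lambda>g. \<Sum>h\<in>carrier G. b h * A h g) D u"
    by (subst sum.swap) (simp add: comb_def scale_sum_left)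
  finally show ?thesis by blast
qed

text \<open>Averaging a linear projection onto the span of the orbit of \<open>v\<close> gives an equivariant one;
  expanding it in the orbit, it is determined by a single linear functional.\<close>

lemma equivariant_projection:
  assumes D: "D \<subseteq> carrier G" and free: "free_on v D"
    and span: "\<And>h. h \<in> carrier G \<Longrightarrow> \<exists>a. app (S h) v = comb a D v"
  shows "\<exists>\<phi>. (\<forall>x y. \<phi> (x + y) = \<phi> x + \<phi> y) \<and> (\<forall>a x. \<phi> (scale a x) = a * \<phi> x) \<and>
    (\<forall>b. comb (\<lambda>k. \<phi> (app (S (inv k)) (comb b (carrier G) v))) (carrier G) v = comb b (carrier G) v)"
proof -
  have finD: "finite D" using D fin by (rule finite_subset)
  let ?e = "\<lambda>g. app (S g) v"
  have inj: "inj_on ?e D"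
  proof (rule inj_onI, rule ccontr)
    fix g h assume gh: "g \<in> D" "h \<in> D" "?e g = ?e h" "g \<noteq> h"
    let ?a = "\<lambda>k. if k = g then 1 else if k = h then - 1 else 0 :: complex"
    have "comb ?a D v = (\<Sum>k\<in>{g, h}. scale (?a k) (?e k))"
      unfolding comb_def using gh finD by (intro sum.mono_neutral_right) auto
    then have "comb ?a D v = 0" using gh by simp
    then have "?a g = 0" using free gh(1) unfolding free_on_def by blast
    then show False by simp
  qed
  have indep: "independent (?e ` D)"
  proof (rule independent_if_scalars_zero)
    fix f x assume *: "(\<Sum>x\<in>?e ` D. scale (f x) x) = 0" "x \<in> ?e ` D"
    have "comb (\<lambda>g. f (?e g)) D v = 0"
      using *(1) by (simp add: comb_def sum.reindex[OF inj])
    then show "f x = 0" using free *(2) by (auto simp: free_on_def)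
  qed (simp add: finD)
  define C where "C = extend_basis (?e ` D)"
  have C: "?e ` D \<subseteq> C" "independent C" "span C = UNIV"
    using extend_basis_superset[OF indep] independent_extend_basis[OF indep] span_extend_basis[OF indep]
    by (simp_all add: C_def)
  define \<psi> where "\<psi> = (\<lambda>g x. representation C x (?e g))"
  have \<psi>: "\<psi> g (x + y) = \<psi> g x + \<psi> g y" "\<psi> g (scale a x) = a * \<psi> g x" for g x y a
    using C by (simp_all add: \<psi>_def representation_add representation_scale)
  have proj: "comb (\<lambda>g. \<psi> g (comb a D v)) D v = comb a D v" for a
  proof -
    have "\<psi> g (comb a D v) = a g" if g: "g \<in> D" for g
    proof -
      have "\<psi> g (comb a D v) = (\<Sum>h\<in>D. a h * representation C (?e h) (?e g))"
        using C by (simp add: \<psi>_def comb_def representation_sum representation_scale)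
      also have "\<dots> = (\<Sum>h\<in>D. if h = g then a g else 0)"
        using C g by (intro sum.cong refl) (auto simp: representation_basis inj_on_eq_iff[OF inj])
      finally show ?thesis using g finD by simp
    qed
    then show ?thesis by (simp add: comb_def)
  qed
  define N where "N = complex_of_nat (card (carrier G))"
  have N: "N \<noteq> 0" using fin by (auto simp: N_def)
  \<comment> \<open>If p x is the sum of the \<psi>_g(x) g v, the average of h p h^(-1) contains the
    terms \<psi>_g(h^(-1) x) h g v. With k = h g, the coefficient of k v becomes \<phi>(k^(-1) x)
    for this functional.\<close>
  define \<phi> where "\<phi> = (\<lambda>x. 1 / N * (\<Sum>g\<in>D. \<psi> g (app (S g) x)))"
  have "\<phi> (x + y) = \<phi> x + \<phi> y" for x y
    by (simp add: \<phi>_def app_add \<psi> sum.distrib distrib_left add_divide_distrib)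
  moreover have "\<phi> (scale a x) = a * \<phi> x" for a x
  proof -
    have *: "(\<Sum>g\<in>D. \<psi> g (app (S g) (scale a x))) = (\<Sum>g\<in>D. a * \<psi> g (app (S g) x))"
      using D by (intro sum.cong refl) (auto simp: lin_scale S_lin \<psi>)
    show ?thesis unfolding \<phi>_def * by (simp flip: sum_distrib_left)
  qed
  moreover have "comb (\<lambda>k. \<phi> (app (S (inv k)) x)) (carrier G) v = x" if x: "x = comb b (carrier G) v" for x b
  proof -
    have trans: "\<exists>a. app (S h) x = comb a D v" if h: "h \<in> carrier G" for h
    proof -
      have "app (S h) x = (\<Sum>k\<in>carrier G. scale (b k) (app (S (h \<otimes> k)) v))"
        by (simp add: x S_comb h)
      also have "\<dots> = comb (\<lambda>k. b (inv h \<otimes> k)) (carrier G) v"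
        unfolding comb_def using h
        by (subst sum_left_translate[OF h, of "\<lambda>k. scale (b (inv h \<otimes> k)) (app (S k) v)"]) (simp add: m_assoc[symmetric])
      finally show ?thesis
        using comb_carrier_in_D[OF D span] by metis
    qed
    have "comb (\<lambda>k. \<phi> (app (S (inv k)) x)) (carrier G) v =
        (\<Sum>k\<in>carrier G. \<Sum>g\<in>D. scale (1 / N * \<psi> g (app (S g) (app (S (inv k)) x))) (app (S k) v))"
      unfolding comb_def \<phi>_def by (simp add: sum_distrib_left scale_sum_left)
    also have "\<dots> = (\<Sum>g\<in>D. \<Sum>k\<in>carrier G. scale (1 / N * \<psi> g (app (S g) (app (S (inv k)) x))) (app (S k) v))"
      by (rule sum.swap)
    also have "\<dots> = (\<Sum>g\<in>D. \<Sum>h\<in>carrier G. scale (1 / N) (app (S h) (scale (\<psi> g (app (S (inv h)) x)) (app (S g) v))))"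
    proof (rule sum.cong[OF refl])
      fix g assume "g \<in> D"
      then have g: "g \<in> carrier G" using D by blast
      have "app (S g) (app (S (inv (h \<otimes> g))) x) = app (S (inv h)) x" if "h \<in> carrier G" for h
        using that g by (simp add: S_S inv_mult_group m_assoc[symmetric])
      moreover have "app (S (h \<otimes> g)) v = app (S h) (app (S g) v)" if "h \<in> carrier G" for h
        using that g by (simp add: S_S)
      ultimately show "(\<Sum>k\<in>carrier G. scale (1 / N * \<psi> g (app (S g) (app (S (inv k)) x))) (app (S k) v)) =
        (\<Sum>h\<in>carrier G. scale (1 / N) (app (S h) (scale (\<psi> g (app (S (inv h)) x)) (app (S g) v))))"
        by (subst sum_right_translate[OF g]) (simp add: lin_scale S_lin cong: sum.cong)
    qed
    also have "\<dots> = (\<Sum>h\<in>carrier G. scale (1 / N) (app (S h) (comb (\<lambda>g. \<psi> g (app (S (inv h)) x)) D v)))"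
      by (subst sum.swap) (simp add: comb_def app_sum_right scale_sum_right)
    also have "\<dots> = (\<Sum>h\<in>carrier G. scale (1 / N) x)"
    proof (rule sum.cong[OF refl])
      fix h assume h: "h \<in> carrier G"
      obtain a where "app (S (inv h)) x = comb a D v"
        using trans[of "inv h"] h by auto
      then have "comb (\<lambda>g. \<psi> g (app (S (inv h)) x)) D v = app (S (inv h)) x"
        using proj by simp
      then show "scale (1 / N) (app (S h) (comb (\<lambda>g. \<psi> g (app (S (inv h)) x)) D v)) = scale (1 / N) x"
        using h by (simp add: S_S S_one)
    qed
    also have "\<dots> = x"
      using N by (simp add: sum_constant_scale N_def)
    finally show ?thesis .
  qed
  ultimately show ?thesis by blast
qed

text \<open>Take a vector \<open>v\<close> and a set \<open>D\<close>, as large as possible, such that the vectors \<open>g v\<close> with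
  \<open>g \<in> D\<close> are independent, and let \<open>P\<close> be an equivariant projection onto the span of the orbit. It
  provides an idempotent \<open>f\<close> of the group algebra that generates the annihilator of \<open>v\<close>. By
  maximality \<open>f\<close> kills the kernel of \<open>P\<close>, so \<open>f\<close> and \<open>f P\<close> have the same trace. The
  hypothesis on the traces turns this into the vanishing of the trace of the idempotent operator
  \<open>b \<mapsto> f b f\<close> on the group algebra; this operator is therefore zero, and it maps \<open>f\<close> to \<open>f\<close>.\<close>

theorem exists_free_vector: "\<exists>v. free_on v (carrier G)"
proof -
  interpret A: complex_space "\<lambda>a (f :: 'g \<Rightarrow> complex) m. a * f m"
    by (rule complex_space_functions)
  interpret R: ring "monoid_algebra G"
    by (rule monoid_algebra_ring) (rule monoid_axioms)
  let ?P = "\<lambda>k. \<exists>v D. D \<subseteq> carrier G \<and> free_on v D \<and> card D = k"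
  have "?P 0"
    by (intro exI[of _ 0] exI[of _ "{}"]) (auto simp: free_on_def)
  moreover have bound: "k \<le> card (carrier G)" if "?P k" for k
    using that card_mono[OF fin] by blast
  ultimately obtain m where m: "?P m" "\<And>k. ?P k \<Longrightarrow> k \<le> m"
    using GreatestI_nat[of ?P 0 "card (carrier G)"] Greatest_le_nat[of ?P _ "card (carrier G)"] by blast
  then obtain v D where D: "D \<subseteq> carrier G" "free_on v D" "card D = m"
    by blast
  have finD: "finite D" using D(1) fin by (rule finite_subset)
  \<comment> \<open>The size of \<open>D\<close> is maximal over all vectors at once, so the
    conclusion holds for every \<open>u\<close> that is free on \<open>D\<close>; it is applied to
    \<open>v\<close> and to \<open>v + w\<close>.\<close>
  have span: "\<exists>a. app (S h) u = comb a D u" if u: "free_on u D" and h: "h \<in> carrier G" for u h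
  proof (rule free_on_extend[OF D(1) u h])
    assume "h \<notin> D"
    show "\<not> free_on u (insert h D)"
    proof
      assume "free_on u (insert h D)"
      then have "?P (Suc m)"
        using D h \<open>h \<notin> D\<close> finD by (intro exI[of _ u] exI[of _ "insert h D"]) auto
      with m(2) show False by fastforce
    qed
  qed
  obtain \<phi> where \<phi>: "\<And>x y. \<phi> (x + y) = \<phi> x + \<phi> y" "\<And>a x. \<phi> (scale a x) = a * \<phi> x"
    and proj: "\<And>b. comb (\<lambda>k. \<phi> (app (S (inv k)) (comb b (carrier G) v))) (carrier G) v = comb b (carrier G) v"
    using equivariant_projection[OF D(1,2) span[OF D(2)]] by blast
  have \<phi>_0: "\<phi> 0 = 0" using \<phi>(2)[of 0 0] by simp
  have \<phi>_sum: "\<phi> (\<Sum>i\<in>I. x i) = (\<Sum>i\<in>I. \<phi> (x i))" for x and I :: "'g set"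
    by (induct I rule: infinite_finite_induct) (auto simp: \<phi>_0 \<phi>)
  define P where "P = (\<lambda>x. comb (\<lambda>k. \<phi> (app (S (inv k)) x)) (carrier G) v)"
  have P_add: "P (x + y) = P x + P y" for x y
    by (simp add: P_def comb_def app_add \<phi> scale_left_distrib sum.distrib)
  have P_scale: "P (scale a x) = scale a (P x)" for a x
    unfolding P_def comb_def scale_sum_right by (intro sum.cong refl) (simp add: lin_scale S_lin \<phi>)
  have P_0: "P 0 = 0" using P_scale[of 0 0] by simp
  have P_diff: "P (x - y) = P x - P y" for x y
    using P_add[of "x - y" y] by (simp add: algebra_simps)
  have P_S: "P (app (S g) x) = app (S g) (P x)" if g: "g \<in> carrier G" for g x
  proof -
    have "P (app (S g) x) = (\<Sum>k\<in>carrier G. scale (\<phi> (app (S (inv k \<otimes> g)) x)) (app (S k) v))"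
      unfolding P_def comb_def using g by (intro sum.cong refl) (simp add: S_S)
    also have "\<dots> = (\<Sum>k\<in>carrier G. scale (\<phi> (app (S (inv k)) x)) (app (S (g \<otimes> k)) v))"
      using g by (subst sum_left_translate[OF g]) (simp add: inv_mult_group m_assoc cong: sum.cong)
    also have "\<dots> = app (S g) (P x)"
      unfolding P_def using g by (simp add: S_comb)
    finally show ?thesis .
  qed
  have P_comb: "P (comb a E x) = comb a E (P x)" if "E \<subseteq> carrier G" for a E x
  proof -
    have "finite E" using that fin by (rule finite_subset)
    then show ?thesis using that
      by (induct E) (auto simp: comb_def P_0 P_add P_scale P_S)
  qed
  have P_P: "P (P x) = P x" for x
    unfolding P_def by (rule proj)
  have P_orbit: "P (comb b (carrier G) v) = comb b (carrier G) v" for b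
    unfolding P_def by (rule proj)
  have v_comb: "v = comb (\<lambda>g. if g = \<one> then 1 else 0) (carrier G) v"
    using fin by (simp add: comb_def if_distrib[of "\<lambda>a. scale a _"] S_one cong: if_cong)
  have P_v: "P v = v"
    using P_orbit v_comb by metis
  \<comment> \<open>Since P v = v, the group algebra element with coefficients \<phi>(g^(-1) v)
    fixes \<open>v\<close>. Subtracting it from 1 gives an element that annihilates
    \<open>v\<close>.\<close>
  define f where "f = (\<lambda>g. if g \<in> carrier G then (if g = \<one> then 1 else 0) - \<phi> (app (S (inv g)) v) else 0)"
  have f_in: "f \<in> carrier (monoid_algebra G)"
    by (simp add: monoid_algebra_carrier_iff[OF fin] f_def)
  have f_v: "comb f (carrier G) v = 0"
  proof -
    have "comb f (carrier G) v = comb (\<lambda>g. if g = \<one> then 1 else 0) (carrier G) v - P v"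
      by (simp add: comb_def f_def P_def scale_left_diff_distrib sum_subtractf)
    then show ?thesis using v_comb P_v by simp
  qed
  \<comment> \<open>The product of \<open>b\<close> with the subtracted part of \<open>f\<close> has
    at \<open>h\<close> the coefficient \<phi>(h^(-1) b v), which is 0 when b v = 0.\<close>
  have absorb: "b \<otimes>\<^bsub>monoid_algebra G\<^esub> f = b"
    if b: "b \<in> carrier (monoid_algebra G)" "comb b (carrier G) v = 0" for b
  proof
    fix h
    show "(b \<otimes>\<^bsub>monoid_algebra G\<^esub> f) h = b h"
    proof (cases "h \<in> carrier G")
      case False
      then show ?thesis
        using R.m_closed[OF b(1) f_in] b(1) monoid_algebra_carrier_iff[OF fin] by metis
    next
      case True
      have "(b \<otimes>\<^bsub>monoid_algebra G\<^esub> f) h = (\<Sum>p\<in>carrier G. b p * f (inv p \<otimes> h))"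
        by (rule monoid_algebra_mult_eval[OF fin b(1) f_in True])
      also have "\<dots> = (\<Sum>p\<in>carrier G. (if p = h then b h else 0) - \<phi> (scale (b p) (app (S (inv h \<otimes> p)) v)))"
      proof (rule sum.cong[OF refl])
        fix p assume p: "p \<in> carrier G"
        have "inv p \<otimes> h = \<one> \<longleftrightarrow> p = h"
          using p True by (metis inv_closed inv_equality inv_inv l_inv)
        moreover have "inv (inv p \<otimes> h) = inv h \<otimes> p"
          using p True by (simp add: inv_mult_group)
        ultimately show "b p * f (inv p \<otimes> h) = (if p = h then b h else 0) - \<phi> (scale (b p) (app (S (inv h \<otimes> p)) v))"
          using p True by (simp add: f_def \<phi> right_diff_distrib)
      qed
      also have "\<dots> = b h - \<phi> (app (S (inv h)) (comb b (carrier G) v))"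
        using fin True by (simp add: sum_subtractf S_comb \<phi>_sum)
      finally show ?thesis by (simp add: b(2) \<phi>_0)
    qed
  qed
  have f_f: "f \<otimes>\<^bsub>monoid_algebra G\<^esub> f = f"
    by (rule absorb[OF f_in f_v])
  \<comment> \<open>\<open>P\<close> sends \<open>v + w\<close> to \<open>v\<close>, so
    \<open>v + w\<close> is free on \<open>D\<close> as well, and by maximality f (v + w) is a
    combination of its \<open>D\<close>-translates. Applying \<open>P\<close> gives the same
    combination for \<open>v\<close>, equal to f v = 0; all its coefficients vanish and so f w =
    0.\<close>
  have kill: "comb f (carrier G) w = 0" if w: "P w = 0" for w
  proof -
    have P_vw: "P (v + w) = v" using w P_v by (simp add: P_add)
    have "free_on (v + w) D"
      unfolding free_on_def
    proof (intro allI impI)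
      fix a assume "comb a D (v + w) = 0"
      then have "comb a D v = 0" using P_comb[OF D(1), of a "v + w"] by (simp add: P_vw P_0)
      then show "\<forall>g\<in>D. a g = 0" using D(2) by (simp add: free_on_def)
    qed
    then obtain a where a: "comb f (carrier G) (v + w) = comb a D (v + w)"
      using comb_carrier_in_D[OF D(1) span] by metis
    have "comb a D v = P (comb f (carrier G) (v + w))"
      unfolding a by (simp add: P_comb D(1) P_vw)
    also have "\<dots> = comb f (carrier G) v"
      by (simp add: P_comb P_vw)
    finally have "comb a D v = 0" using f_v by simp
    then have "\<forall>g\<in>D. a g = 0" using D(2) by (simp add: free_on_def)
    then have "comb a D (v + w) = 0" by (simp add: comb_def)
    then show ?thesis using a f_v by (simp add: comb_add)
  qed
  define N where "N = complex_of_nat (card (carrier G))"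
  \<comment> \<open>The trace of b -> f b f on the group algebra, computed in the basis of group
    elements.\<close>
  define Q where "Q = (\<Sum>k\<in>carrier G. \<Sum>g\<in>carrier G. f g * f (inv k \<otimes> inv g \<otimes> k))"
  have spanB: "x \<in> span B" for x using B(3) by simp
  have tr1: "tr B (comb f (carrier G)) = N * f \<one>"
  proof -
    have "tr B (comb f (carrier G)) = (\<Sum>g\<in>carrier G. f g * tr B (app (S g)))"
      unfolding comb_def[abs_def] by (simp add: tr_sum tr_scale B(2) spanB)
    also have "\<dots> = (\<Sum>g\<in>carrier G. if g = \<one> then f \<one> * N else 0)"
    proof (intro sum.cong refl)
      have "app (S \<one>) = (\<lambda>x. x)" by (rule ext) (simp add: S_one)
      then show "f g * tr B (app (S g)) = (if g = \<one> then f \<one> * N else 0)" if "g \<in> carrier G" for g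
        using tr_S[OF that] tr_id[OF B(2)] B(4) by (simp add: N_def)
    qed
    finally show ?thesis using fin by simp
  qed
  \<comment> \<open>\<open>P\<close> is the sum over k of the rank one operators x -> \<phi>(k^(-1)
    x) k v, so the trace of f P is the sum of the \<phi>(k^(-1) f k v). The definition of
    \<open>f\<close> turns the values of \<phi> back into coefficients of \<open>f\<close>.\<close>
  have tr2: "tr B (\<lambda>x. comb f (carrier G) (P x)) = N * f \<one> - Q"
  proof -
    have comb_P: "comb f (carrier G) (P x) =
        (\<Sum>k\<in>carrier G. scale (\<phi> (app (S (inv k)) x)) (comb f (carrier G) (app (S k) v)))" for x
    proof -
      have lin: "comb f (carrier G) (scale a x) = scale a (comb f (carrier G) x)" for a x
        unfolding comb_def scale_sum_right by (intro sum.cong refl) (simp add: lin_scale S_lin mult.commute)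
      have "comb f (carrier G) (\<Sum>k\<in>I. x k) = (\<Sum>k\<in>I. comb f (carrier G) (x k))" for x and I :: "'g set"
        by (induct I rule: infinite_finite_induct) (auto simp: comb_add, simp_all add: comb_def)
      then show ?thesis by (simp add: P_def comb_def[of "\<lambda>k. \<phi> (app (S (inv k)) x)"] lin)
    qed
    have "tr B (\<lambda>x. comb f (carrier G) (P x)) =
        (\<Sum>k\<in>carrier G. tr B (\<lambda>x. scale (\<phi> (app (S (inv k)) x)) (comb f (carrier G) (app (S k) v))))"
      unfolding comb_P by (rule tr_sum[OF B(2)]) (simp add: spanB)
    also have "\<dots> = (\<Sum>k\<in>carrier G. \<phi> (app (S (inv k)) (comb f (carrier G) (app (S k) v))))"
      by (intro sum.cong refl tr_rank_one[OF B(1,2) spanB]) (simp_all add: app_add \<phi> lin_scale S_lin)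
    also have "\<dots> = (\<Sum>k\<in>carrier G. \<Sum>g\<in>carrier G. (if g = \<one> then f \<one> else 0) - f g * f (inv k \<otimes> inv g \<otimes> k))"
    proof (rule sum.cong[OF refl])
      fix k assume k: "k \<in> carrier G"
      have "\<phi> (app (S (inv k)) (comb f (carrier G) (app (S k) v))) =
          (\<Sum>g\<in>carrier G. f g * \<phi> (app (S (inv k \<otimes> g \<otimes> k)) v))"
        using k by (simp add: S_comb S_S \<phi>_sum \<phi> cong: sum.cong)
      also have "\<dots> = (\<Sum>g\<in>carrier G. (if g = \<one> then f \<one> else 0) - f g * f (inv k \<otimes> inv g \<otimes> k))"
      proof (rule sum.cong[OF refl])
        fix g assume g: "g \<in> carrier G"
        have "inv (inv k \<otimes> inv g \<otimes> k) = inv k \<otimes> g \<otimes> k"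
          using k g by (simp add: inv_mult_group m_assoc)
        moreover have "inv k \<otimes> inv g \<otimes> k = \<one> \<longleftrightarrow> g = \<one>"
        proof
          assume "inv k \<otimes> inv g \<otimes> k = \<one>"
          then have "k \<otimes> (inv k \<otimes> inv g \<otimes> k) \<otimes> inv k = \<one>" using k by simp
          then have "inv g = \<one>" using k g by (simp add: m_assoc) (simp add: m_assoc[symmetric])
          then show "g = \<one>" using g by (metis inv_inv inv_one)
        qed (use k in simp)
        ultimately have "f (inv k \<otimes> inv g \<otimes> k) = (if g = \<one> then 1 else 0) - \<phi> (app (S (inv k \<otimes> g \<otimes> k)) v)"
          using k g by (simp add: f_def)
        then have *: "\<phi> (app (S (inv k \<otimes> g \<otimes> k)) v) = (if g = \<one> then 1 else 0) - f (inv k \<otimes> inv g \<otimes> k)"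
          by simp
        then show "f g * \<phi> (app (S (inv k \<otimes> g \<otimes> k)) v) = (if g = \<one> then f \<one> else 0) - f g * f (inv k \<otimes> inv g \<otimes> k)"
          unfolding * right_diff_distrib by simp
      qed
      finally show "\<phi> (app (S (inv k)) (comb f (carrier G) (app (S k) v))) = \<dots>" .
    qed
    also have "\<dots> = N * f \<one> - Q"
      using fin by (simp add: sum_subtractf Q_def N_def)
    finally show ?thesis .
  qed
  have "comb f (carrier G) x = comb f (carrier G) (P x)" for x
    using kill[of "x - P x"] by (simp add: P_diff P_P comb_diff)
  then have "tr B (comb f (carrier G)) = tr B (\<lambda>x. comb f (carrier G) (P x))"
    by (simp add: tr_def)
  then have Q: "Q = 0" using tr1 tr2 by simp
  define \<Phi> where "\<Phi> = (\<lambda>b. f \<otimes>\<^bsub>monoid_algebra G\<^esub> b \<otimes>\<^bsub>monoid_algebra G\<^esub> f)"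
  let ?E = "(basis_elem :: 'g \<Rightarrow> 'g \<Rightarrow> complex) ` carrier G"
  have injE: "inj_on (basis_elem :: 'g \<Rightarrow> 'g \<Rightarrow> complex) (carrier G)"
    by (rule inj_onI) (metis basis_elem_def zero_neq_one)
  have finE: "finite ?E" using fin by simp
  have indepE: "A.independent ?E"
  proof (rule A.independent_if_scalars_zero[OF finE])
    fix a x assume *: "(\<Sum>x\<in>?E. (\<lambda>m. a x * x m)) = 0" "x \<in> ?E"
    then obtain g where g: "g \<in> carrier G" "x = basis_elem g" by blast
    have "0 = (\<Sum>x\<in>?E. (\<lambda>m. a x * x m)) g" by (simp add: *(1))
    also have "\<dots> = (\<Sum>h\<in>carrier G. if h = g then a (basis_elem g) else 0)"
      unfolding sum_func_apply sum.reindex[OF injE] o_def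
      by (intro sum.cong refl) (auto simp: basis_elem_def)
    finally show "a x = 0" using g fin by simp
  qed
  have expand: "b = (\<Sum>g\<in>carrier G. (\<lambda>m. b g * basis_elem g m))" if "b \<in> carrier (monoid_algebra G)" for b
  proof
    fix m
    have "(\<Sum>g\<in>carrier G. (\<lambda>m. b g * basis_elem g m)) m = (\<Sum>g\<in>carrier G. if g = m then b m else 0)"
      unfolding sum_func_apply by (intro sum.cong refl) (auto simp: basis_elem_def)
    then show "b m = (\<Sum>g\<in>carrier G. (\<lambda>m. b g * basis_elem g m)) m"
      using that fin by (simp add: monoid_algebra_carrier_iff)
  qed
  have spanE: "A.span ?E = carrier (monoid_algebra G)"
  proof
    show "A.span ?E \<subseteq> carrier (monoid_algebra G)"
      by (rule A.span_minimal)
        (auto simp: basis_elem_def A.subspace_def monoid_algebra_carrier_iff[OF fin])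
    show "carrier (monoid_algebra G) \<subseteq> A.span ?E"
    proof
      fix b assume "b \<in> carrier (monoid_algebra G)"
      then have "b = (\<Sum>g\<in>carrier G. (\<lambda>m. b g * basis_elem g m))" by (rule expand)
      moreover have "\<dots> \<in> A.span ?E"
        by (intro A.span_sum A.span_scale A.span_base) auto
      ultimately show "b \<in> A.span ?E" by simp
    qed
  qed
  have repE: "A.representation ?E b (basis_elem g) = b g"
    if b: "b \<in> carrier (monoid_algebra G)" and g: "g \<in> carrier G" for b g
  proof -
    have "A.representation ?E b (basis_elem g) =
        (\<Sum>h\<in>carrier G. A.representation ?E (\<lambda>m. b h * basis_elem h m) (basis_elem g))"
    proof -
      have "(\<lambda>m. b h * basis_elem h m) \<in> A.span ?E" if "h \<in> carrier G" for h
        by (rule A.span_scale[OF A.span_base]) (use that in blast)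
      then show ?thesis
        by (subst expand[OF b], subst A.representation_sum[OF indepE]) auto
    qed
    also have "\<dots> = (\<Sum>h\<in>carrier G. if h = g then b g else 0)"
      using g by (intro sum.cong refl)
        (auto simp: A.representation_scale[OF indepE A.span_base] A.representation_basis[OF indepE] inj_on_eq_iff[OF injE])
    finally show ?thesis using fin g by simp
  qed
  have \<Phi>_closed: "\<Phi> b \<in> carrier (monoid_algebra G)" if "b \<in> carrier (monoid_algebra G)" for b
    using that f_in by (simp add: \<Phi>_def)
  have endo: "A.endo (A.span ?E) \<Phi>"
    unfolding A.endo_def spanE
  proof (intro conjI ballI allI)
    fix x y assume x: "x \<in> carrier (monoid_algebra G)" and y: "y \<in> carrier (monoid_algebra G)"
    have add: "a + b = a \<oplus>\<^bsub>monoid_algebra G\<^esub> b" for a b :: "'g \<Rightarrow> complex"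
      by (simp add: monoid_algebra_def fun_eq_iff)
    show "\<Phi> (x + y) = \<Phi> x + \<Phi> y"
      using f_in x y by (simp add: \<Phi>_def add R.l_distr R.r_distr)
  next
    fix a x assume x: "x \<in> carrier (monoid_algebra G)"
    show "\<Phi> (\<lambda>m. a * x m) = (\<lambda>m. a * \<Phi> x m)"
      using f_in x by (simp add: \<Phi>_def monoid_algebra_mult_scale[OF fin])
  qed (use \<Phi>_closed in auto)
  have idem: "\<Phi> (\<Phi> b) = \<Phi> b" if "b \<in> carrier (monoid_algebra G)" for b
  proof -
    have "\<Phi> (\<Phi> b) = (f \<otimes>\<^bsub>monoid_algebra G\<^esub> f) \<otimes>\<^bsub>monoid_algebra G\<^esub> b \<otimes>\<^bsub>monoid_algebra G\<^esub>
        (f \<otimes>\<^bsub>monoid_algebra G\<^esub> f)"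
      using f_in that by (simp add: \<Phi>_def R.m_assoc)
    then show ?thesis by (simp add: f_f \<Phi>_def)
  qed
  have "A.tr ?E \<Phi> = (\<Sum>g\<in>carrier G. \<Phi> (basis_elem g) g)"
    unfolding A.tr_def sum.reindex[OF injE] o_def
    by (intro sum.cong refl repE \<Phi>_closed) (auto intro: basis_elem_closed)
  also have "\<dots> = Q"
    unfolding Q_def
  proof (rule sum.cong[OF refl])
    fix g assume g: "g \<in> carrier G"
    have e: "basis_elem g \<in> carrier (monoid_algebra G)" by (rule basis_elem_closed[OF g])
    have fe: "(f \<otimes>\<^bsub>monoid_algebra G\<^esub> basis_elem g) p = f (p \<otimes> inv g)" if p: "p \<in> carrier G" for p
    proof -
      have "(f \<otimes>\<^bsub>monoid_algebra G\<^esub> basis_elem g) p = (\<Sum>q\<in>carrier G. f q * basis_elem g (inv q \<otimes> p))"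
        by (rule monoid_algebra_mult_eval[OF fin f_in e p])
      also have "\<dots> = (\<Sum>q\<in>carrier G. if q = p \<otimes> inv g then f (p \<otimes> inv g) else 0)"
      proof (rule sum.cong[OF refl])
        fix q assume q: "q \<in> carrier G"
        have "inv q \<otimes> p = g \<longleftrightarrow> q = p \<otimes> inv g"
          using p q g by (metis inv_closed inv_inv inv_solve_left inv_solve_right m_closed)
        then show "f q * basis_elem g (inv q \<otimes> p) = (if q = p \<otimes> inv g then f (p \<otimes> inv g) else 0)"
          by (auto simp: basis_elem_def)
      qed
      finally show ?thesis using fin p g by simp
    qed
    have "\<Phi> (basis_elem g) g = (\<Sum>p\<in>carrier G. f (p \<otimes> inv g) * f (inv p \<otimes> g))"
      unfolding \<Phi>_def monoid_algebra_mult_eval[OF fin R.m_closed[OF f_in e] f_in g]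
      by (intro sum.cong refl) (simp add: fe)
    also have "\<dots> = (\<Sum>h\<in>carrier G. f h * f (inv g \<otimes> inv h \<otimes> g))"
      using g by (subst sum_right_translate[OF g]) (simp add: m_assoc inv_mult_group cong: sum.cong)
    finally show "\<Phi> (basis_elem g) g = (\<Sum>h\<in>carrier G. f h * f (inv g \<otimes> inv h \<otimes> g))" .
  qed
  finally have "A.tr ?E \<Phi> = 0" using Q by simp
  then have "\<Phi> f = 0"
    using A.tr_idempotent_0[OF finE indepE endo] idem f_in by (simp add: spanE)
  then have "f = 0" by (simp add: \<Phi>_def f_f)
  then have f_zero: "f = \<zero>\<^bsub>monoid_algebra G\<^esub>" by (simp add: monoid_algebra_def fun_eq_iff)
  show ?thesis
  proof (rule exI[of _ v], unfold free_on_def, intro allI impI)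
    fix a assume "comb a (carrier G) v = 0"
    define b where "b = (\<lambda>g. if g \<in> carrier G then a g else 0)"
    have b: "b \<in> carrier (monoid_algebra G)"
      by (simp add: monoid_algebra_carrier_iff[OF fin] b_def)
    have "comb b (carrier G) v = 0"
      using \<open>comb a (carrier G) v = 0\<close> by (simp add: comb_def b_def)
    then have "b = \<zero>\<^bsub>monoid_algebra G\<^esub>"
      using absorb[OF b] f_zero b by simp
    then have "b g = 0" for g by (simp add: monoid_algebra_def)
    then show "\<forall>g\<in>carrier G. a g = 0" unfolding b_def by metis
  qed
qed

text \<open>The orbit of a free vector \<open>v\<close> is independent and has as many elements as
  the dimension, so it is a basis. The isomorphism is the inverse of a -> a v.\<close>

theorem isomorphic_to_regular: "isomorphic_to_regular G scale (\<lambda>g. app (S g))"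
proof -
  obtain v where v: "free_on v (carrier G)"
    using exists_free_vector by blast
  let ?R = "monoid_algebra G"
  define \<psi> where "\<psi> = (\<lambda>a. comb a (carrier G) v)"
  note iff = monoid_algebra_carrier_iff[OF fin]
  interpret R: ring ?R
    by (rule monoid_algebra_ring) (rule monoid_axioms)
  have \<psi>_add: "\<psi> (a \<oplus>\<^bsub>?R\<^esub> b) = \<psi> a + \<psi> b" for a b
    by (simp add: \<psi>_def comb_def monoid_algebra_def scale_left_distrib sum.distrib)
  have \<psi>_scale: "\<psi> (\<lambda>g. l * a g) = scale l (\<psi> a)" for l a
    by (simp add: \<psi>_def comb_def scale_sum_right)
  have \<psi>_mult: "\<psi> (basis_elem g \<otimes>\<^bsub>?R\<^esub> a) = app (S g) (\<psi> a)" if g: "g \<in> carrier G" and a: "a \<in> carrier ?R" for g a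
  proof -
    have "(basis_elem g \<otimes>\<^bsub>?R\<^esub> a) (g \<otimes> h) = a h" if h: "h \<in> carrier G" for h
    proof -
      have "(basis_elem g \<otimes>\<^bsub>?R\<^esub> a) (g \<otimes> h) = (\<Sum>p\<in>carrier G. basis_elem g p * a (inv p \<otimes> (g \<otimes> h)))"
        using g h by (intro monoid_algebra_mult_eval[OF fin basis_elem_closed a]) auto
      also have "\<dots> = (\<Sum>p\<in>carrier G. if p = g then a (inv g \<otimes> (g \<otimes> h)) else 0)"
        by (intro sum.cong refl) (auto simp: basis_elem_def)
      finally show ?thesis using g h fin by (simp add: m_assoc[symmetric])
    qed
    then show ?thesis
      unfolding \<psi>_def S_comb[OF subset_refl g]
      by (simp add: comb_def sum_left_translate[OF g, of "\<lambda>k. scale ((basis_elem g \<otimes>\<^bsub>?R\<^esub> a) k) (app (S k) v)"] cong: sum.cong)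
  qed
  have zero: "a = b" if ab: "a \<in> carrier ?R" "b \<in> carrier ?R" "\<psi> a = \<psi> b" for a b
  proof -
    have "comb (\<lambda>g. a g - b g) (carrier G) v = 0"
      using ab(3) by (simp add: \<psi>_def comb_def scale_left_diff_distrib sum_subtractf)
    then have "\<forall>g\<in>carrier G. a g - b g = 0" using v unfolding free_on_def by blast
    with ab(1,2) show ?thesis unfolding iff by (metis eq_iff_diff_eq_0 ext)
  qed
  have inj_orbit: "inj_on (\<lambda>g. app (S g) v) (carrier G)"
  proof (rule inj_onI)
    fix g h assume gh: "g \<in> carrier G" "h \<in> carrier G" "app (S g) v = app (S h) v"
    have "\<psi> (basis_elem k) = app (S k) v" if "k \<in> carrier G" for k
    proof -
      have "\<psi> (basis_elem k) = (\<Sum>g\<in>carrier G. if g = k then app (S k) v else 0)"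
        unfolding \<psi>_def comb_def by (intro sum.cong refl) (auto simp: basis_elem_def)
      then show ?thesis using that fin by simp
    qed
    then have "(basis_elem g :: 'g \<Rightarrow> complex) = basis_elem h"
      using gh by (intro zero) (simp_all add: basis_elem_closed)
    then show "g = h" by (metis basis_elem_def zero_neq_one)
  qed
  let ?O = "(\<lambda>g. app (S g) v) ` carrier G"
  have indep: "independent ?O"
  proof (rule independent_if_scalars_zero)
    fix f x assume *: "(\<Sum>x\<in>?O. scale (f x) x) = 0" "x \<in> ?O"
    have "comb (\<lambda>g. f (app (S g) v)) (carrier G) v = 0"
      using *(1) by (simp add: comb_def sum.reindex[OF inj_orbit])
    then show "f x = 0" using v *(2) by (auto simp: free_on_def)
  qed (simp add: fin)
  have span: "u \<in> span ?O" for u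
  proof (rule ccontr)
    assume u: "u \<notin> span ?O"
    then have "independent (insert u ?O)" using indep by (rule independent_insertI)
    then have "card (insert u ?O) \<le> card B"
      using independent_span_bound[OF B(1)] B(3) by simp
    moreover have "u \<notin> ?O" using u span_base[of u ?O] by (rule contrapos_nn)
    ultimately show False
      using fin by (simp add: B(4) card_image[OF inj_orbit])
  qed
  have surj: "u \<in> \<psi> ` carrier ?R" for u
  proof -
    have "u \<in> range (\<lambda>r. \<Sum>x\<in>?O. scale (r x) x)"
      using span[of u] span_finite[of ?O] fin by simp
    then obtain r where "u = (\<Sum>x\<in>?O. scale (r x) x)" by blast
    also have "\<dots> = \<psi> (\<lambda>g. if g \<in> carrier G then r (app (S g) v) else 0)"
      by (simp add: \<psi>_def comb_def sum.reindex[OF inj_orbit])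
    finally show ?thesis by (auto simp: iff)
  qed
  have bij: "bij_betw \<psi> (carrier ?R) UNIV"
    using zero surj by (auto simp: bij_betw_def inj_on_def)
  define \<phi> where "\<phi> = the_inv_into (carrier ?R) \<psi>"
  have \<phi>: "\<phi> u \<in> carrier ?R" "\<psi> (\<phi> u) = u" for u
    using bij the_inv_into_into[of \<psi> "carrier ?R" u "carrier ?R"] f_the_inv_into_f[of \<psi> "carrier ?R" u]
    by (auto simp: \<phi>_def bij_betw_def)
  have \<phi>_eqI: "\<phi> u = a" if "a \<in> carrier ?R" "\<psi> a = u" for u a
    using that zero \<phi> by metis
  show ?thesis
    unfolding isomorphic_to_regular_def
  proof (intro exI[of _ \<phi>] conjI allI ballI)
    show "bij_betw \<phi> UNIV (carrier ?R)"
      unfolding \<phi>_def by (rule bij_betw_the_inv_into[OF bij])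
    show "\<phi> (u + w) = \<phi> u \<oplus>\<^bsub>?R\<^esub> \<phi> w" for u w
      by (rule \<phi>_eqI) (simp_all add: \<phi> \<psi>_add)
    show "\<phi> (scale a u) = (\<lambda>g. a * \<phi> u g)" for a u
      using \<phi>(1)[of u] by (intro \<phi>_eqI) (simp_all add: \<psi>_scale \<phi>(2) iff)
    show "\<phi> (app (S g) u) = basis_elem g \<otimes>\<^bsub>?R\<^esub> \<phi> u" if "g \<in> carrier G" for g u
      using that by (intro \<phi>_eqI) (simp_all add: \<psi>_mult \<phi> basis_elem_closed)
  qed
qed

end

section \<open>Representations of the Cherednik algebra\<close>

lemma monoid_algebra_basis_mult:
  "basis_elem p \<otimes>\<^bsub>monoid_algebra M\<^esub> basis_elem q = basis_elem (p \<otimes>\<^bsub>M\<^esub> q)"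
proof
  fix m
  have "(basis_elem p \<otimes>\<^bsub>monoid_algebra M\<^esub> basis_elem q) m =
      (\<Sum>x\<in>{p}. \<Sum>y\<in>{q}. if x \<otimes>\<^bsub>M\<^esub> y = m then basis_elem p x * basis_elem q y else 0)"
    by (rule monoid_algebra_mult_superset) (auto simp: basis_elem_def)
  then show "(basis_elem p \<otimes>\<^bsub>monoid_algebra M\<^esub> basis_elem q) m = basis_elem (p \<otimes>\<^bsub>M\<^esub> q) m"
    by (auto simp: basis_elem_def)
qed

lemma skew_basis_mult:
  "basis_elem (w, \<sigma>) \<otimes>\<^bsub>skew_algebra n\<^esub> basis_elem (v, \<tau>) = basis_elem (w @ map (perm_gen \<sigma>) v, \<sigma> \<circ> \<tau>)"
  by (simp add: skew_algebra_def monoid_algebra_basis_mult) (simp add: skew_monoid_def)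

lemma skew_basis_closed:
  "set w \<subseteq> cherednik_gens n \<Longrightarrow> \<sigma> permutes {1..n} \<Longrightarrow> basis_elem (w, \<sigma>) \<in> carrier (skew_algebra n)"
  by (auto simp: skew_algebra_def skew_monoid_def sym_group_def intro!: basis_elem_closed)

lemma skew_closed:
  "i \<in> {1..n} \<Longrightarrow> skew_x i \<in> carrier (skew_algebra n)"
  "i \<in> {1..n} \<Longrightarrow> skew_y i \<in> carrier (skew_algebra n)"
  "\<sigma> permutes {1..n} \<Longrightarrow> skew_perm \<sigma> \<in> carrier (skew_algebra n)"
  "skew_scalar n a \<in> carrier (skew_algebra n)"
  by (auto simp: skew_x_def skew_y_def skew_perm_def cherednik_gens_def permutes_id intro!: skew_basis_closed)
    (simp add: skew_algebra_def skew_scalar_def scalar_elem_closed monoid_skew_monoid)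

lemma skew_algebra_decompose:
  assumes "f \<in> carrier (skew_algebra n)" "f m \<noteq> 0"
  shows "f = (skew_scalar n (f m) \<otimes>\<^bsub>skew_algebra n\<^esub> basis_elem m) \<oplus>\<^bsub>skew_algebra n\<^esub> f(m := 0)"
proof
  fix k
  have m: "m \<in> carrier (skew_monoid n)"
    using assms by (auto simp: skew_algebra_def monoid_algebra_def)
  let ?one = "\<one>\<^bsub>skew_monoid n\<^esub>"
  have "(skew_scalar n (f m) \<otimes>\<^bsub>skew_algebra n\<^esub> basis_elem m) k =
     (\<Sum>p\<in>{?one}. \<Sum>q\<in>{m}. if p \<otimes>\<^bsub>skew_monoid n\<^esub> q = k then skew_scalar n (f m) p * basis_elem m q else 0)"
    unfolding skew_algebra_def
    by (rule monoid_algebra_mult_superset) (auto simp: skew_scalar_def scalar_elem_def basis_elem_def)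
  also have "\<dots> = (if m = k then f m else 0)"
    using monoid.l_one[OF monoid_skew_monoid m] by (simp add: skew_scalar_def scalar_elem_def basis_elem_def)
  finally show "f k = ((skew_scalar n (f m) \<otimes>\<^bsub>skew_algebra n\<^esub> basis_elem m) \<oplus>\<^bsub>skew_algebra n\<^esub> f(m := 0)) k"
    by (simp add: skew_algebra_def monoid_algebra_def)
qed

section \<open>From a representation of the quotient algebra to the generators\<close>

locale cherednik_algebra_irrep =
  fixes n :: nat and c :: complex and scale :: "complex \<Rightarrow> 'v::ab_group_add \<Rightarrow> 'v"
    and \<rho> :: "skew_elem set \<Rightarrow> 'v \<Rightarrow> 'v"
  assumes n: "n \<ge> 1" and c: "c \<noteq> 0"
    and irrep: "irreducible_representation (cherednik_algebra n c) (cherednik_scalar n c) scale \<rho>"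
begin

abbreviation A :: "skew_elem ring" where "A \<equiv> skew_algebra n"

sublocale A: ring A
  by (rule ring_skew_algebra)

lemma rep: "representation (cherednik_algebra n c) (cherednik_scalar n c) scale \<rho>"
  using irrep by (simp add: irreducible_representation_def)

sublocale complex_space scale
  using rep by (simp add: representation_def complex_space_def)

definition \<theta> :: "skew_elem \<Rightarrow> 'v \<Rightarrow> 'v" where
  "\<theta> f = \<rho> (cherednik_class n c f)"

lemma class_hom: "cherednik_class n c \<in> ring_hom A (cherednik_algebra n c)"
  using ideal.rcos_ring_hom[OF ideal_cherednik_ideal, of n c]
  by (simp add: cherednik_class_def[abs_def] cherednik_algebra_def)

lemma \<theta>_hom: "\<theta> \<in> ring_hom A (End_ring scale)"
proof -
  have "\<rho> \<in> ring_hom (cherednik_algebra n c) (End_ring scale)"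
    using rep by (simp add: Defs.representation_def)
  from ring_hom_trans[OF class_hom this] show ?thesis
    by (simp add: \<theta>_def[abs_def] o_def)
qed

definition T :: "skew_elem \<Rightarrow> 'v aend" where
  "T f = Aend (\<theta> f)"

lemma \<theta>_linear: "f \<in> carrier A \<Longrightarrow> Vector_Spaces.linear scale scale (\<theta> f)"
  using ring_hom_closed[OF \<theta>_hom] by (simp add: End_ring_def)

lemma app_T: "f \<in> carrier A \<Longrightarrow> app (T f) = \<theta> f"
  unfolding T_def using \<theta>_linear by (intro app_Aend) (auto simp: Vector_Spaces.linear_iff)

lemma T_lin: "f \<in> carrier A \<Longrightarrow> lin (T f)"
  using \<theta>_linear by (auto simp: lin_def app_T Vector_Spaces.linear_iff)

lemma T_mult: "f \<in> carrier A \<Longrightarrow> g \<in> carrier A \<Longrightarrow> T (f \<otimes>\<^bsub>A\<^esub> g) = T f * T g"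
  using ring_hom_mult[OF \<theta>_hom, of f g] by (intro aend_eqI) (simp add: app_T End_ring_def)

lemma T_add: "f \<in> carrier A \<Longrightarrow> g \<in> carrier A \<Longrightarrow> T (f \<oplus>\<^bsub>A\<^esub> g) = T f + T g"
  using ring_hom_add[OF \<theta>_hom, of f g] by (intro aend_eqI) (simp add: app_T End_ring_def)

lemma T_one: "T \<one>\<^bsub>A\<^esub> = 1"
  using ring_hom_one[OF \<theta>_hom] by (intro aend_eqI) (simp add: app_T End_ring_def)

lemma T_zero: "T \<zero>\<^bsub>A\<^esub> = 0"
  using T_add[of "\<zero>\<^bsub>A\<^esub>" "\<zero>\<^bsub>A\<^esub>"] by simp

lemma T_minus: "f \<in> carrier A \<Longrightarrow> g \<in> carrier A \<Longrightarrow> T (f \<ominus>\<^bsub>A\<^esub> g) = T f - T g"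
  using T_add[of g "\<ominus>\<^bsub>A\<^esub> g"] T_add[of f "\<ominus>\<^bsub>A\<^esub> g"]
  by (simp add: A.r_neg T_zero A.minus_eq eq_neg_iff_add_eq_0[symmetric] add.commute)

lemma T_finsum:
  "finite I \<Longrightarrow> (\<And>i. i \<in> I \<Longrightarrow> f i \<in> carrier A) \<Longrightarrow> T (finsum A f I) = (\<Sum>i\<in>I. T (f i))"
proof (induct I rule: finite_induct)
  case (insert i I)
  then show ?case by (subst A.finsum_insert) (auto simp: T_add)
qed (simp add: T_zero)

lemma T_scalar: "T (skew_scalar n a) = sc a"
proof -
  have "\<theta> (skew_scalar n a) = scale a"
    using rep by (simp add: \<theta>_def Defs.representation_def cherednik_scalar_def)
  then show ?thesis
    by (intro aend_eqI) (simp add: app_T skew_closed app_sc)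
qed

lemma T_relator: assumes "r \<in> cherednik_relators n c" shows "T r = 0"
proof -
  interpret I: ideal "cherednik_ideal n c" A
    by (rule ideal_cherednik_ideal)
  have r: "r \<in> carrier A" using assms cherednik_relators_closed by blast
  have "r \<in> cherednik_ideal n c"
    unfolding cherednik_ideal_def using A.genideal_self[OF cherednik_relators_closed] assms by blast
  then have "cherednik_class n c r = cherednik_class n c \<zero>\<^bsub>A\<^esub>"
    unfolding cherednik_class_def by (metis I.a_rcos_const A.zero_closed I.zero_closed)
  then have "T r = T \<zero>\<^bsub>A\<^esub>" by (simp add: T_def \<theta>_def)
  then show ?thesis by (simp add: T_zero)
qed

definition tX :: "nat \<Rightarrow> 'v aend" where "tX i = T (skew_x i)"
definition tY :: "nat \<Rightarrow> 'v aend" where "tY i = T (skew_y i)"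
definition tS :: "(nat \<Rightarrow> nat) \<Rightarrow> 'v aend" where "tS \<sigma> = T (skew_perm \<sigma>)"

lemma T_commutator: "f \<in> carrier A \<Longrightarrow> g \<in> carrier A \<Longrightarrow> T (commutator A f g) = T f * T g - T g * T f"
  by (simp add: commutator_def T_minus T_mult)

lemma cherednik_rep_T: "cherednik_rep n c sc tX tY tS"
proof
  fix \<sigma> i assume \<sigma>: "\<sigma> permutes {1..n}" and i: "i \<in> {1..n}"
  have \<sigma>i: "\<sigma> i \<in> {1..n}" using \<sigma> i by (simp only: permutes_in_image)
  have "skew_perm \<sigma> \<otimes>\<^bsub>A\<^esub> skew_x i = skew_x (\<sigma> i) \<otimes>\<^bsub>A\<^esub> skew_perm \<sigma>"
    "skew_perm \<sigma> \<otimes>\<^bsub>A\<^esub> skew_y i = skew_y (\<sigma> i) \<otimes>\<^bsub>A\<^esub> skew_perm \<sigma>"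
    by (simp_all add: skew_perm_def skew_x_def skew_y_def skew_basis_mult)
  then show "tS \<sigma> * tX i = tX (\<sigma> i) * tS \<sigma>" "tS \<sigma> * tY i = tY (\<sigma> i) * tS \<sigma>"
    unfolding tX_def tY_def tS_def
    using \<sigma> i \<sigma>i by (simp_all only: T_mult[symmetric] skew_closed)
next
  fix \<sigma> \<tau> assume "\<sigma> permutes {1..n}" "\<tau> permutes {1..n}"
  moreover have "skew_perm (\<sigma> \<circ> \<tau>) = skew_perm \<sigma> \<otimes>\<^bsub>A\<^esub> skew_perm \<tau>"
    by (simp add: skew_perm_def skew_basis_mult)
  ultimately show "tS (\<sigma> \<circ> \<tau>) = tS \<sigma> * tS \<tau>"
    by (simp add: tS_def T_mult skew_closed)
next
  have "skew_perm id = \<one>\<^bsub>A\<^esub>"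
    by (simp add: skew_perm_def basis_elem_def skew_algebra_def monoid_algebra_def skew_monoid_def)
  then show "tS id = 1" by (simp add: tS_def T_one)
next
  fix i j assume i: "i \<in> {1..n}" and j: "j \<in> {1..n}"
  have "T (commutator A (skew_x i) (skew_x j)) = 0" "T (commutator A (skew_y i) (skew_y j)) = 0"
    using i j by (intro T_relator; unfold cherednik_relators_def; blast)+
  then show "tX i * tX j = tX j * tX i" "tY i * tY j = tY j * tY i"
    using i j by (simp_all add: T_commutator skew_closed tX_def tY_def)
  assume ne: "i \<noteq> j"
  have "T (commutator A (skew_y i) (skew_x j) \<ominus>\<^bsub>A\<^esub>
       skew_scalar n c \<otimes>\<^bsub>A\<^esub> skew_perm (Transposition.transpose i j)) = 0"
    using i j ne by (intro T_relator) (unfold cherednik_relators_def, blast)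
  moreover have "Transposition.transpose i j permutes {1..n}" using i j by (rule permutes_swap_id)
  ultimately show "tY i * tX j = tX j * tY i + sc c * tS (Transposition.transpose i j)"
    using i j
    by (simp add: T_minus T_commutator T_mult T_scalar skew_closed commutator_closed ring_skew_algebra tX_def tY_def tS_def algebra_simps)
next
  fix i assume i: "i \<in> {1..n}"
  let ?s = "\<lambda>j. skew_perm (Transposition.transpose i j)"
  have s: "?s j \<in> carrier A" if "j \<in> {1..n} - {i}" for j
    using that permutes_swap_id[OF i, of j] by (simp add: skew_closed)
  have "T (commutator A (skew_y i) (skew_x i) \<ominus>\<^bsub>A\<^esub> skew_scalar n (- c) \<otimes>\<^bsub>A\<^esub>
      (\<Oplus>\<^bsub>A\<^esub> j \<in> {1..n} - {i}. ?s j)) = 0"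
    using i by (intro T_relator) (unfold cherednik_relators_def, blast)
  moreover have "(\<Oplus>\<^bsub>A\<^esub> j \<in> {1..n} - {i}. ?s j) \<in> carrier A"
    using s by (intro A.finsum_closed) blast
  moreover have "T (\<Oplus>\<^bsub>A\<^esub> j \<in> {1..n} - {i}. ?s j) = (\<Sum>j\<in>{1..n} - {i}. tS (Transposition.transpose i j))"
    unfolding tS_def by (rule T_finsum) (use s in auto)
  moreover have "sc (- c) = - sc c"
    using sc_diff[of 0 c] by (simp add: sc_0)
  ultimately show "tY i * tX i = tX i * tY i - sc c * (\<Sum>j\<in>{1..n} - {i}. tS (Transposition.transpose i j))"
    using i by (simp add: T_minus T_commutator T_mult T_scalar skew_closed commutator_closed ring_skew_algebra tX_def tY_def
        algebra_simps)
qed (use T_lin skew_closed in \<open>auto simp: sc_add sc_mult sc_1 lin_iff tX_def tY_def tS_def\<close>)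

text \<open>Irreducibility is given for the whole algebra, but only generators are under control.
  Invariance spreads to words by induction on their length, and then to all elements by splitting
  off one term at a time.\<close>

lemma invariant_subspace:
  assumes W: "subspace W" and X: "\<And>i w. i \<in> {1..n} \<Longrightarrow> w \<in> W \<Longrightarrow> app (tX i) w \<in> W"
    and Y: "\<And>i w. i \<in> {1..n} \<Longrightarrow> w \<in> W \<Longrightarrow> app (tY i) w \<in> W"
    and S: "\<And>\<sigma> w. \<sigma> permutes {1..n} \<Longrightarrow> w \<in> W \<Longrightarrow> app (tS \<sigma>) w \<in> W"
  shows "W = {0} \<or> W = UNIV"
proof -
  have basis: "app (T (basis_elem (w, \<sigma>))) v \<in> W" if "set w \<subseteq> cherednik_gens n" "\<sigma> permutes {1..n}" "v \<in> W" for w \<sigma> v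
    using that(1)
  proof (induct w)
    case Nil
    then show ?case using S[OF that(2,3)] by (simp add: tS_def skew_perm_def)
  next
    case (Cons x w)
    have "basis_elem (x # w, \<sigma>) = basis_elem ([x], id) \<otimes>\<^bsub>A\<^esub> basis_elem (w, \<sigma>)"
      by (simp add: skew_basis_mult perm_gen_id)
    then have "T (basis_elem (x # w, \<sigma>)) = T (basis_elem ([x], id)) * T (basis_elem (w, \<sigma>))"
      using Cons(2) that(2) by (simp add: T_mult skew_basis_closed permutes_id)
    moreover have "app (T (basis_elem ([x], id))) u \<in> W" if "u \<in> W" for u
      using Cons(2) X Y that by (auto simp: cherednik_gens_def tX_def tY_def skew_x_def skew_y_def)
    ultimately show ?case using Cons by simp
  qed
  have all: "app (T f) v \<in> W" if v: "v \<in> W" and f: "f \<in> carrier A" for f v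
    using f
  proof (induct "card {m. f m \<noteq> 0}" arbitrary: f)
    case 0
    then have "f = \<zero>\<^bsub>A\<^esub>" by (auto simp: skew_algebra_def monoid_algebra_def)
    then show ?case using W by (simp add: T_zero subspace_0)
  next
    case (Suc k)
    have fin: "finite {m. f m \<noteq> 0}" using Suc(3) by (simp add: skew_algebra_def monoid_algebra_def)
    have "{m. f m \<noteq> 0} \<noteq> {}" using Suc(2) by (metis card.empty nat.distinct(1))
    then obtain m where m: "f m \<noteq> 0" by blast
    obtain w \<sigma> where w: "m = (w, \<sigma>)" by (cases m)
    have mem: "set w \<subseteq> cherednik_gens n" "\<sigma> permutes {1..n}"
      using m Suc(3) by (auto simp: w skew_algebra_def monoid_algebra_def skew_monoid_def sym_group_def)
    let ?g = "f(m := 0)"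
    have supp: "{k. ?g k \<noteq> 0} = {k. f k \<noteq> 0} - {m}" by auto
    have "finite {k. ?g k \<noteq> 0}" "{k. ?g k \<noteq> 0} \<subseteq> carrier (skew_monoid n)"
      unfolding supp using fin Suc(3) by (auto simp: skew_algebra_def monoid_algebra_def)
    then have g: "?g \<in> carrier A"
      by (simp add: skew_algebra_def monoid_algebra_def del: fun_upd_apply)
    have "k = card {k. ?g k \<noteq> 0}"
      unfolding supp using Suc(2) m fin by simp
    then have "app (T ?g) v \<in> W" using Suc(1) g by blast
    moreover have "T f = sc (f m) * T (basis_elem m) + T ?g"
      using skew_algebra_decompose[OF Suc(3) m] mem g
      by (metis A.m_closed T_add T_mult T_scalar skew_basis_closed skew_closed(4) w)
    ultimately show ?case
      using W basis[OF mem v] by (simp add: app_sc w subspace_add subspace_scale)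
  qed
  have "\<rho> a ` W \<subseteq> W" if a: "a \<in> carrier (cherednik_algebra n c)" for a
  proof -
    obtain f where f: "f \<in> carrier A" "a = cherednik_class n c f"
      using a by (auto simp: cherednik_algebra_def FactRing_def A_RCOSETS_def' cherednik_class_def)
    then have "\<rho> a = app (T f)" by (simp add: app_T \<theta>_def)
    then show ?thesis using all f by auto
  qed
  then show ?thesis
    using irrep W by (simp add: irreducible_representation_def)
qed

sublocale cherednik_irrep scale n c tX tY tS
proof (intro cherednik_irrep.intro cherednik_irrep_axioms.intro)
  show "\<exists>v::'v. v \<noteq> 0" using irrep by (simp add: irreducible_representation_def)
qed (use n c invariant_subspace cherednik_rep_T complex_space_axioms in auto)

lemma regular: "isomorphic_to_regular (sym_group n) scale (\<lambda>\<sigma>. \<rho> (cherednik_perm n c \<sigma>))"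
proof -
  interpret G: group "sym_group n" by (rule sym_group_is_group)
  interpret traceless_group_action scale "sym_group n" tS basis
  proof
    show "finite (carrier (sym_group n))"
      using finite_perms by (simp add: sym_group_def)
    show "tS \<one>\<^bsub>sym_group n\<^esub> = 1" using S_id by (simp add: sym_group_def)
    show "card basis = card (carrier (sym_group n))"
      using card_basis by (simp add: sym_group_card_carrier)
    fix g assume g: "g \<in> carrier (sym_group n)"
    then show "lin (tS g)" using lin_normal_span normal_span_S_in by (simp add: sym_group_def)
    show "tr basis (app (tS g)) = 0" if "g \<noteq> \<one>\<^bsub>sym_group n\<^esub>"
      using trace_S[of g] g that by (simp add: sym_group_def trace_def)
    show "tS (g \<otimes>\<^bsub>sym_group n\<^esub> h) = tS g * tS h" if "h \<in> carrier (sym_group n)" for h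
      using S_comp[of g h] g that by (simp add: sym_group_def)
  qed (use basis in auto)
  have "app (tS \<sigma>) = \<rho> (cherednik_perm n c \<sigma>)" if "\<sigma> \<in> carrier (sym_group n)" for \<sigma>
    using that by (simp add: tS_def app_T skew_closed sym_group_def \<theta>_def cherednik_perm_def)
  then show ?thesis
    using isomorphic_to_regular by (simp add: isomorphic_to_regular_def)
qed

end

theorem theorem10p6:
  fixes n :: nat and c :: complex
    and scale :: "complex \<Rightarrow> 'v::ab_group_add \<Rightarrow> 'v"
    and \<rho> :: "skew_elem set \<Rightarrow> 'v \<Rightarrow> 'v"
  assumes "n \<ge> 1" and "c \<noteq> 0"
    and "irreducible_representation (cherednik_algebra n c) (cherednik_scalar n c) scale \<rho>"
  shows "vector_space.dim scale (UNIV :: 'v set) = fact n \<and>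
    isomorphic_to_regular (sym_group n) scale (\<lambda>\<sigma>. \<rho> (cherednik_perm n c \<sigma>))"
proof -
  interpret cherednik_algebra_irrep n c scale \<rho>
    using assms by unfold_locales
  show ?thesis
    using dim_UNIV regular by simp
qed

end
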